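(* Suppose that $\theta_x\neq0$ and $\sigma=\sigma_0:=-2\theta_x-\theta_\infty$. Let $\delta$ be a given positive number with $\delta<\pi/2$, let $\tilde B\subset\mathbb C$ be a given bounded domain and $B_0\subset\mathbb C\setminus\{0\}$ a given bounded domain. Then the system $$x\frac{dA_0}{dx}=[A_x,A_0],\qquad x\frac{dA_x}{dx}=[A_0,A_x]+\frac x2[J,A_x]\qquad(\mathrm S)$$ admits a two-parameter family of solutions $\{(A_0(\mathbf c,x),A_x(\mathbf c,x));\ \mathbf c=(c_0,c_x)\in B_0\times\tilde B\}$, $A_0=f_0J+f_+\Delta_++f_-\Delta_-$, $A_x=g_0J+g_+\Delta_++g_-\Delta_-$, such that the entries are holomorphic in $(\mathbf c,x)\in B_0\times\tilde B\times\Sigma_*(\varepsilon,x_\infty,\delta)$ and are represented by the following convergent series in powers of $e^xx^{\sigma_0-1}$, where $\gamma^0_{+*}=\frac{c_0}2(\theta_0-\theta_x-\theta_\infty)$, $\gamma^0_{-*}=\frac{c_0^{-1}}2(\theta_0+\theta_x+\theta_\infty)$, $\gamma^x_{+*}=c_x\theta_x$: $$\begin{aligned} f_0={}&-\tfrac{\theta_x+\theta_\infty}2+\theta_x\gamma^0_{+*}\gamma^0_{-*}x^{-2}+[x^{-3}]+\gamma^0_{-*}\gamma^x_{+*}(1+[x^{-1}])e^xx^{\sigma_0-1}+\sum_{n\ge2}(\gamma^0_{-*}\gamma^x_{+*})^n[x^{-n+1}](e^xx^{\sigma_0-1})^n,\\ g_0={}&-\theta_\infty/2-f_0,\\ x^{-\theta_x}f_+={}&\gamma^0_{+*}(1+[x^{-1}])+\gamma^x_{+*}(\theta_x+\theta_\infty+[x^{-1}])e^xx^{\sigma_0-1}-\gamma^0_{-*}(\gamma^x_{+*})^2(1+[x^{-1}])(e^xx^{\sigma_0-1})^2\\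 &+\sum_{n\ge3}\gamma^x_{+*}(\gamma^0_{-*}\gamma^x_{+*})^{n-1}[x^{-n+2}](e^xx^{\sigma_0-1})^n,\\ e^{-x}x^{\theta_x+\theta_\infty}g_+={}&\gamma^x_{+*}(1+[x^{-1}])+2\gamma^0_{-*}(\gamma^x_{+*})^2(1+[x^{-1}])e^xx^{\sigma_0-2}+\sum_{n\ge2}\gamma^x_{+*}(\gamma^0_{-*}\gamma^x_{+*})^n[x^{-n}](e^xx^{\sigma_0-1})^n\\ &+\gamma^0_{+*}(\theta_x+[x^{-1}])e^{-x}x^{-\sigma_0-1},\\ x^{\theta_x}f_-={}&\gamma^0_{-*}(1+[x^{-1}])+2(\gamma^0_{-*})^2\gamma^x_{+*}(1+[x^{-1}])e^xx^{\sigma_0-2}+\sum_{n\ge2}\gamma^0_{-*}(\gamma^0_{-*}\gamma^x_{+*})^n[x^{-n}](e^xx^{\sigma_0-1})^n,\\ e^xx^{-\theta_x-\theta_\infty}g_-={}&\gamma^0_{-*}(\theta_x+[x^{-1}])e^xx^{\sigma_0-1}-(\gamma^0_{-*})^2\gamma^x_{+*}(1+[x^{-1}])(e^xx^{\sigma_0-1})^2\\ &+\sum_{n\ge3}\gamma^0_{-*}(\gamma^0_{-*}\gamma^x_{+*})^{n-1}[x^{-n+2}](e^xx^{\sigma_0-1})^n. \end{aligned}$$ Here $\varepsilon=\varepsilon(B_0,\tilde B,\delta)$ (resp. $x_\infty=x_\infty(B_0,\tilde B,\delta)$) is a sufficiently small (resp. large) positive number depending on $(B_0,\tilde B,\delta)$,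 and the asymptotic series for $[x^{-1}],[x^{-n}],\dots$ are valid uniformly in $\mathbf c\in B_0\times\tilde B$ as $x$ tends to $\infty$ through the sector $-(\pi/2-\delta)<\arg x-\pi/2<\pi-\delta$, $|x|>x_\infty$, with coefficients in $\mathbb Q[\theta_0,\theta_x,\theta_\infty,c_0,c_0^{-1},c_x]$. In addition to $\sigma=\sigma_0$, if $c_x=0$, then $(\mathrm S)$ admits a one-parameter family of solutions $\{(A_0(c_0,x),A_x(c_0,x));\ c_0\in B_0\}$, $A_0=f_0J+f_+\Delta_++f_-\Delta_-$, $A_x=g_0J+g_+\Delta_++g_-\Delta_-$, whose entries are holomorphic in $(c_0,x)\in B_0\times\Sigma_{**}(x_\infty,\delta)$ for some $x_\infty=x_\infty(B_0,\delta)$, and are represented by the asymptotic series $$\begin{aligned} &f_0=-\tfrac{\theta_x+\theta_\infty}2+\tfrac{\theta_x}4\big(\theta_0^2-(\theta_x+\theta_\infty)^2\big)x^{-2}+[x^{-3}],\qquad g_0=-\theta_\infty/2-f_0,\\ &x^{-\theta_x}f_+=c_0(\theta_0-\theta_x-\theta_\infty)\big(\tfrac12+[x^{-1}]\big),\qquad x^{-\theta_x+1}g_+=c_0(\theta_0-\theta_x-\theta_\infty)\big(\tfrac{\theta_x}2+[x^{-1}]\big),\\ &x^{\theta_x}f_-=c_0^{-1}(\theta_0+\theta_x+\theta_\infty)\big(\tfrac12+[x^{-1}]\big),\qquad x^{\theta_x+1}g_-=c_0^{-1}(\theta_0+\theta_x+\theta_\infty)\big(\tfrac{\theta_x}2+[x^{-1}]\big),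 \end{aligned}$$ uniformly in $c_0\in B_0$ as $x$ tends to $\infty$ through $\Sigma_{**}(x_\infty,\delta)$, the coefficients of $[x^{-1}],\dots$ being in $\mathbb Q[\theta_0,\theta_x,\theta_\infty,c_0,c_0^{-1}]$.
   Context: $\theta_0,\theta_x,\theta_\infty\in\mathbb C$ are fixed. $J=\mathrm{diag}[1,-1]$, $\Delta_+=\begin{pmatrix}0&1\\0&0\end{pmatrix}$, $\Delta_-=\begin{pmatrix}0&0\\1&0\end{pmatrix}$; $A_0,A_x$ are $2\times2$ matrix functions of $x$. $\mathcal R(\mathbb C\setminus\{0\})$ is the universal covering of $\mathbb C\setminus\{0\}$; powers $x^a$ are defined on it via $\log x=\log|x|+i\arg x$. Domains in $\mathcal R(\mathbb C\setminus\{0\})$: $$\Sigma_*(\varepsilon,x_\infty,\delta):\ -(\pi/2-\delta)<\arg x-\pi/2<\pi-\delta,\quad |e^xx^{\sigma_0-1}|<\varepsilon,\quad |x|>x_\infty;$$ $$\Sigma_{**}(x_\infty,\delta):\ |\arg x-\pi/2|<\pi-\delta,\quad |x|>x_\infty.$$ For an integer $k\ge0$, $[x^{-k}]$ denotes a holomorphic function (possibly different at each occurrence) of the parameters and $x$ admitting an asymptotic representation $x^{-k}\sum_{j\ge0}f_jx^{-j}$, with coefficients $f_j$ (not necessarily nonzero) in the indicated ring, as $x\to\infty$ through the indicated sector.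
   Formalization: For the two-parameter family, B_0 is additionally required to stay away from 0 (0 not in the closure of B_0, so c_0^{-1} is bounded); otherwise uniform ε and x_∞ generally fail because poles enter Σ_*. The one-parameter part is unchanged. *)

theory Defs
  imports "HOL-Analysis.Analysis"
begin

text \<open>
  The universal covering of the punctured plane is represented by the complex plane through
  the global coordinate z = log x. Thus a point z lies over x = exp z, its modulus is
  norm (exp z), its argument is Im z, a power of x with exponent a is exp (a * z), a function
  is holomorphic in x iff it is holomorphic in z, and the operator x d/dx is d/dz.
\<close>

definition xpow :: "complex \<Rightarrow> complex \<Rightarrow> complex" where
  "xpow z a = exp (a * z)"

definition expx :: "complex \<Rightarrow> complex" where
  "expx z = exp (exp z)"

definition sector_star :: "real \<Rightarrow> real \<Rightarrow> complex set" where
  "sector_star xinf \<delta> =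
     {z. - (pi/2 - \<delta>) < Im z - pi/2 \<and> Im z - pi/2 < pi - \<delta> \<and> norm (exp z) > xinf}"

definition Sigma_star :: "complex \<Rightarrow> real \<Rightarrow> real \<Rightarrow> real \<Rightarrow> complex set" where
  "Sigma_star \<sigma>0 \<epsilon> xinf \<delta> =
     {z. - (pi/2 - \<delta>) < Im z - pi/2 \<and> Im z - pi/2 < pi - \<delta> \<and>
         norm (expx z * xpow z (\<sigma>0 - 1)) < \<epsilon> \<and> norm (exp z) > xinf}"

definition Sigma_dstar :: "real \<Rightarrow> real \<Rightarrow> complex set" where
  "Sigma_dstar xinf \<delta> = {z. \<bar>Im z - pi/2\<bar> < pi - \<delta> \<and> norm (exp z) > xinf}"

definition J_mat :: "complex^2^2" where
  "J_mat = vector [vector [1, 0], vector [0, -1]]"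

definition Delta_plus :: "complex^2^2" where
  "Delta_plus = vector [vector [0, 1], vector [0, 0]]"

definition Delta_minus :: "complex^2^2" where
  "Delta_minus = vector [vector [0, 0], vector [1, 0]]"

definition sl2_mat :: "complex \<Rightarrow> complex \<Rightarrow> complex \<Rightarrow> complex^2^2" where
  "sl2_mat a b c = (\<chi> i j. a * J_mat$i$j + b * Delta_plus$i$j + c * Delta_minus$i$j)"

definition mcomm :: "complex^2^2 \<Rightarrow> complex^2^2 \<Rightarrow> complex^2^2" where
  "mcomm A B = A ** B - B ** A"

text \<open>The system (S), read entrywise; the derivative with respect to z is x d/dx.\<close>

definition solves_S :: "(complex \<Rightarrow> complex^2^2) \<Rightarrow> (complex \<Rightarrow> complex^2^2) \<Rightarrow> complex set \<Rightarrow> bool" where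
  "solves_S A0 Ax U \<longleftrightarrow> (\<forall>z\<in>U. \<forall>i j.
     ((\<lambda>w. A0 w $ i $ j) has_field_derivative mcomm (Ax z) (A0 z) $ i $ j) (at z) \<and>
     ((\<lambda>w. Ax w $ i $ j) has_field_derivative
        (mcomm (A0 z) (Ax z) $ i $ j + exp z / 2 * mcomm J_mat (Ax z) $ i $ j)) (at z))"

text \<open>
  Joint holomorphy in one (respectively two) parameters and z, on open sets: the total
  derivative exists at every point and is complex linear.
\<close>

definition holo1 :: "complex set \<Rightarrow> complex set \<Rightarrow> (complex \<Rightarrow> complex \<Rightarrow> complex) \<Rightarrow> bool" where
  "holo1 B U h \<longleftrightarrow> (\<forall>c\<in>B. \<forall>z\<in>U. \<exists>p q.
     ((\<lambda>(c, z). h c z) has_derivative (\<lambda>(u, w). p * u + q * w)) (at (c, z)))"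

definition holo2 ::
  "(complex \<times> complex) set \<Rightarrow> complex set \<Rightarrow> (complex \<times> complex \<Rightarrow> complex \<Rightarrow> complex) \<Rightarrow> bool" where
  "holo2 B U h \<longleftrightarrow> (\<forall>c\<in>B. \<forall>z\<in>U. \<exists>p q r.
     ((\<lambda>(c, z). h c z) has_derivative (\<lambda>((u, v), w). p * u + q * v + r * w)) (at (c, z)))"

text \<open>The ring of functions of the parameters generated by a set of functions over the rationals.\<close>

inductive_set rat_ring :: "('p \<Rightarrow> complex) set \<Rightarrow> ('p \<Rightarrow> complex) set"
  for G :: "('p \<Rightarrow> complex) set" where
  rat: "q \<in> \<rat> \<Longrightarrow> (\<lambda>_. q) \<in> rat_ring G"
| gen: "g \<in> G \<Longrightarrow> g \<in> rat_ring G"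
| add: "f \<in> rat_ring G \<Longrightarrow> g \<in> rat_ring G \<Longrightarrow> (\<lambda>c. f c + g c) \<in> rat_ring G"
| mult: "f \<in> rat_ring G \<Longrightarrow> g \<in> rat_ring G \<Longrightarrow> (\<lambda>c. f c * g c) \<in> rat_ring G"

text \<open>
  The asymptotic representation of h by the power of x with exponent -k times the sum of all
  f j c * (power of x with exponent -j), as x tends to infinity through U, uniformly for c in B,
  with the coefficients f j in R. The leading coefficient may vanish.
\<close>

definition unif_asymp ::
  "('p \<Rightarrow> complex) set \<Rightarrow> 'p set \<Rightarrow> complex set \<Rightarrow> nat \<Rightarrow> ('p \<Rightarrow> complex \<Rightarrow> complex) \<Rightarrow> bool" where
  "unif_asymp R B U k h \<longleftrightarrow> (\<exists>f. (\<forall>j::nat. f j \<in> R) \<and>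
     (\<forall>N::nat. \<exists>K r::real. \<forall>c\<in>B. \<forall>z\<in>U. norm (exp z) > r \<longrightarrow>
        norm (h c z - xpow z (- of_nat k) * (\<Sum>j<N. f j c * xpow z (- of_nat j)))
          \<le> K / norm (exp z) ^ (k + N)))"

text \<open>
  The functions written as a bracketed power of x with exponent -k, for the parameter c0 and for
  the parameters (c0, cx). They live on the whole sector U, without the smallness condition
  on exp x times a power of x that restricts the solutions themselves.
\<close>

definition bracket1 ::
  "complex \<Rightarrow> complex \<Rightarrow> complex \<Rightarrow> complex set \<Rightarrow> complex set \<Rightarrow> nat \<Rightarrow>
   (complex \<Rightarrow> complex \<Rightarrow> complex) \<Rightarrow> bool" where
  "bracket1 \<theta>0 \<theta>x \<theta>inf B U k h \<longleftrightarrow> holo1 B U h \<and>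
     unif_asymp (rat_ring {\<lambda>_. \<theta>0, \<lambda>_. \<theta>x, \<lambda>_. \<theta>inf, \<lambda>c0. c0, \<lambda>c0. inverse c0}) B U k h"

definition bracket2 ::
  "complex \<Rightarrow> complex \<Rightarrow> complex \<Rightarrow> (complex \<times> complex) set \<Rightarrow> complex set \<Rightarrow> nat \<Rightarrow>
   (complex \<times> complex \<Rightarrow> complex \<Rightarrow> complex) \<Rightarrow> bool" where
  "bracket2 \<theta>0 \<theta>x \<theta>inf B U k h \<longleftrightarrow> holo2 B U h \<and>
     unif_asymp (rat_ring {\<lambda>_. \<theta>0, \<lambda>_. \<theta>x, \<lambda>_. \<theta>inf,
        \<lambda>(c0, cx). c0, \<lambda>(c0, cx). inverse c0, \<lambda>(c0, cx). cx}) B U k h"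

end

theory Submission
  imports Defs "HOL-Complex_Analysis.Complex_Analysis"
begin

text \<open>
  Put \<^term>\<open>X = exp z\<close>. Conjugation by diagonal matrices scales \<^term>\<open>c0\<close> away, and the solution becomes
  a power series in w, a constant times \<^term>\<open>E z / X\<close>, whose coefficients depend on X only.
  The coefficients solve a quadratic system of ordinary differential equations in X whose linear
  parts have the integer rates n for the modes \<^term>\<open>exp (- n * X)\<close>. On the complement D of a downward
  cone, each equation is inverted by integration to infinity along a ray of one of two fixed
  directions, one with increasing and one with decreasing real part; D is closed under translation in both
  directions. Far from the origin the whole infinite system is a contraction for sup norms with
  weights of geometric growth in n, which gives existence and convergence at once. Feeding the
  solution into the equations again improves an expansion in powers of 1/X by one order, so all
  expansions exist, with coefficients in any ring containing the parameters and the rationals.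
\<close>

section \<open>Linear equations on a domain closed under two translations\<close>

text \<open>The exponents pulled out of the entries and the value of \<open>sg\<close> are such that
  the equations of rate 0 contain no term of order 1/x. Their right sides are integrable at
  infinity, so \<open>IA\<close>, \<open>Iph 0\<close> and \<open>Iq 0\<close> have limits there;
  these are normalised to 1, and the free constants sit in the factors \<open>gpl\<close>,
  \<open>gmi\<close>, \<open>gxp\<close>. The entries f+ and g+ mix two such constants, hence they
  are split into a part with factor \<open>gpl\<close>, free of exponentials, and a series with
  factor \<open>gxp\<close>. The product of the former part with f0 feeds mode n + 1 of f0 into mode
  n of that series, with \<open>gpl * gmi = ka\<close>. The modes therefore cannot be found one
  after the other. The coupling to the next mode is merely small for large X, which is why one
  contraction treats the infinite system and why all expansions are raised together. The single
  negative rate, that of \<open>IB\<close>, calls for the second ray direction. A separate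
  difficulty is the x^(-2) term of f0: the leading parts of its source cancel, so the next
  coefficients of two combinations of unknowns are needed.\<close>

lemma ray_difference_bound:
  fixes v :: "real \<Rightarrow> complex" and \<tau> \<tau>' :: "real \<Rightarrow> real"
  assumes v: "\<And>r. 0 \<le> r \<Longrightarrow> (v has_vector_derivative v' r) (at r)"
    and \<tau>: "\<And>r. 0 \<le> r \<Longrightarrow> (\<tau> has_real_derivative \<tau>' r) (at r)"
    and le: "\<And>r. 0 \<le> r \<Longrightarrow> norm (v' r) \<le> - \<tau>' r"
    and r: "0 \<le> a" "a \<le> b"
  shows "norm (v b - v a) \<le> \<tau> a - \<tau> b"
proof (cases "a = b")
  case False
  with r have "a < b" by simp
  have "norm (v b - v a) \<le> (- \<tau> b) - (- \<tau> a)"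
  proof (rule differentiable_bound_general[OF \<open>a < b\<close>, where f' = v' and \<phi>' = "\<lambda>r. - \<tau>' r"])
    show "continuous_on {a..b} v"
      by (intro continuous_at_imp_continuous_on ballI)
        (use r in \<open>auto intro: has_vector_derivative_continuous[OF v]\<close>)
    show "continuous_on {a..b} (\<lambda>r. - \<tau> r)"
      by (intro continuous_at_imp_continuous_on ballI continuous_minus)
        (use r in \<open>auto intro: DERIV_isCont[OF \<tau>]\<close>)
    show "((\<lambda>r. - \<tau> r) has_vector_derivative - \<tau>' x) (at x)" if "a < x" "x < b" for x
      using \<tau>[of x] that r by (auto intro!: derivative_intros simp: has_real_derivative_iff_has_vector_derivative)
  qed (use v le r in auto)
  then show ?thesis by simp
qed auto

text \<open>Let the far end of the interval tend to infinity, where both functions vanish. Here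
  \<open>\<tau>\<close> plays the role of the integral of a majorant of the derivative from r to
  infinity, so that no integral has to be formed.\<close>

lemma ray_bound:
  fixes v :: "real \<Rightarrow> complex" and \<tau> \<tau>' :: "real \<Rightarrow> real"
  assumes v: "\<And>r. 0 \<le> r \<Longrightarrow> (v has_vector_derivative v' r) (at r)"
    and \<tau>: "\<And>r. 0 \<le> r \<Longrightarrow> (\<tau> has_real_derivative \<tau>' r) (at r)"
    and le: "\<And>r. 0 \<le> r \<Longrightarrow> norm (v' r) \<le> - \<tau>' r"
    and lim: "(v \<longlongrightarrow> 0) at_top" "(\<tau> \<longlongrightarrow> 0) at_top"
  shows "norm (v 0) \<le> \<tau> 0"
proof -
  have "((\<lambda>r. norm (v r - v 0)) \<longlongrightarrow> norm (0 - v 0)) at_top"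
    by (intro tendsto_intros lim)
  moreover have "((\<lambda>r. \<tau> 0 - \<tau> r) \<longlongrightarrow> \<tau> 0 - 0) at_top"
    by (intro tendsto_intros lim)
  moreover have "\<forall>\<^sub>F r in at_top. norm (v r - v 0) \<le> \<tau> 0 - \<tau> r"
    using eventually_ge_at_top[of 0]
    by eventually_elim (rule ray_difference_bound[OF v \<tau> le], auto)
  ultimately have "norm (0 - v 0) \<le> \<tau> 0 - 0"
    by (intro tendsto_le[OF trivial_limit_at_top_linorder])
  then show ?thesis by simp
qed

lemma DERIV_affine:
  fixes h :: "complex \<Rightarrow> complex"
  assumes "(h has_field_derivative d) (at (x + w * c))"
  shows "((\<lambda>w. h (x + w * c)) has_field_derivative d * c) (at w)"
proof -
  have "((\<lambda>w. x + w * c) has_field_derivative c) (at w)"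
    by (auto intro!: derivative_eq_intros)
  from DERIV_chain2[OF _ this, of h d] assms show ?thesis by simp
qed

lemma tendsto_exp_minus_abs:
  fixes \<mu> :: real
  assumes "\<mu> \<noteq> 0"
  shows "((\<lambda>r. exp (- (\<bar>\<mu>\<bar> * r))) \<longlongrightarrow> 0) at_top"
proof -
  have "filterlim (\<lambda>r. \<bar>\<mu>\<bar> * r) at_top at_top"
    using assms by (intro filterlim_tendsto_pos_mult_at_top[OF tendsto_const]) (auto simp: filterlim_ident)
  then show ?thesis
    by (intro filterlim_compose[OF exp_at_bot] filterlim_compose[OF filterlim_uminus_at_bot_at_top])
qed

lemma tendsto_inverse_add_at_top: "((\<lambda>r. A / (a + r)) \<longlongrightarrow> 0) at_top" for A a :: real
  by (intro tendsto_divide_0[OF tendsto_const] filterlim_at_top_imp_at_infinity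
      filterlim_tendsto_add_at_top[OF tendsto_const]) (simp add: filterlim_ident)

section \<open>Geometry of the domain and of the rays\<close>

locale sector_dom =
  fixes s R :: real
  assumes s: "1 \<le> s" and R: "0 < R"
begin

text \<open>The cone left out has its apex at R times the imaginary unit and contains the negative
  imaginary axis; a larger \<open>s\<close> makes it narrower. The expression compared with
  \<open>R\<close> serves as a level function in the lemmas below.\<close>

definition D :: "complex set" where
  "D = {x. R < Im x + s * \<bar>Re x\<bar>}"

text \<open>The sign of the real part makes \<open>exp (\<mu> * x)\<close> decay along the ray at
  rate \<open>\<bar>\<mu>\<bar>\<close>. The imaginary part s + 1 outweighs by 1 the loss of at most
  \<open>s\<close> that the level suffers when the ray approaches the imaginary axis. For \<mu> = 0
  the second direction is taken by convention.\<close>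

definition dir :: "real \<Rightarrow> complex" where
  "dir \<mu> = (if \<mu> < 0 then Complex 1 (s + 1) else Complex (-1) (s + 1))"

definition q :: real where "q = 1 + (1 + s) * (3 + s)"

lemma q_ge1: "1 \<le> q" using s by (simp add: q_def)

lemma open_D: "open D"
  unfolding D_def by (intro open_Collect_less continuous_intros)

lemma norm_dir: "norm (dir \<mu>) \<le> s + 2"
  using cmod_le[of "dir \<mu>"] s by (auto simp: dir_def)

lemma Re_dir: "Re (of_real \<mu> * dir \<mu>) = - \<bar>\<mu>\<bar>"
  by (auto simp: dir_def)

lemma norm_exp_dir: "norm (exp (of_real \<mu> * (of_real r * dir \<mu>))) = exp (- \<bar>\<mu>\<bar> * r)"
  using Re_dir[of \<mu>] by (auto simp: dir_def)

lemma level_shift: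
  assumes "0 \<le> r"
  shows "Im (x + of_real r * dir \<mu>) + s * \<bar>Re (x + of_real r * dir \<mu>)\<bar> \<ge> Im x + s * \<bar>Re x\<bar> + r"
proof -
  have "\<bar>Re x\<bar> \<le> \<bar>Re (x + of_real r * dir \<mu>)\<bar> + r"
    using assms by (auto simp: dir_def)
  then have "s * \<bar>Re x\<bar> \<le> s * (\<bar>Re (x + of_real r * dir \<mu>)\<bar> + r)"
    using s by (intro mult_left_mono) auto
  moreover have "Im (x + of_real r * dir \<mu>) = Im x + r * (s + 1)"
    by (auto simp: dir_def)
  ultimately show ?thesis by (simp add: algebra_simps)
qed

lemma D_shift: "x \<in> D \<Longrightarrow> 0 \<le> r \<Longrightarrow> x + of_real r * dir \<mu> \<in> D"
  using level_shift[of r x \<mu>] by (auto simp: D_def)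

lemma level_le_norm: "Im x + s * \<bar>Re x\<bar> \<le> (1 + s) * norm x"
proof -
  have "s * \<bar>Re x\<bar> \<le> s * norm x" using s abs_Re_le_cmod by (intro mult_left_mono) auto
  then show ?thesis using abs_Im_le_cmod[of x] by (auto simp: algebra_simps)
qed

lemma D_norm: "x \<in> D \<Longrightarrow> R / (1 + s) \<le> norm x"
  using level_le_norm[of x] s by (simp add: D_def field_simps)

lemma D_nonzero: "x \<in> D \<Longrightarrow> x \<noteq> 0"
  using R by (auto simp: D_def)

lemma D_inverse: "x \<in> D \<Longrightarrow> norm (inverse x) \<le> (1 + s) / R"
  using D_norm[of x] D_nonzero[of x] s R
  unfolding norm_inverse by (simp add: divide_simps) (simp add: algebra_simps)

text \<open>This lets negative powers of the norm at a point of the ray be majorised by powers of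
  \<open>norm x\<close> and of \<open>norm x + r\<close>. The level bounds r by (1 + s) times the
  norm of the endpoint, and the triangle inequality then bounds \<open>norm x\<close>; adding 1, (1
  + s) (s + 2) and 1 + s gives the constant \<open>q\<close>.\<close>

lemma shift_norm:
  assumes "x \<in> D" "0 \<le> r"
  shows "norm x + r \<le> q * norm (x + of_real r * dir \<mu>)"
proof -
  let ?y = "x + of_real r * dir \<mu>"
  have 1: "r \<le> (1 + s) * norm ?y"
    using level_shift[of r x \<mu>] level_le_norm[of ?y] assms R by (auto simp: D_def)
  have "norm x \<le> norm ?y + norm (of_real r * dir \<mu>)"
    using norm_triangle_ineq4[of ?y "of_real r * dir \<mu>"] by simp
  also have "norm (of_real r * dir \<mu>) \<le> r * (s + 2)"
    using assms norm_dir by (auto simp: norm_mult intro!: mult_left_mono)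
  also have "\<dots> \<le> ((1 + s) * norm ?y) * (s + 2)"
    using 1 s by (intro mult_right_mono) auto
  finally show ?thesis using 1 by (simp add: q_def algebra_simps)
qed

text \<open>Needed for primitives. The centre has real part 0, so along a segment
  \<open>\<bar>Re\<bar>\<close> is linear and the level is interpolated affinely between two values
  above \<open>R\<close>.\<close>

lemma starlike_D: "starlike D"
proof -
  let ?a = "Complex 0 (R + 1)"
  have "u \<in> D" if x: "x \<in> D" and u: "u \<in> closed_segment ?a x" for x u
  proof -
    obtain t where t: "0 \<le> t" "t \<le> 1" "u = (1 - t) *\<^sub>R ?a + t *\<^sub>R x"
      using u unfolding in_segment by blast
    have "Re u = t * Re x" "Im u = (1 - t) * (R + 1) + t * Im x"
      using t(3) by auto
    then have "Im u + s * \<bar>Re u\<bar> = (1 - t) * (R + 1) + t * (Im x + s * \<bar>Re x\<bar>)"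
      using t(1) by (simp only: abs_mult abs_of_nonneg[OF t(1)]) (simp add: algebra_simps)
    moreover have "t * (Im x + s * \<bar>Re x\<bar>) \<ge> t * R"
      using x t by (intro mult_left_mono) (auto simp: D_def)
    moreover have "(1 - t) * (R + 1) + t * (Im x + s * \<bar>Re x\<bar>) > R"
    proof (cases "t = 1")
      case True then show ?thesis using x by (simp add: D_def)
    next
      case False
      then have "(1 - t) * (R + 1) > (1 - t) * R" using t by (intro mult_strict_left_mono) auto
      with \<open>t * (Im x + s * \<bar>Re x\<bar>) \<ge> t * R\<close> show ?thesis by (simp add: algebra_simps)
    qed
    ultimately show ?thesis by (simp add: D_def)
  qed
  moreover have "?a \<in> D" by (simp add: D_def)
  ultimately show ?thesis unfolding starlike_def by blast
qed

text \<open>The side condition selects the solution that vanishes at the end of the rays along which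
  the homogeneous solution \<^term>\<open>exp (- \<mu> * x)\<close> grows.\<close>

definition ode_sol :: "real \<Rightarrow> (complex \<Rightarrow> complex) \<Rightarrow> (complex \<Rightarrow> complex) \<Rightarrow> bool" where
  "ode_sol \<mu> g h \<longleftrightarrow>
     (\<forall>x\<in>D. (h has_field_derivative g x - of_real \<mu> * h x) (at x)) \<and>
     (\<forall>x\<in>D. ((\<lambda>r. exp (of_real \<mu> * (of_real r * dir \<mu>)) * h (x + of_real r * dir \<mu>)) \<longlongrightarrow> 0) at_top)"

lemma ode_sol_holomorphic: "ode_sol \<mu> g h \<Longrightarrow> h holomorphic_on D"
  unfolding ode_sol_def holomorphic_on_open[OF open_D] by blast

lemma ode_sol_diff:
  assumes "ode_sol \<mu> g h" "ode_sol \<mu> g' h'"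
  shows "ode_sol \<mu> (\<lambda>x. g x - g' x) (\<lambda>x. h x - h' x)"
  unfolding ode_sol_def
proof (intro conjI ballI)
  fix x assume x: "x \<in> D"
  show "((\<lambda>x. h x - h' x) has_field_derivative g x - g' x - of_real \<mu> * (h x - h' x)) (at x)"
    using assms x by (auto simp: ode_sol_def algebra_simps intro!: derivative_eq_intros)
  have "((\<lambda>r. exp (of_real \<mu> * (of_real r * dir \<mu>)) * h (x + of_real r * dir \<mu>)
      - exp (of_real \<mu> * (of_real r * dir \<mu>)) * h' (x + of_real r * dir \<mu>)) \<longlongrightarrow> 0 - 0) at_top"
    using assms x unfolding ode_sol_def by (intro tendsto_diff) blast+
  then show "((\<lambda>r. exp (of_real \<mu> * (of_real r * dir \<mu>)) *
      (h (x + of_real r * dir \<mu>) - h' (x + of_real r * dir \<mu>))) \<longlongrightarrow> 0) at_top"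
    by (simp add: algebra_simps)
qed

lemma ode_sol_zero: "ode_sol \<mu> (\<lambda>_. 0) (\<lambda>_. 0)"
  by (simp add: ode_sol_def)

text \<open>Multiplying h by \<open>exp (\<mu> * (r * dir \<mu>))\<close> along the ray removes the
  linear term: the derivative of the product contains only g, and \<open>ray_bound\<close> applies.
  The factor s + 2 bounds the length of the direction.\<close>

lemma ode_sol_bound:
  assumes sol: "ode_sol \<mu> g h" and x: "x \<in> D"
    and \<tau>: "\<And>r. 0 \<le> r \<Longrightarrow> (\<tau> has_real_derivative \<tau>' r) (at r)" and lim: "(\<tau> \<longlongrightarrow> 0) at_top"
    and le: "\<And>r. 0 \<le> r \<Longrightarrow> (s + 2) * (exp (- \<bar>\<mu>\<bar> * r) * norm (g (x + of_real r * dir \<mu>))) \<le> - \<tau>' r"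
  shows "norm (h x) \<le> \<tau> 0"
proof -
  define v where "v = (\<lambda>r. exp (of_real \<mu> * (of_real r * dir \<mu>)) * h (x + of_real r * dir \<mu>))"
  define v' where "v' = (\<lambda>r. dir \<mu> * (exp (of_real \<mu> * (of_real r * dir \<mu>)) * g (x + of_real r * dir \<mu>)))"
  have "norm (v 0) \<le> \<tau> 0"
  proof (rule ray_bound[OF _ \<tau>, where v' = v'])
    fix r :: real assume r: "0 \<le> r"
    have h: "(h has_field_derivative (g (x + of_real r * dir \<mu>) - of_real \<mu> * h (x + of_real r * dir \<mu>)))
        (at (x + of_real r * dir \<mu>))"
      using sol D_shift[OF x r] by (auto simp: ode_sol_def)
    have "((\<lambda>w. exp (of_real \<mu> * (w * dir \<mu>)) * h (x + w * dir \<mu>)) has_field_derivative v' r) (at (of_real r))"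
      unfolding v'_def
      by (rule derivative_eq_intros DERIV_affine[OF h] refl)+ (simp add: algebra_simps)
    then show "(v has_vector_derivative v' r) (at r)"
      unfolding v_def by (rule has_vector_derivative_real_field)
    have "norm (v' r) \<le> (s + 2) * (exp (- \<bar>\<mu>\<bar> * r) * norm (g (x + of_real r * dir \<mu>)))"
      unfolding v'_def norm_mult norm_exp_dir using norm_dir by (intro mult_right_mono) auto
    also have "\<dots> \<le> - \<tau>' r" by (rule le[OF r])
    finally show "norm (v' r) \<le> - \<tau>' r" .
  next
    show "(v \<longlongrightarrow> 0) at_top" using sol x unfolding ode_sol_def v_def by blast
  qed (use lim in auto)
  then show ?thesis by (simp add: v_def)
qed

text \<open>Variation of constants from infinity: h(x) is minus \<open>exp (- \<mu> * x)\<close>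
  times the integral of \<open>exp (\<mu> * t) * g t\<close> from x to the end of the ray.
  Differences of a primitive \<open>U\<close> replace the integral, and the limit runs over integer
  ray parameters. As \<open>\<tau>\<close> does not depend on x, convergence is uniform on D, so
  derivatives converge as well.\<close>

lemma ode_sol_exists:
  assumes g: "g holomorphic_on D"
    and \<tau>: "\<And>r. 0 \<le> r \<Longrightarrow> (\<tau> has_real_derivative \<tau>' r) (at r)"
    and lim: "(\<tau> \<longlongrightarrow> 0) at_top" "(\<tau>' \<longlongrightarrow> 0) at_top"
    and le: "\<And>r x. 0 \<le> r \<Longrightarrow> x \<in> D \<Longrightarrow>
       (s + 2) * (exp (- \<bar>\<mu>\<bar> * r) * norm (g (x + of_real r * dir \<mu>))) \<le> - \<tau>' r"
  shows "\<exists>h. ode_sol \<mu> g h"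
proof -
  have hol: "(\<lambda>x. exp (of_real \<mu> * x) * g x) holomorphic_on D"
    by (intro holomorphic_intros g)
  have "\<exists>U. \<forall>x\<in>D. (U has_field_derivative exp (of_real \<mu> * x) * g x) (at x)"
    by (rule holomorphic_starlike_primitive[OF holomorphic_on_imp_continuous_on[OF hol] starlike_D open_D finite.emptyI])
      (use holomorphic_on_imp_differentiable_at[OF hol open_D] in auto)
  then obtain U where U: "\<And>x. x \<in> D \<Longrightarrow> (U has_field_derivative exp (of_real \<mu> * x) * g x) (at x)"
    by blast
  let ?e = "\<lambda>x. exp (- (of_real \<mu> * x))"
  have U_bd: "norm (?e x * (U (x + of_real b * dir \<mu>) - U (x + of_real a * dir \<mu>))) \<le> \<tau> a - \<tau> b"
    if x: "x \<in> D" and ab: "0 \<le> a" "a \<le> b" for x a b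
  proof -
    let ?v' = "\<lambda>r. dir \<mu> * (exp (of_real \<mu> * (of_real r * dir \<mu>)) * g (x + of_real r * dir \<mu>))"
    have "norm (?e x * U (x + of_real b * dir \<mu>) - ?e x * U (x + of_real a * dir \<mu>)) \<le> \<tau> a - \<tau> b"
    proof (rule ray_difference_bound[OF _ \<tau> _ ab, where v' = ?v'])
      fix r :: real assume r: "0 \<le> r"
      have "((\<lambda>w. ?e x * U (x + w * dir \<mu>)) has_field_derivative ?v' r) (at (of_real r))"
        by (rule derivative_eq_intros DERIV_affine[OF U] refl D_shift x r)+
          (simp add: exp_add exp_minus algebra_simps)
      then show "((\<lambda>r. ?e x * U (x + of_real r * dir \<mu>)) has_vector_derivative ?v' r) (at r)"
        by (rule has_vector_derivative_real_field)
      have "norm (?v' r) \<le> (s + 2) * (exp (- \<bar>\<mu>\<bar> * r) * norm (g (x + of_real r * dir \<mu>)))"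
        unfolding norm_mult norm_exp_dir using norm_dir by (intro mult_right_mono) auto
      also have "\<dots> \<le> - \<tau>' r" by (rule le[OF r x])
      finally show "norm (?v' r) \<le> - \<tau>' r" .
    qed auto
    then show ?thesis by (simp add: right_diff_distrib)
  qed
  have \<tau>_nonneg: "0 \<le> \<tau> r" if "0 \<le> r" for r
  proof (rule tendsto_upperbound[OF lim(1)])
    have a: "Complex 0 (R + 1) \<in> D" by (simp add: D_def)
    show "\<forall>\<^sub>F b in at_top. \<tau> b \<le> \<tau> r"
      using eventually_ge_at_top[of r]
    proof eventually_elim
      case (elim b)
      have "0 \<le> \<tau> r - \<tau> b" using U_bd[OF a that elim] norm_ge_zero order_trans by blast
      then show ?case by simp
    qed
  qed auto
  define H where "H = (\<lambda>n x. ?e x * (U x - U (x + of_nat n * dir \<mu>)))"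
  have H_diff: "norm (H m x - H n x) \<le> \<tau> (real n)" if "x \<in> D" "n \<le> m" for m n x
    using U_bd[OF that(1), of "real n" "real m"] \<tau>_nonneg[of m] that
    by (simp add: H_def algebra_simps norm_minus_commute)
  have "uniformly_Cauchy_on D H"
    unfolding uniformly_Cauchy_on_def
  proof (intro allI impI)
    fix e :: real assume "e > 0"
    have "((\<lambda>n. \<tau> (real n)) \<longlonglongrightarrow> 0)"
      by (rule filterlim_compose[OF lim(1) filterlim_real_sequentially])
    then obtain N where N: "\<And>n. n \<ge> N \<Longrightarrow> \<bar>\<tau> (real n)\<bar> < e"
      using \<open>e > 0\<close> by (auto simp: LIMSEQ_iff)
    have "dist (H m x) (H n x) < e" if "x \<in> D" "m \<ge> N" "n \<ge> N" for x m n
      using H_diff[of x n m] H_diff[of x m n] N[of n] N[of m] that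
      by (cases "n \<le> m") (auto simp: dist_norm norm_minus_commute)
    then show "\<exists>M. \<forall>x\<in>D. \<forall>m\<ge>M. \<forall>n\<ge>M. dist (H m x) (H n x) < e" by blast
  qed
  then obtain h where h: "uniform_limit D H h sequentially"
    using Cauchy_uniformly_convergent uniformly_convergent_on_def by blast
  then have h_lim: "(\<lambda>n. H n x) \<longlonglongrightarrow> h x" if "x \<in> D" for x
    using that by (rule tendsto_uniform_limitI)
  have g_lim: "(\<lambda>n. exp (of_real \<mu> * (of_nat n * dir \<mu>)) * g (x + of_nat n * dir \<mu>)) \<longlonglongrightarrow> 0"
    if x: "x \<in> D" for x
  proof (rule Lim_null_comparison)
    show "(\<lambda>n. - \<tau>' (real n)) \<longlonglongrightarrow> 0"
      using filterlim_compose[OF lim(2) filterlim_real_sequentially] tendsto_minus by fastforce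
    have "norm (exp (of_real \<mu> * (of_nat n * dir \<mu>)) * g (x + of_nat n * dir \<mu>)) \<le> - \<tau>' (real n)" for n
    proof -
      let ?a = "exp (- \<bar>\<mu>\<bar> * real n) * norm (g (x + of_real (real n) * dir \<mu>))"
      have "1 * ?a \<le> (s + 2) * ?a" using s by (intro mult_right_mono) auto
      also have "\<dots> \<le> - \<tau>' (real n)" using le[of "real n" x] x by simp
      finally show ?thesis using norm_exp_dir[of \<mu> "real n"] by (simp add: norm_mult)
    qed
    then show "\<forall>\<^sub>F n in sequentially. norm (exp (of_real \<mu> * (of_nat n * dir \<mu>)) * g (x + of_nat n * dir \<mu>)) \<le> - \<tau>' (real n)"
      by simp
  qed
  have H': "(H n has_field_derivative
      g x - exp (of_real \<mu> * (of_nat n * dir \<mu>)) * g (x + of_nat n * dir \<mu>) - of_real \<mu> * H n x) (at x)"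
    if "x \<in> D" for n x
  proof -
    have "x + of_nat n * dir \<mu> \<in> D" using D_shift[OF that, of "real n" \<mu>] by simp
    note U' = U[OF this, unfolded DERIV_shift]
    show ?thesis
      unfolding H_def using that
      by (auto intro!: derivative_eq_intros U U' simp: exp_add exp_minus field_simps)
  qed
  have "\<exists>d. 0 < d \<and> cball x d \<subseteq> D \<and> uniform_limit (cball x d) H h sequentially" if "x \<in> D" for x
    using that open_D h by (meson open_contains_cball uniform_limit_on_subset)
  from has_complex_derivative_uniform_sequence[OF open_D H' this]
  obtain h' where h': "\<And>x. x \<in> D \<Longrightarrow> (h has_field_derivative h' x) (at x)"
    "\<And>x. x \<in> D \<Longrightarrow> (\<lambda>n. g x - exp (of_real \<mu> * (of_nat n * dir \<mu>)) * g (x + of_nat n * dir \<mu>)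
      - of_real \<mu> * H n x) \<longlonglongrightarrow> h' x" by blast
  have "h' x = g x - of_real \<mu> * h x" if "x \<in> D" for x
  proof -
    have "(\<lambda>n. g x - exp (of_real \<mu> * (of_nat n * dir \<mu>)) * g (x + of_nat n * dir \<mu>)
      - of_real \<mu> * H n x) \<longlonglongrightarrow> g x - 0 - of_real \<mu> * h x"
      by (intro tendsto_intros g_lim h_lim that)
    then show ?thesis using h'(2)[OF that] LIMSEQ_unique by fastforce
  qed
  moreover have "((\<lambda>r. exp (of_real \<mu> * (of_real r * dir \<mu>)) * h (x + of_real r * dir \<mu>)) \<longlongrightarrow> 0) at_top"
    if x: "x \<in> D" for x
  proof (rule Lim_null_comparison)
    show "\<forall>\<^sub>F r in at_top. norm (exp (of_real \<mu> * (of_real r * dir \<mu>)) * h (x + of_real r * dir \<mu>)) \<le> \<tau> r"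
      using eventually_ge_at_top[of 0]
    proof eventually_elim
      case (elim r)
      let ?y = "x + of_real r * dir \<mu>"
      have "(\<lambda>n. norm (exp (of_real \<mu> * (of_real r * dir \<mu>)) * H n ?y)) \<longlonglongrightarrow>
          norm (exp (of_real \<mu> * (of_real r * dir \<mu>)) * h ?y)"
        by (intro tendsto_intros h_lim D_shift x elim)
      moreover have "norm (exp (of_real \<mu> * (of_real r * dir \<mu>)) * H n ?y) \<le> \<tau> r" for n
      proof -
        have "exp (of_real \<mu> * (of_real r * dir \<mu>)) * H n ?y
            = - (?e x * (U (x + of_real (r + real n) * dir \<mu>) - U ?y))"
          by (simp add: H_def exp_add exp_minus field_simps)
        then show ?thesis
          using U_bd[OF x, of r "r + real n"] \<tau>_nonneg[of "r + real n"] elim by simp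
      qed
      ultimately show ?case by (intro LIMSEQ_le_const2) auto
    qed
  qed (rule lim(1))
  ultimately show ?thesis using h'(1) unfolding ode_sol_def by metis
qed

text \<open>The forcing term carries the factor \<open>\<bar>\<mu>\<bar>\<close> because the
  integral of \<open>\<bar>\<mu>\<bar> * exp (- \<bar>\<mu>\<bar> * r)\<close> over the ray is 1.
  The constant is thus independent of \<mu>, hence the same for all modes.\<close>

lemma ode_sol_exp_bound:
  assumes sol: "ode_sol \<mu> (\<lambda>x. of_real \<bar>\<mu>\<bar> * k x) h" and \<mu>: "\<mu> \<noteq> 0"
    and k: "\<And>x. x \<in> D \<Longrightarrow> norm (k x) \<le> m / norm x ^ N" and x: "x \<in> D"
  shows "norm (h x) \<le> (s + 2) * q ^ N * m / norm x ^ N"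
proof -
  define A where "A = (s + 2) * q ^ N * m / norm x ^ N"
  have "norm (h x) \<le> A * exp (- \<bar>\<mu>\<bar> * 0)"
  proof (rule ode_sol_bound[OF sol x])
    show "((\<lambda>r. A * exp (- \<bar>\<mu>\<bar> * r)) has_real_derivative - A * \<bar>\<mu>\<bar> * exp (- \<bar>\<mu>\<bar> * r)) (at r)" for r
      by (auto intro!: derivative_eq_intros)
    from tendsto_mult_left[OF tendsto_exp_minus_abs[OF \<mu>], of A] show "((\<lambda>r. A * exp (- \<bar>\<mu>\<bar> * r)) \<longlongrightarrow> 0) at_top" by simp
    fix r :: real assume r: "0 \<le> r"
    let ?y = "x + of_real r * dir \<mu>"
    have y: "?y \<in> D" using D_shift[OF x r] .
    have "0 \<le> m / norm x ^ N" using k[OF x] norm_ge_zero order_trans by blast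
    moreover have "0 < norm x ^ N" using D_nonzero[OF x] by simp
    ultimately have m: "0 \<le> m" using zero_le_divide_iff by (metis linorder_not_less)
    have "norm x ^ N \<le> (q * norm ?y) ^ N"
      using shift_norm[OF x r, of \<mu>] r by (intro power_mono) auto
    then have "m / norm ?y ^ N \<le> q ^ N * m / norm x ^ N"
      using D_nonzero[OF x] D_nonzero[OF y] m mult_left_mono[of "norm x ^ N" "(q * norm ?y) ^ N" m]
      by (simp add: field_simps power_mult_distrib)
    then have "norm (k ?y) \<le> q ^ N * m / norm x ^ N" using k[OF y] by simp
    then have "(s + 2) * (exp (- \<bar>\<mu>\<bar> * r) * (\<bar>\<mu>\<bar> * norm (k ?y)))
        \<le> (s + 2) * (exp (- \<bar>\<mu>\<bar> * r) * (\<bar>\<mu>\<bar> * (q ^ N * m / norm x ^ N)))"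
      using s by (intro mult_left_mono) auto
    then show "(s + 2) * (exp (- \<bar>\<mu>\<bar> * r) * norm (of_real \<bar>\<mu>\<bar> * k ?y)) \<le> - (- A * \<bar>\<mu>\<bar> * exp (- \<bar>\<mu>\<bar> * r))"
      by (simp add: A_def norm_mult mult_ac)
  qed
  then show ?thesis by (simp add: A_def)
qed

lemma ode_sol_exp_exists:
  assumes k: "k holomorphic_on D" and le: "\<And>x. x \<in> D \<Longrightarrow> norm (k x) \<le> m" and \<mu>: "\<mu> \<noteq> 0"
  shows "\<exists>h. ode_sol \<mu> (\<lambda>x. of_real \<bar>\<mu>\<bar> * k x) h"
proof -
  define A where "A = (s + 2) * m"
  note lim = tendsto_exp_minus_abs[OF \<mu>]
  show ?thesis
  proof (rule ode_sol_exists)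
    show "((\<lambda>r. A * exp (- \<bar>\<mu>\<bar> * r)) has_real_derivative - A * \<bar>\<mu>\<bar> * exp (- \<bar>\<mu>\<bar> * r)) (at r)" for r
      by (auto intro!: derivative_eq_intros)
    show "((\<lambda>r. A * exp (- \<bar>\<mu>\<bar> * r)) \<longlongrightarrow> 0) at_top"
      using tendsto_mult_left[OF lim, of A] by simp
    show "((\<lambda>r. - A * \<bar>\<mu>\<bar> * exp (- \<bar>\<mu>\<bar> * r)) \<longlongrightarrow> 0) at_top"
      using tendsto_mult_left[OF lim, of "- A * \<bar>\<mu>\<bar>"] by simp
    fix r :: real and x assume r: "0 \<le> r" and x: "x \<in> D"
    let ?y = "x + of_real r * dir \<mu>"
    have "(s + 2) * (exp (- \<bar>\<mu>\<bar> * r) * (\<bar>\<mu>\<bar> * norm (k ?y))) \<le> (s + 2) * (exp (- \<bar>\<mu>\<bar> * r) * (\<bar>\<mu>\<bar> * m))"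
      using s le[OF D_shift[OF x r]] by (intro mult_left_mono) auto
    then show "(s + 2) * (exp (- \<bar>\<mu>\<bar> * r) * norm (of_real \<bar>\<mu>\<bar> * k ?y)) \<le> - (- A * \<bar>\<mu>\<bar> * exp (- \<bar>\<mu>\<bar> * r))"
      by (simp add: A_def norm_mult mult_ac)
  qed (intro holomorphic_intros k)
qed

text \<open>The integral of \<open>1 / (norm x + r)\<^sup>2\<close> over r is
  \<open>1 / norm x\<close>, so integrating k / x^2 gains one power over k. The exponent N + 2 of
  \<open>q\<close> counts the inverse powers that \<open>shift_norm\<close> replaces.\<close>

lemma ode_sol_slow_bound:
  assumes sol: "ode_sol 0 (\<lambda>x. k x / x\<^sup>2) h"
    and k: "\<And>x. x \<in> D \<Longrightarrow> norm (k x) \<le> m / norm x ^ N" and x: "x \<in> D"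
  shows "norm (h x) \<le> (s + 2) * q ^ (N + 2) * m / norm x ^ (N + 1)"
proof -
  define A where "A = (s + 2) * q ^ (N + 2) * m / norm x ^ N"
  have xp: "0 < norm x" using D_nonzero[OF x] by simp
  have "norm (h x) \<le> A / (norm x + 0)"
  proof (rule ode_sol_bound[OF sol x])
    show "((\<lambda>r. A / (norm x + r)) has_real_derivative - A / (norm x + r)\<^sup>2) (at r)" if "0 \<le> r" for r
    proof -
      have "norm x + r \<noteq> 0" using that xp by linarith
      then show ?thesis by (auto intro!: derivative_eq_intros simp: power2_eq_square)
    qed
    show "((\<lambda>r. A / (norm x + r)) \<longlongrightarrow> 0) at_top" by (rule tendsto_inverse_add_at_top)
    fix r :: real assume r: "0 \<le> r"
    let ?y = "x + of_real r * dir 0"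
    have y: "?y \<in> D" using D_shift[OF x r] .
    have yp: "0 < norm ?y" using D_nonzero[OF y] by simp
    have "0 \<le> m / norm x ^ N" using k[OF x] norm_ge_zero order_trans by blast
    moreover have "0 < norm x ^ N" using xp by simp
    ultimately have m: "0 \<le> m" using zero_le_divide_iff by (metis linorder_not_less)
    have "norm x ^ N * (norm x + r)\<^sup>2 \<le> (q * norm ?y) ^ N * (q * norm ?y)\<^sup>2"
      using shift_norm[OF x r, of 0] r q_ge1 by (intro mult_mono power_mono) auto
    then have "m * (norm x ^ N * (norm x + r)\<^sup>2) \<le> m * ((q * norm ?y) ^ N * (q * norm ?y)\<^sup>2)"
      using m by (rule mult_left_mono)
    then have "m * (norm x ^ N * (norm x + r)\<^sup>2) \<le> (q ^ (N + 2) * m) * (norm ?y ^ N * (norm ?y)\<^sup>2)"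
      by (simp add: power_mult_distrib power_add mult_ac power2_eq_square)
    moreover have "0 < norm x ^ N * (norm x + r)\<^sup>2" "0 < norm ?y ^ N * (norm ?y)\<^sup>2"
      using xp yp r by (auto intro!: mult_pos_pos zero_less_power add_pos_nonneg simp del: zero_less_norm_iff)
    ultimately have "m / (norm ?y ^ N * (norm ?y)\<^sup>2) \<le> (q ^ (N + 2) * m) / (norm x ^ N * (norm x + r)\<^sup>2)"
      by (simp only: pos_divide_le_eq pos_le_divide_eq times_divide_eq_left)
    then have "(m / norm ?y ^ N) / norm ?y ^ 2 \<le> q ^ (N + 2) * m / norm x ^ N / (norm x + r)\<^sup>2"
      by simp
    moreover have "norm (k ?y / ?y\<^sup>2) \<le> (m / norm ?y ^ N) / norm ?y ^ 2"
      unfolding norm_divide norm_power using k[OF y] by (rule divide_right_mono) simp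
    ultimately have "norm (k ?y / ?y\<^sup>2) \<le> q ^ (N + 2) * m / norm x ^ N / (norm x + r)\<^sup>2" by linarith
    then have "(s + 2) * norm (k ?y / ?y\<^sup>2) \<le> (s + 2) * (q ^ (N + 2) * m / norm x ^ N / (norm x + r)\<^sup>2)"
      using s by (intro mult_left_mono) auto
    then show "(s + 2) * (exp (- \<bar>0\<bar> * r) * norm (k ?y / ?y\<^sup>2)) \<le> - (- A / (norm x + r)\<^sup>2)"
      by (simp add: A_def mult_ac)
  qed
  then show ?thesis by (simp add: A_def mult_ac)
qed

lemma ode_sol_slow_exists:
  assumes k: "k holomorphic_on D" and le: "\<And>x. x \<in> D \<Longrightarrow> norm (k x) \<le> m"
  shows "\<exists>h. ode_sol 0 (\<lambda>x. k x / x\<^sup>2) h"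
proof -
  \<comment> \<open>A lower bound of the norm on D; with it in place of \<open>norm x\<close> the
    majorant does not depend on x, as \<open>ode_sol_exists\<close> demands.\<close>
  define c where "c = R / (1 + s)"
  have c: "0 < c" using R s by (simp add: c_def)
  define A where "A = (s + 2) * q\<^sup>2 * m"
  show ?thesis
  proof (rule ode_sol_exists)
    show "((\<lambda>r. A / (c + r)) has_real_derivative - A / (c + r)\<^sup>2) (at r)" if "0 \<le> r" for r
      using that c by (auto intro!: derivative_eq_intros simp: power2_eq_square)
    show "((\<lambda>r. A / (c + r)) \<longlongrightarrow> 0) at_top" by (rule tendsto_inverse_add_at_top)
    have "((\<lambda>r. - (A / (c + r)) * (1 / (c + r))) \<longlongrightarrow> - 0 * 0) at_top"
      by (intro tendsto_mult tendsto_minus tendsto_inverse_add_at_top)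
    then show "((\<lambda>r. - A / (c + r)\<^sup>2) \<longlongrightarrow> 0) at_top"
      by (simp add: power2_eq_square)
    fix r :: real and x assume r: "0 \<le> r" and x: "x \<in> D"
    let ?y = "x + of_real r * dir 0"
    have y: "?y \<in> D" using D_shift[OF x r] .
    have yp: "0 < norm ?y" using D_nonzero[OF y] by simp
    have m: "0 \<le> m" using le[OF x] norm_ge_zero order_trans by blast
    have "(c + r)\<^sup>2 \<le> (q * norm ?y)\<^sup>2"
      using shift_norm[OF x r, of 0] D_norm[OF x] r c by (intro power_mono) (auto simp: c_def)
    then have "m * (c + r)\<^sup>2 \<le> m * (q * norm ?y)\<^sup>2" using m by (rule mult_left_mono)
    then have "m / norm ?y ^ 2 \<le> q\<^sup>2 * m / (c + r)\<^sup>2"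
      using c yp r by (simp add: divide_simps power_mult_distrib add_pos_nonneg) (simp add: mult_ac)
    moreover have "norm (k ?y / ?y\<^sup>2) \<le> m / norm ?y ^ 2"
      using le[OF y] by (simp add: norm_divide norm_power divide_right_mono)
    ultimately have "norm (k ?y / ?y\<^sup>2) \<le> q\<^sup>2 * m / (c + r)\<^sup>2" by linarith
    then have "(s + 2) * norm (k ?y / ?y\<^sup>2) \<le> (s + 2) * (q\<^sup>2 * m / (c + r)\<^sup>2)"
      using s by (intro mult_left_mono) auto
    then show "(s + 2) * (exp (- \<bar>0\<bar> * r) * norm (k ?y / ?y\<^sup>2)) \<le> - (- A / (c + r)\<^sup>2)"
      by (simp add: A_def mult_ac)
  qed (use D_nonzero in \<open>auto intro!: holomorphic_intros k\<close>)
qed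

text \<open>By this criterion and the next one, explicit polynomials in 1/x are recognised as the
  selected solutions: boundedness suffices for \<mu> \<noteq> 0, decay like 1/x for \<mu> =
  0.\<close>

lemma ode_sol_expI:
  assumes "\<And>x. x \<in> D \<Longrightarrow> (h has_field_derivative g x - of_real \<mu> * h x) (at x)"
    and bd: "\<And>x. x \<in> D \<Longrightarrow> norm (h x) \<le> m" and \<mu>: "\<mu> \<noteq> 0"
  shows "ode_sol \<mu> g h"
  unfolding ode_sol_def
proof (intro conjI ballI assms(1))
  fix x assume x: "x \<in> D"
  note lim = tendsto_exp_minus_abs[OF \<mu>]
  show "((\<lambda>r. exp (of_real \<mu> * (of_real r * dir \<mu>)) * h (x + of_real r * dir \<mu>)) \<longlongrightarrow> 0) at_top"
  proof (rule Lim_null_comparison)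
    show "((\<lambda>r. m * exp (- \<bar>\<mu>\<bar> * r)) \<longlongrightarrow> 0) at_top"
      using tendsto_mult_left[OF lim, of m] by simp
    show "\<forall>\<^sub>F r in at_top. norm (exp (of_real \<mu> * (of_real r * dir \<mu>)) * h (x + of_real r * dir \<mu>))
        \<le> m * exp (- \<bar>\<mu>\<bar> * r)"
      using eventually_ge_at_top[of 0]
    proof eventually_elim
      case (elim r)
      show ?case unfolding norm_mult[of "exp _"] norm_exp_dir
        using bd[OF D_shift[OF x elim]] by (simp add: mult.commute mult_right_mono)
    qed
  qed
qed

lemma ode_sol_slowI:
  assumes "\<And>x. x \<in> D \<Longrightarrow> (h has_field_derivative g x) (at x)"
    and bd: "\<And>x. x \<in> D \<Longrightarrow> norm (h x) \<le> m / norm x"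
  shows "ode_sol 0 g h"
  unfolding ode_sol_def
proof (intro conjI ballI)
  fix x assume x: "x \<in> D"
  show "(h has_field_derivative g x - of_real 0 * h x) (at x)" using assms(1)[OF x] by simp
  show "((\<lambda>r. exp (of_real 0 * (of_real r * dir 0)) * h (x + of_real r * dir 0)) \<longlongrightarrow> 0) at_top"
  proof (rule Lim_null_comparison)
    show "((\<lambda>r. (q * m) / (norm x + r)) \<longlongrightarrow> 0) at_top" by (rule tendsto_inverse_add_at_top)
    show "\<forall>\<^sub>F r in at_top. norm (exp (of_real 0 * (of_real r * dir 0)) * h (x + of_real r * dir 0))
        \<le> (q * m) / (norm x + r)"
      using eventually_ge_at_top[of 0]
    proof eventually_elim
      case (elim r)
      let ?y = "x + of_real r * dir 0"
      have y: "?y \<in> D" using D_shift[OF x elim] .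
      have yp: "0 < norm ?y" "0 < norm x" using D_nonzero[OF y] D_nonzero[OF x] by auto
      have "0 \<le> m / norm x" using bd[OF x] norm_ge_zero order_trans by blast
      then have m: "0 \<le> m" using yp by (simp add: zero_le_divide_iff)
      then have "m / norm ?y \<le> (q * m) / (norm x + r)"
        using mult_left_mono[OF shift_norm[OF x elim, of 0] m] yp elim
        by (simp add: divide_simps add_pos_nonneg mult_ac)
      then show ?case using bd[OF y] by simp
    qed
  qed
qed

end

section \<open>A fixed point theorem for systems\<close>

text \<open>Iteration of Y -> ini + solution of the linear equation with right side
  \<open>K i Y\<close>, in the families bounded by \<open>B\<close>. A quadratic K has Lipschitz
  factor 2, so \<open>C i * M i \<le> B i / 4\<close> gives the contraction ratio 1/2, and three
  quarters of \<open>B i\<close> remain for the initial value. The bound on a solution itself is the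
  Lipschitz bound against the zero solution.\<close>

lemma picard_system:
  fixes D :: "complex set" and B ini M C :: "'i \<Rightarrow> real"
    and K :: "'i \<Rightarrow> ('i \<Rightarrow> complex \<Rightarrow> complex) \<Rightarrow> complex \<Rightarrow> complex"
    and Sol :: "'i \<Rightarrow> (complex \<Rightarrow> complex) \<Rightarrow> (complex \<Rightarrow> complex) \<Rightarrow> bool"
  assumes D: "open D"
    and E: "\<And>i k m. k holomorphic_on D \<Longrightarrow> (\<forall>x\<in>D. norm (k x) \<le> m) \<Longrightarrow> \<exists>h. Sol i k h"
    and L: "\<And>i k k' h h' m x. Sol i k h \<Longrightarrow> Sol i k' h' \<Longrightarrow>
        (\<forall>x\<in>D. norm (k x - k' x) \<le> m) \<Longrightarrow> x \<in> D \<Longrightarrow> norm (h x - h' x) \<le> C i * m"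
    and Z: "\<And>i. Sol i (\<lambda>_. 0) (\<lambda>_. 0)"
    and hol: "\<And>i k h. Sol i k h \<Longrightarrow> h holomorphic_on D"
    and Khol: "\<And>i Y. (\<forall>j. Y j holomorphic_on D) \<Longrightarrow> K i Y holomorphic_on D"
    and KM: "\<And>i Y x. x \<in> D \<Longrightarrow> (\<forall>j. norm (Y j x) \<le> B j) \<Longrightarrow> norm (K i Y x) \<le> M i"
    and KL: "\<And>i Y Y' x d. x \<in> D \<Longrightarrow> 0 \<le> d \<Longrightarrow> (\<forall>j. norm (Y j x) \<le> B j) \<Longrightarrow> (\<forall>j. norm (Y' j x) \<le> B j) \<Longrightarrow>
        (\<forall>j. norm (Y j x - Y' j x) \<le> d * B j) \<Longrightarrow> norm (K i Y x - K i Y' x) \<le> 2 * d * M i"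
    and C: "\<And>i. 0 \<le> C i"
    and small: "\<And>i. C i * M i \<le> B i / 4"
    and start: "\<And>i. \<bar>ini i\<bar> \<le> 3 * B i / 4"
  shows "\<exists>Y. (\<forall>i. Y i holomorphic_on D) \<and> (\<forall>i. \<forall>x\<in>D. norm (Y i x) \<le> B i) \<and>
     (\<forall>i. \<exists>h. Sol i (K i Y) h \<and> (\<forall>x\<in>D. Y i x = of_real (ini i) + h x))"
proof -
  define good where "good Y \<longleftrightarrow> (\<forall>i. Y i holomorphic_on D) \<and> (\<forall>i. \<forall>x\<in>D. norm (Y i x) \<le> B i)"
    for Y :: "'i \<Rightarrow> complex \<Rightarrow> complex"
  define S where "S i k = (SOME h. Sol i k h)" for i k
  define T where "T Y = (\<lambda>i x. of_real (ini i) + S i (K i Y) x)" for Y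
  have B: "0 \<le> B i" for i using start[of i] by linarith
  have S: "Sol i (K i Y) (S i (K i Y))" if "good Y" for i Y
  proof -
    have "K i Y holomorphic_on D" using that by (intro Khol) (simp add: good_def)
    moreover have "\<forall>x\<in>D. norm (K i Y x) \<le> M i" using that by (intro ballI KM) (auto simp: good_def)
    ultimately show ?thesis unfolding S_def by (intro someI_ex[OF E])
  qed
  have T_good: "good (T Y)" if "good Y" for Y
  proof -
    have "norm (T Y i x) \<le> B i" if x: "x \<in> D" for i x
    proof -
      have "norm (S i (K i Y) x - 0) \<le> C i * M i"
        using \<open>good Y\<close> by (intro L[OF S[OF \<open>good Y\<close>] Z[of i] _ x] ballI) (simp add: good_def KM)
      then have "norm (S i (K i Y) x) \<le> B i / 4" using small[of i] by simp
      moreover have "norm (T Y i x) \<le> \<bar>ini i\<bar> + norm (S i (K i Y) x)"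
        unfolding T_def using norm_triangle_ineq[of "of_real (ini i)" "S i (K i Y) x"] by simp
      ultimately show ?thesis using start[of i] by simp
    qed
    moreover have "T Y i holomorphic_on D" for i
      unfolding T_def using hol[OF S[OF \<open>good Y\<close>]] by (intro holomorphic_intros)
    ultimately show ?thesis by (auto simp: good_def)
  qed
  have T_contr: "norm (T Y i x - T Y' i x) \<le> (d / 2) * B i"
    if "good Y" "good Y'" "0 \<le> d" "\<forall>j. \<forall>x\<in>D. norm (Y j x - Y' j x) \<le> d * B j" "x \<in> D" for Y Y' i x d
  proof -
    have "norm (S i (K i Y) x - S i (K i Y') x) \<le> C i * (2 * d * M i)"
      using that by (intro L[OF S[OF that(1)] S[OF that(2)] _ that(5)] ballI KL) (auto simp: good_def)
    also have "\<dots> = 2 * d * (C i * M i)" by simp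
    also have "\<dots> \<le> 2 * d * (B i / 4)" using small that by (intro mult_left_mono) auto
    finally show ?thesis by (simp add: T_def)
  qed
  define Y where "Y n = (T ^^ n) (\<lambda>i _. of_real (ini i))" for n
  have Y_good: "good (Y n)" for n
  proof (induction n)
    case 0
    have "\<bar>ini i\<bar> \<le> B i" for i using start[of i] B[of i] by linarith
    then show ?case by (auto simp: good_def Y_def)
  next
    case (Suc n) then show ?case using T_good by (simp add: Y_def)
  qed
  have YS: "Y (Suc n) = T (Y n)" for n by (simp add: Y_def)
  have step: "\<forall>i. \<forall>x\<in>D. norm (Y (Suc n) i x - Y n i x) \<le> 2 * (1/2) ^ n * B i" for n
  proof (induction n)
    case 0
    show ?case
    proof (intro allI ballI)
      fix i x assume "x \<in> D"
      then have "norm (Y (Suc 0) i x) \<le> B i" "norm (Y 0 i x) \<le> B i" using Y_good by (auto simp: good_def)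
      then show "norm (Y (Suc 0) i x - Y 0 i x) \<le> 2 * (1/2) ^ 0 * B i"
        using norm_triangle_ineq4[of "Y (Suc 0) i x" "Y 0 i x"] by simp
    qed
  next
    case (Suc n)
    show ?case
    proof (intro allI ballI)
      fix i x assume "x \<in> D"
      from T_contr[OF Y_good[of "Suc n"] Y_good[of n] _ Suc.IH this, of i]
      show "norm (Y (Suc (Suc n)) i x - Y (Suc n) i x) \<le> 2 * (1/2) ^ Suc n * B i"
        by (simp add: YS[symmetric])
    qed
  qed
  have tail: "norm (Y m i x - Y n i x) \<le> 4 * (1/2) ^ n * B i" if "x \<in> D" "n \<le> m" for m n i x
  proof -
    have "norm (Y m i x - Y n i x) \<le> (4 * (1/2) ^ n - 4 * (1/2) ^ m) * B i" using that(2)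
    proof (induction m rule: dec_induct)
      case (step m)
      have "norm (Y (Suc m) i x - Y n i x) \<le> norm (Y (Suc m) i x - Y m i x) + norm (Y m i x - Y n i x)"
        using norm_triangle_ineq[of "Y (Suc m) i x - Y m i x" "Y m i x - Y n i x"] by simp
      then show ?case using step.IH \<open>\<forall>i. \<forall>x\<in>D. norm (Y (Suc m) i x - Y m i x) \<le> 2 * (1/2) ^ m * B i\<close>[rule_format, OF that(1), of i]
        by (simp add: algebra_simps)
    qed simp
    also have "\<dots> \<le> 4 * (1/2) ^ n * B i" using B by (intro mult_right_mono) auto
    finally show ?thesis .
  qed
  have null: "(\<lambda>n. 4 * (1/2) ^ n * b) \<longlonglongrightarrow> 0" for b :: real
    by (auto intro!: tendsto_eq_intros LIMSEQ_realpow_zero)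
  have "\<exists>y. uniform_limit D (\<lambda>n. Y n i) y sequentially" for i
  proof -
    have "uniformly_Cauchy_on D (\<lambda>n. Y n i)"
      unfolding uniformly_Cauchy_on_def
    proof (intro allI impI)
      fix e :: real assume "0 < e"
      then obtain N where N: "\<And>n. N \<le> n \<Longrightarrow> norm (4 * (1/2) ^ n * B i) < e"
        using null[of "B i"] by (auto simp: LIMSEQ_iff)
      have "dist (Y m i x) (Y n i x) < e" if "x \<in> D" "m \<ge> N" "n \<ge> N" for x m n
        using tail[of x n m i] tail[of x m n i] N[of n] N[of m] that
        by (cases "n \<le> m") (auto simp: dist_norm norm_minus_commute)
      then show "\<exists>M. \<forall>x\<in>D. \<forall>m\<ge>M. \<forall>n\<ge>M. dist (Y m i x) (Y n i x) < e" by blast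
    qed
    then show ?thesis using Cauchy_uniformly_convergent uniformly_convergent_on_def by blast
  qed
  then obtain y where y: "\<And>i. uniform_limit D (\<lambda>n. Y n i) (y i) sequentially" by metis
  have y_lim: "(\<lambda>n. Y n i x) \<longlonglongrightarrow> y i x" if "x \<in> D" for i x
    using y that by (rule tendsto_uniform_limitI)
  have y_good: "good y"
    unfolding good_def
  proof (intro conjI allI ballI)
    fix i
    show "y i holomorphic_on D"
    proof (rule holomorphic_uniform_sequence[OF D])
      show "Y n i holomorphic_on D" for n using Y_good by (auto simp: good_def)
      show "\<exists>d>0. cball x d \<subseteq> D \<and> uniform_limit (cball x d) (\<lambda>n. Y n i) (y i) sequentially"
        if "x \<in> D" for x
        using that D y[of i] by (meson open_contains_cball uniform_limit_on_subset)
    qed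
    show "norm (y i x) \<le> B i" if "x \<in> D" for x
      by (rule LIMSEQ_le_const2[OF tendsto_norm[OF y_lim[OF that]]]) (use Y_good that in \<open>auto simp: good_def\<close>)
  qed
  have y_tail: "norm (y i x - Y n i x) \<le> 4 * (1/2) ^ n * B i" if "x \<in> D" for n i x
    using tendsto_norm[OF tendsto_diff[OF y_lim[OF that, of i] tendsto_const[of "Y n i x"]]] tail[OF that, of n]
    by (intro LIMSEQ_le_const2) auto
  have "y i x = T y i x" if "x \<in> D" for i x
  proof (rule LIMSEQ_unique)
    have "norm (Y (Suc n) i x - T y i x) \<le> 4 * (1/2) ^ n * B i" for n
    proof -
      have "norm (T (Y n) i x - T y i x) \<le> (4 * (1/2) ^ n / 2) * B i"
        using y_tail by (intro T_contr[OF Y_good y_good _ _ that]) (auto simp: norm_minus_commute)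
      also have "\<dots> \<le> 4 * (1/2) ^ n * B i" using B by (intro mult_right_mono) auto
      finally show ?thesis by (simp add: YS)
    qed
    then have "(\<lambda>n. Y (Suc n) i x - T y i x) \<longlonglongrightarrow> 0"
      by (intro Lim_null_comparison[OF _ null[of "B i"]]) simp
    then show "(\<lambda>n. Y (Suc n) i x) \<longlonglongrightarrow> T y i x" by (simp add: LIM_zero_iff)
    show "(\<lambda>n. Y (Suc n) i x) \<longlonglongrightarrow> y i x" using y_lim[OF that] by (rule LIMSEQ_Suc)
  qed
  then show ?thesis using y_good S[OF y_good] unfolding good_def T_def by blast
qed

section \<open>Majorants for the coefficient system\<close>

text \<open>A product of two quantities related by \<^term>\<open>lip1\<close> is related by \<^term>\<open>lip2\<close>, so a polynomial of degree two
  without constant term is bounded and Lipschitz with one and the same majorant.\<close>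

definition lip1 :: "real \<Rightarrow> complex \<Rightarrow> complex \<Rightarrow> real \<Rightarrow> bool" where
  "lip1 d k k' M \<longleftrightarrow> 0 \<le> d \<and> norm k \<le> M \<and> norm k' \<le> M \<and> norm (k - k') \<le> d * M"

definition lip2 :: "real \<Rightarrow> complex \<Rightarrow> complex \<Rightarrow> real \<Rightarrow> bool" where
  "lip2 d k k' M \<longleftrightarrow> 0 \<le> d \<and> norm k \<le> M \<and> norm k' \<le> M \<and> norm (k - k') \<le> 2 * d * M"

lemma lip1_nonneg: "lip1 d k k' M \<Longrightarrow> 0 \<le> M"
  unfolding lip1_def using norm_ge_zero order_trans by blast

lemma lip1_imp_lip2: "lip1 d k k' M \<Longrightarrow> lip2 d k k' M"
proof -
  assume h: "lip1 d k k' M"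
  then have "0 \<le> d * M" using lip1_nonneg by (auto simp: lip1_def)
  with h show ?thesis by (auto simp: lip1_def lip2_def)
qed

lemma lip1_mono: "lip1 d k k' M \<Longrightarrow> M \<le> N \<Longrightarrow> lip1 d k k' N"
  unfolding lip1_def by (meson mult_left_mono order_trans)

lemma lip2_mono: "lip2 d k k' M \<Longrightarrow> M \<le> N \<Longrightarrow> lip2 d k k' N"
  unfolding lip2_def by (smt (verit) mult_left_mono mult_nonneg_nonneg)

lemma lip1_add: "lip1 d k k' M \<Longrightarrow> lip1 d l l' N \<Longrightarrow> lip1 d (k + l) (k' + l') (M + N)"
  unfolding lip1_def using norm_triangle_ineq[of k l] norm_triangle_ineq[of k' l']
    norm_triangle_ineq[of "k - k'" "l - l'"] by (auto simp: algebra_simps)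

lemma lip2_add: "lip2 d k k' M \<Longrightarrow> lip2 d l l' N \<Longrightarrow> lip2 d (k + l) (k' + l') (M + N)"
  unfolding lip2_def using norm_triangle_ineq[of k l] norm_triangle_ineq[of k' l']
    norm_triangle_ineq[of "k - k'" "l - l'"] by (auto simp: algebra_simps)

lemma lip2_uminus: "lip2 d k k' M \<Longrightarrow> lip2 d (- k) (- k') M"
  unfolding lip2_def by (simp add: norm_minus_commute)

lemma lip2_diff: "lip2 d k k' M \<Longrightarrow> lip2 d l l' N \<Longrightarrow> lip2 d (k - l) (k' - l') (M + N)"
  using lip2_add[OF _ lip2_uminus, of d k k' M l l' N] by simp

lemma lip1_cmult: "norm c \<le> m \<Longrightarrow> lip1 d k k' M \<Longrightarrow> lip1 d (c * k) (c * k') (m * M)"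
proof -
  assume c: "norm c \<le> m" and h: "lip1 d k k' M"
  have "norm (c * k) \<le> m * M" "norm (c * k') \<le> m * M" "norm (c * (k - k')) \<le> m * (d * M)"
    using c h norm_ge_zero[of c] order_trans[OF norm_ge_zero c] unfolding norm_mult lip1_def
    by (auto intro!: mult_mono)
  then show ?thesis using h by (simp add: lip1_def algebra_simps)
qed

lemma lip2_cmult: "norm c \<le> m \<Longrightarrow> lip2 d k k' M \<Longrightarrow> lip2 d (c * k) (c * k') (m * M)"
proof -
  assume c: "norm c \<le> m" and h: "lip2 d k k' M"
  have "norm (c * k) \<le> m * M" "norm (c * k') \<le> m * M" "norm (c * (k - k')) \<le> m * (2 * d * M)"
    using c h norm_ge_zero[of c] order_trans[OF norm_ge_zero c] unfolding norm_mult lip2_def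
    by (auto intro!: mult_mono)
  then show ?thesis using h by (simp add: lip2_def algebra_simps)
qed

lemma lip1_mult:
  assumes h: "lip1 d k k' M" and g: "lip1 d l l' N"
  shows "lip2 d (k * l) (k' * l') (M * N)"
proof -
  note nn = lip1_nonneg[OF h] lip1_nonneg[OF g]
  have "k * l - k' * l' = (k - k') * l + k' * (l - l')" by (simp add: algebra_simps)
  then have "norm (k * l - k' * l') \<le> norm (k - k') * norm l + norm k' * norm (l - l')"
    by (metis norm_mult norm_triangle_ineq)
  also have "\<dots> \<le> (d * M) * N + M * (d * N)"
    using h g nn unfolding lip1_def by (intro add_mono mult_mono) auto
  finally have "norm (k * l - k' * l') \<le> 2 * d * (M * N)" by (simp add: algebra_simps)
  moreover have "norm (k * l) \<le> M * N" "norm (k' * l') \<le> M * N"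
    using h g nn unfolding lip1_def norm_mult by (auto intro!: mult_mono)
  ultimately show ?thesis using h by (simp add: lip1_def lip2_def)
qed

lemma lip2_sum:
  assumes "finite A" "0 \<le> d" "\<And>j. j \<in> A \<Longrightarrow> lip2 d (f j) (f' j) (M j)"
  shows "lip2 d (\<Sum>j\<in>A. f j) (\<Sum>j\<in>A. f' j) (\<Sum>j\<in>A. M j)"
  using assms
proof (induction A rule: finite_induct)
  case empty then show ?case by (simp add: lip2_def)
next
  case (insert a A)
  then show ?case by (simp add: lip2_add)
qed

text \<open>The inverse square makes convolution of the weights cost only a constant factor, so that
  sequences bounded by them are closed under Cauchy products; pure geometric weights would lose a
  factor n + 1.\<close>

definition wt :: "real \<Rightarrow> nat \<Rightarrow> real" where
  "wt \<rho> n = \<rho> ^ n / (real n + 1)\<^sup>2"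

lemma wt_pos: "0 < \<rho> \<Longrightarrow> 0 < wt \<rho> n"
  by (simp add: wt_def)

lemma wt_0 [simp]: "wt \<rho> 0 = 1"
  by (simp add: wt_def)

lemma wt_Suc_le: "0 < \<rho> \<Longrightarrow> wt \<rho> (Suc n) \<le> \<rho> * wt \<rho> n"
  by (simp add: wt_def divide_simps add_pos_nonneg)

text \<open>A large \<rho> makes the cost of raising the index small. This pays for
  \<open>cQ\<close>, which enters the equation of \<open>Ia (Suc n)\<close> with index n and without
  any factor 1/x.\<close>

lemma wt_le_Suc: "0 < \<rho> \<Longrightarrow> wt \<rho> n \<le> 4 / \<rho> * wt \<rho> (Suc n)"
proof -
  assume r: "0 < \<rho>"
  have "(2 + real n)\<^sup>2 \<le> (2 * (real n + 1))\<^sup>2" by (intro power_mono) auto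
  then have "\<rho> ^ n * (2 + real n)\<^sup>2 \<le> \<rho> ^ n * (2 * (real n + 1))\<^sup>2"
    using r by (intro mult_left_mono) auto
  then have "\<rho> ^ n * (2 + real n)\<^sup>2 \<le> 4 * \<rho> ^ n * (real n + 1)\<^sup>2"
    by (simp only: power_mult_distrib) simp
  then have "\<rho> ^ n / (real n + 1)\<^sup>2 \<le> 4 * \<rho> ^ n / (2 + real n)\<^sup>2"
    by (simp add: frac_le_eq divide_simps add_pos_nonneg) 
  then show ?thesis using r by (simp add: wt_def add.commute)
qed

lemma sum_inverse_squares: "(\<Sum>j\<le>n. 1 / (real j + 1)\<^sup>2) \<le> 2 - 1 / (real n + 1)"
proof (induction n)
  case (Suc n)
  have "1 / (real n + 2)\<^sup>2 \<le> 1 / ((real n + 1) * (real n + 2))"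
    by (intro divide_left_mono) (auto simp: power2_eq_square)
  also have "\<dots> = 1 / (real n + 1) - 1 / (real n + 2)"
    by (simp add: field_simps)
  finally show ?case using Suc by (simp add: add.commute)
qed auto

text \<open>With a = j + 1 and b = n - j + 1 the sum a + b is n + 2, and 1/(ab) = (1/a + 1/b)/(a +
  b). This pulls the weight of index n out of the product and leaves two sums of inverse squares,
  each at most 2.\<close>

lemma wt_convolution:
  assumes "0 < \<rho>"
  shows "(\<Sum>j\<le>n. wt \<rho> j * wt \<rho> (n - j)) \<le> 8 * wt \<rho> n"
proof -
  have summand: "wt \<rho> j * wt \<rho> (n - j) \<le>
      2 * \<rho> ^ n / (real n + 1)\<^sup>2 * (1 / (real j + 1)\<^sup>2 + 1 / (real (n - j) + 1)\<^sup>2)" if "j \<le> n" for j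
  proof -
    define a b where "a = real j + 1" and "b = real (n - j) + 1"
    have ab: "0 < a" "0 < b" "a + b = real n + 2" using that by (auto simp: a_def b_def)
    have "1 / (a\<^sup>2 * b\<^sup>2) = (1 / a + 1 / b)\<^sup>2 / (a + b)\<^sup>2"
    proof -
      have "1 / a + 1 / b = (a + b) / (a * b)" using ab(1,2) by (simp add: field_simps)
      then show ?thesis using ab(1,2) by (simp add: power_divide power_mult_distrib)
    qed
    also have "\<dots> \<le> 2 * (1 / a\<^sup>2 + 1 / b\<^sup>2) / (real n + 1)\<^sup>2"
    proof (rule frac_le)
      have "(1 / a + 1 / b)\<^sup>2 + (1 / a - 1 / b)\<^sup>2 = 2 * ((1 / a)\<^sup>2 + (1 / b)\<^sup>2)"
        by (simp add: power2_eq_square algebra_simps)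
      then show "(1 / a + 1 / b)\<^sup>2 \<le> 2 * (1 / a\<^sup>2 + 1 / b\<^sup>2)"
        using zero_le_power2[of "1 / a - 1 / b"] by (simp only: power_one_over)
      show "(real n + 1)\<^sup>2 \<le> (a + b)\<^sup>2" using ab by (intro power_mono) auto
    qed (use ab in auto)
    finally have "\<rho> ^ n * (1 / (a\<^sup>2 * b\<^sup>2)) \<le> \<rho> ^ n * (2 * (1 / a\<^sup>2 + 1 / b\<^sup>2) / (real n + 1)\<^sup>2)"
      using assms by (intro mult_left_mono) auto
    moreover have "\<rho> ^ n = \<rho> ^ j * \<rho> ^ (n - j)" using that by (simp flip: power_add)
    ultimately show ?thesis by (simp add: wt_def a_def b_def algebra_simps add_divide_distrib)
  qed
  have "(\<Sum>j\<le>n. wt \<rho> j * wt \<rho> (n - j)) \<le>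
      (\<Sum>j\<le>n. 2 * \<rho> ^ n / (real n + 1)\<^sup>2 * (1 / (real j + 1)\<^sup>2 + 1 / (real (n - j) + 1)\<^sup>2))"
    by (intro sum_mono summand) auto
  also have "\<dots> = 2 * \<rho> ^ n / (real n + 1)\<^sup>2 *
      ((\<Sum>j\<le>n. 1 / (real j + 1)\<^sup>2) + (\<Sum>j\<le>n. 1 / (real (n - j) + 1)\<^sup>2))"
    unfolding sum.distrib[symmetric] sum_distrib_left ..
  also have "(\<Sum>j\<le>n. 1 / (real (n - j) + 1)\<^sup>2) = (\<Sum>j\<le>n. 1 / (real j + 1)\<^sup>2)"
    by (rule sum.reindex_bij_witness[of _ "\<lambda>j. n - j" "\<lambda>j. n - j"]) auto
  also have "2 * \<rho> ^ n / (real n + 1)\<^sup>2 * ((\<Sum>j\<le>n. 1 / (real j + 1)\<^sup>2) + (\<Sum>j\<le>n. 1 / (real j + 1)\<^sup>2))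
      \<le> 2 * \<rho> ^ n / (real n + 1)\<^sup>2 * (2 + 2)"
  proof (rule mult_left_mono)
    have "(\<Sum>j\<le>n. 1 / (real j + 1)\<^sup>2) \<le> 2"
      by (rule order_trans[OF sum_inverse_squares]) simp
    then show "(\<Sum>j\<le>n. 1 / (real j + 1)\<^sup>2) + (\<Sum>j\<le>n. 1 / (real j + 1)\<^sup>2) \<le> 2 + 2" by simp
  qed (use assms in simp)
  also have "\<dots> = 8 * wt \<rho> n" by (simp add: wt_def)
  finally show ?thesis .
qed

section \<open>Unknowns and right sides of the coefficient system\<close>

datatype idx = IA | IB | Ia nat | Iph nat | Iga nat | Ip nat | Iq nat

text \<open>\<^term>\<open>Iph\<close>, \<^term>\<open>Iga\<close>, \<^term>\<open>Ip\<close> and \<^term>\<open>Iq\<close> index the coefficients belonging to the entries f-, g-, f+ and g+,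
  \<^term>\<open>Ia\<close> those of f0, while \<^term>\<open>IA\<close> and \<^term>\<open>IB\<close> index the parts of f+ and g+ free of exponentials.
  The unknowns are scaled to be bounded: the coefficients of order zero of the series
  belonging to \<^term>\<open>Ia\<close>, \<^term>\<open>Iga\<close> and \<^term>\<open>Ip\<close> decay like the second, first and first power of
  \<^term>\<open>inverse x\<close>. Here \<^term>\<open>u\<close> stands for \<^term>\<open>inverse x\<close>.\<close>

definition va :: "(idx \<Rightarrow> complex) \<Rightarrow> complex \<Rightarrow> nat \<Rightarrow> complex" where
  "va y u n = (if n = 0 then u\<^sup>2 * y (Ia 0) else y (Ia n))"

definition vg :: "(idx \<Rightarrow> complex) \<Rightarrow> complex \<Rightarrow> nat \<Rightarrow> complex" where
  "vg y u n = (if n = 0 then u * y (Iga 0) else y (Iga n))"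

definition vp :: "(idx \<Rightarrow> complex) \<Rightarrow> complex \<Rightarrow> nat \<Rightarrow> complex" where
  "vp y u n = (if n = 0 then u * y (Ip 0) else y (Ip n))"

definition vW :: "(idx \<Rightarrow> complex) \<Rightarrow> complex \<Rightarrow> complex" where
  "vW y u = y IA + u * y IB"

text \<open>Writing a, phi, gamma, p, q for the power series in w of the five families,
  \<open>cG\<close>, \<open>cP\<close> and \<open>cQ\<close> are the coefficients of a (gamma +
  phi), a (p + q) and q phi - gamma p.\<close>

definition cG :: "(idx \<Rightarrow> complex) \<Rightarrow> complex \<Rightarrow> nat \<Rightarrow> complex" where
  "cG y u n = (\<Sum>j\<le>n. va y u j * (vg y u (n - j) + y (Iph (n - j))))"

definition cP :: "(idx \<Rightarrow> complex) \<Rightarrow> complex \<Rightarrow> nat \<Rightarrow> complex" where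
  "cP y u n = (\<Sum>j\<le>n. va y u j * (vp y u (n - j) + y (Iq (n - j))))"

definition cQ :: "(idx \<Rightarrow> complex) \<Rightarrow> complex \<Rightarrow> nat \<Rightarrow> complex" where
  "cQ y u n = (\<Sum>j\<le>n. y (Iq j) * y (Iph (n - j)) - vg y u j * vp y u (n - j))"

context
  fixes th ta ka sg :: complex
begin

text \<open>With r = \<open>rate i\<close> the equations read Y' = |r| rhs - r Y if r \<noteq> 0, Y'
  = rhs / x^2 if r = 0, and Y' = (Y + rhs) / x for \<open>Ia 0\<close>. Division by |r| explains the
  denominators. In the application \<open>th\<close>, \<open>ta\<close>, \<open>ka\<close>,
  \<open>sg\<close> are \<theta>x, \<theta>x + \<theta>inf, the product of the two gammas of
  superscript 0, and \<sigma>0. The terms with \<open>ka * Ia (Suc n) * vW\<close> are the coupling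
  to the next mode.\<close>

fun rhs :: "idx \<Rightarrow> (idx \<Rightarrow> complex) \<Rightarrow> complex \<Rightarrow> complex" where
  "rhs IA y u = ta * y IB - 2 * (y (Ia 0) * vW y u)"
| "rhs IB y u = (1 - th - ta) * (u * y IB) - th * y IA + 2 * u * (y (Ia 0) * vW y u)"
| "rhs (Ia 0) y u = ka * (y IB * y (Iph 0) - y (Iga 0) * y IA)"
| "rhs (Iph 0) y u = - ta * y (Iga 0) + 2 * (y (Ia 0) * (vg y u 0 + y (Iph 0)))"
| "rhs (Iga 0) y u = (1 + th + ta) * vg y u 0 + th * y (Iph 0) - 2 * u * (y (Ia 0) * (vg y u 0 + y (Iph 0)))"
| "rhs (Ip 0) y u = (1 - sg) * vp y u 0 + ta * y (Iq 0) - 2 * u * (y (Ia 0) * (vp y u 0 + y (Iq 0)))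
     - 2 * ka * u * (y (Ia 1) * vW y u)"
| "rhs (Iq 0) y u = - th * y (Ip 0) + 2 * (y (Ia 0) * (vp y u 0 + y (Iq 0))) + 2 * ka * (y (Ia 1) * vW y u)"
| "rhs (Ia (Suc n)) y u = - ((1 + of_nat (Suc n) * (sg - 2)) / of_nat (Suc n)) * u * va y u (Suc n)
     + ka * u\<^sup>2 / of_nat (Suc n) * (u * y IB * y (Iph (Suc n)) - vg y u (Suc n) * y IA)
     + 1 / of_nat (Suc n) * cQ y u n"
| "rhs (Iph (Suc n)) y u = - (sg - 2) * u * y (Iph (Suc n)) - ta * u / of_nat (Suc n) * vg y u (Suc n)
     + 2 / of_nat (Suc n) * cG y u (Suc n)"
| "rhs (Iga (Suc n)) y u = - (of_nat (Suc n) * (sg - 2) / of_nat (Suc (Suc n))) * u * vg y u (Suc n)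
     + (th + ta) * u / of_nat (Suc (Suc n)) * vg y u (Suc n) + th * u / of_nat (Suc (Suc n)) * y (Iph (Suc n))
     - 2 / of_nat (Suc (Suc n)) * cG y u (Suc n)"
| "rhs (Ip (Suc n)) y u = - ((sg + of_nat (Suc n) * (sg - 2)) / of_nat (Suc (Suc n))) * u * vp y u (Suc n)
     + ta * u / of_nat (Suc (Suc n)) * y (Iq (Suc n)) - 2 / of_nat (Suc (Suc n)) * cP y u (Suc n)
     - 2 * ka * u\<^sup>2 / of_nat (Suc (Suc n)) * (y (Ia (Suc (Suc n))) * vW y u)"
| "rhs (Iq (Suc n)) y u = - (sg - 2) * u * y (Iq (Suc n)) - th * u / of_nat (Suc n) * vp y u (Suc n)
     + 2 / of_nat (Suc n) * cP y u (Suc n) + 2 * ka * u\<^sup>2 / of_nat (Suc n) * (y (Ia (Suc (Suc n))) * vW y u)"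

end

text \<open>Three scales: \<open>M\<close> for unknowns driven by a linear source of the size of the
  parameters, its square for \<open>Ia 0\<close>, whose source is itself of size \<open>M\<close>,
  and a small \<xi> for the positive modes of f0, because they multiply the other series in
  \<open>cG\<close> and \<open>cP\<close>.\<close>

fun bnd :: "real \<Rightarrow> real \<Rightarrow> real \<Rightarrow> idx \<Rightarrow> real" where
  "bnd M \<xi> \<rho> IA = 2"
| "bnd M \<xi> \<rho> IB = M"
| "bnd M \<xi> \<rho> (Ia n) = (if n = 0 then M\<^sup>2 else \<xi> * wt \<rho> n)"
| "bnd M \<xi> \<rho> (Iph n) = 2 * wt \<rho> n"
| "bnd M \<xi> \<rho> (Iga n) = (if n = 0 then M else 2 * wt \<rho> n)"
| "bnd M \<xi> \<rho> (Ip n) = (if n = 0 then M else 2 * wt \<rho> n)"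
| "bnd M \<xi> \<rho> (Iq n) = 2 * wt \<rho> n"

fun rbnd :: "real \<Rightarrow> real \<Rightarrow> real \<Rightarrow> real \<Rightarrow> real \<Rightarrow> idx \<Rightarrow> real" where
  "rbnd \<Lambda> M \<xi> \<rho> t IA = \<Lambda> * M + 6 * M\<^sup>2"
| "rbnd \<Lambda> M \<xi> \<rho> t IB = 3 * \<Lambda> + 6 * t * M\<^sup>2"
| "rbnd \<Lambda> M \<xi> \<rho> t (Ia 0) = 4 * \<Lambda> * M"
| "rbnd \<Lambda> M \<xi> \<rho> t (Iph 0) = \<Lambda> * M + 8 * M\<^sup>2"
| "rbnd \<Lambda> M \<xi> \<rho> t (Iga 0) = 4 * \<Lambda> + 8 * t * M\<^sup>2"
| "rbnd \<Lambda> M \<xi> \<rho> t (Ip 0) = 4 * \<Lambda> + 8 * t * M\<^sup>2 + 6 * \<Lambda> * t * \<xi> * \<rho>"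
| "rbnd \<Lambda> M \<xi> \<rho> t (Iq 0) = \<Lambda> * M + 8 * M\<^sup>2 + 6 * \<Lambda> * \<xi> * \<rho>"
| "rbnd \<Lambda> M \<xi> \<rho> t (Ia (Suc n)) = (\<Lambda> * t * \<xi> + 6 * \<Lambda> * t\<^sup>2 + 256 / \<rho>) * wt \<rho> (Suc n)"
| "rbnd \<Lambda> M \<xi> \<rho> t (Iph (Suc n)) = (6 * \<Lambda> * t + 64 * \<xi> + 6 * \<Lambda> * t\<^sup>2 * \<xi> * \<rho>) * wt \<rho> (Suc n)"
| "rbnd \<Lambda> M \<xi> \<rho> t (Iga (Suc n)) = (6 * \<Lambda> * t + 64 * \<xi> + 6 * \<Lambda> * t\<^sup>2 * \<xi> * \<rho>) * wt \<rho> (Suc n)"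
| "rbnd \<Lambda> M \<xi> \<rho> t (Ip (Suc n)) = (6 * \<Lambda> * t + 64 * \<xi> + 6 * \<Lambda> * t\<^sup>2 * \<xi> * \<rho>) * wt \<rho> (Suc n)"
| "rbnd \<Lambda> M \<xi> \<rho> t (Iq (Suc n)) = (6 * \<Lambda> * t + 64 * \<xi> + 6 * \<Lambda> * t\<^sup>2 * \<xi> * \<rho>) * wt \<rho> (Suc n)"

lemma norm_divide_of_nat_le: "norm (c / of_nat (Suc n) :: complex) \<le> norm c"
  using mult_left_mono[of 1 "real (Suc n)" "norm c"] by (simp add: norm_divide divide_le_eq del: of_nat_Suc)

text \<open>The two conditions on \<open>t\<close>, a bound of |1/x|, make the scaled coefficients
  of order zero obey the same majorants as the others. Hence \<open>va\<close> is bounded by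
  \<open>\<xi> * wt \<rho> n\<close>, and \<open>vg\<close> and \<open>vp\<close> by
  \<open>2 * wt \<rho> n\<close>, for every n, and the convolution estimate applies without
  exceptions. The rest is term by term.\<close>

lemma rhs_lip:
  fixes th ta ka sg u :: complex
  assumes \<Lambda>: "norm th \<le> \<Lambda>" "norm ta \<le> \<Lambda>" "norm ka \<le> \<Lambda>" "norm (1 - th - ta) \<le> \<Lambda>"
      "norm (1 + th + ta) \<le> \<Lambda>" "norm (1 - sg) \<le> \<Lambda>" "1 + norm (sg - 2) \<le> \<Lambda>" "norm sg + norm (sg - 2) \<le> \<Lambda>"
      "norm (th + ta) \<le> \<Lambda>"
    and u: "norm u \<le> t"
    and pos: "0 < M" "0 < \<xi>" "0 < \<rho>" "0 < t"
    and t: "t * M \<le> 1" "t\<^sup>2 * M\<^sup>2 \<le> \<xi>"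
    and y: "\<And>j. lip1 d (y j) (y' j) (bnd M \<xi> \<rho> j)"
  shows "lip2 d (rhs th ta ka sg i y u) (rhs th ta ka sg i y' u) (rbnd \<Lambda> M \<xi> \<rho> t i)"
proof -
  note nt = norm_divide_of_nat_le
  have d: "0 \<le> d" using y by (simp add: lip1_def)
  have \<Lambda>0: "0 \<le> \<Lambda>" using \<Lambda>(1) norm_ge_zero order_trans by blast
  note wp = wt_pos[OF pos(3)]
  have u2: "norm (u\<^sup>2) \<le> t\<^sup>2" using u by (simp add: norm_power power_mono)
  have va: "lip1 d (va y u n) (va y' u n) (\<xi> * wt \<rho> n)" for n
  proof (cases "n = 0")
    case True
    show ?thesis using lip1_mono[OF lip1_cmult[OF u2 y[of "Ia 0"]]] t(2) True by (simp add: va_def)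
  next
    case False then show ?thesis using y[of "Ia n"] by (simp add: va_def)
  qed
  have vg: "lip1 d (vg y u n) (vg y' u n) (2 * wt \<rho> n)" for n
  proof (cases "n = 0")
    case True
    show ?thesis using lip1_mono[OF lip1_cmult[OF u y[of "Iga 0"]]] t(1) True by (simp add: vg_def)
  next
    case False then show ?thesis using y[of "Iga n"] by (simp add: vg_def)
  qed
  have vp: "lip1 d (vp y u n) (vp y' u n) (2 * wt \<rho> n)" for n
  proof (cases "n = 0")
    case True
    show ?thesis using lip1_mono[OF lip1_cmult[OF u y[of "Ip 0"]]] t(1) True by (simp add: vp_def)
  next
    case False then show ?thesis using y[of "Ip n"] by (simp add: vp_def)
  qed
  have ph: "lip1 d (y (Iph n)) (y' (Iph n)) (2 * wt \<rho> n)" for n using y[of "Iph n"] by simp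
  have q: "lip1 d (y (Iq n)) (y' (Iq n)) (2 * wt \<rho> n)" for n using y[of "Iq n"] by simp
  have b: "lip1 d (u * y IB) (u * y' IB) 1"
    using lip1_mono[OF lip1_cmult[OF u y[of IB]]] t(1) by simp
  have A: "lip1 d (y IA) (y' IA) 2" using y[of IA] by simp
  have yB: "lip1 d (y IB) (y' IB) M" using y[of IB] by simp
  have a0: "lip1 d (y (Ia 0)) (y' (Ia 0)) (M\<^sup>2)" using y[of "Ia 0"] by simp
  have g0: "lip1 d (y (Iga 0)) (y' (Iga 0)) M" using y[of "Iga 0"] by simp
  have p0: "lip1 d (y (Ip 0)) (y' (Ip 0)) M" using y[of "Ip 0"] by simp
  have W: "lip1 d (vW y u) (vW y' u) 3" using lip1_add[OF A b] by (simp add: vW_def)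
  have aS: "lip1 d (y (Ia (Suc n))) (y' (Ia (Suc n))) (\<xi> * (\<rho> * wt \<rho> n))" for n
    using lip1_mono[OF y[of "Ia (Suc n)"], of "\<xi> * (\<rho> * wt \<rho> n)"] wt_Suc_le[OF pos(3), of n] pos by simp
  have gp: "lip1 d (vg y u n + y (Iph n)) (vg y' u n + y' (Iph n)) (4 * wt \<rho> n)" for n
    using lip1_add[OF vg ph, of n n] by simp
  have pq: "lip1 d (vp y u n + y (Iq n)) (vp y' u n + y' (Iq n)) (4 * wt \<rho> n)" for n
    using lip1_add[OF vp q, of n n] by simp
  have cG: "lip2 d (cG y u n) (cG y' u n) (32 * \<xi> * wt \<rho> n)" for n
  proof -
    have "(\<Sum>j\<le>n. \<xi> * wt \<rho> j * (4 * wt \<rho> (n - j))) = 4 * \<xi> * (\<Sum>j\<le>n. wt \<rho> j * wt \<rho> (n - j))"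
      by (simp add: sum_distrib_left mult_ac)
    also have "\<dots> \<le> 4 * \<xi> * (8 * wt \<rho> n)" using wt_convolution[OF pos(3)] pos by (intro mult_left_mono) auto
    finally have le: "(\<Sum>j\<le>n. \<xi> * wt \<rho> j * (4 * wt \<rho> (n - j))) \<le> 32 * \<xi> * wt \<rho> n" by simp
    show ?thesis unfolding cG_def
      by (rule lip2_mono[OF lip2_sum[OF _ d lip1_mult[OF va gp]] le]) simp
  qed
  have cP: "lip2 d (cP y u n) (cP y' u n) (32 * \<xi> * wt \<rho> n)" for n
  proof -
    have "(\<Sum>j\<le>n. \<xi> * wt \<rho> j * (4 * wt \<rho> (n - j))) = 4 * \<xi> * (\<Sum>j\<le>n. wt \<rho> j * wt \<rho> (n - j))"
      by (simp add: sum_distrib_left mult_ac)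
    also have "\<dots> \<le> 4 * \<xi> * (8 * wt \<rho> n)" using wt_convolution[OF pos(3)] pos by (intro mult_left_mono) auto
    finally have le: "(\<Sum>j\<le>n. \<xi> * wt \<rho> j * (4 * wt \<rho> (n - j))) \<le> 32 * \<xi> * wt \<rho> n" by simp
    show ?thesis unfolding cP_def
      by (rule lip2_mono[OF lip2_sum[OF _ d lip1_mult[OF va pq]] le]) simp
  qed
  have cQ: "lip2 d (cQ y u n) (cQ y' u n) (256 / \<rho> * wt \<rho> (Suc n))" for n
  proof -
    have "(\<Sum>j\<le>n. 2 * wt \<rho> j * (2 * wt \<rho> (n - j)) + 2 * wt \<rho> j * (2 * wt \<rho> (n - j)))
        = 8 * (\<Sum>j\<le>n. wt \<rho> j * wt \<rho> (n - j))"
      by (simp add: sum_distrib_left mult_ac)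
    also have "\<dots> \<le> 64 * wt \<rho> n" using wt_convolution[OF pos(3), of n] by simp
    also have "\<dots> \<le> 256 / \<rho> * wt \<rho> (Suc n)" using wt_le_Suc[OF pos(3), of n] by simp
    finally have le: "(\<Sum>j\<le>n. 2 * wt \<rho> j * (2 * wt \<rho> (n - j)) + 2 * wt \<rho> j * (2 * wt \<rho> (n - j)))
        \<le> 256 / \<rho> * wt \<rho> (Suc n)" .
    show ?thesis unfolding cQ_def
      by (rule lip2_mono[OF lip2_sum[OF _ d lip2_diff[OF lip1_mult[OF q ph] lip1_mult[OF vg vp]]] le]) simp
  qed
  have n2: "norm (2 :: complex) \<le> 2" by simp
  have n2u: "norm (2 * u) \<le> 2 * t" using u by (simp add: norm_mult)
  have nk: "norm (2 * ka * u) \<le> 2 * \<Lambda> * t" "norm (2 * ka) \<le> 2 * \<Lambda>"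
    using u \<Lambda> \<Lambda>0 by (auto simp: norm_mult intro!: mult_mono)
  have nk2: "norm (2 * ka * u\<^sup>2 / of_nat (Suc n)) \<le> 2 * \<Lambda> * t\<^sup>2" for n
    by (rule order_trans[OF nt]) (use u2 \<Lambda> \<Lambda>0 in \<open>auto simp: norm_mult intro!: mult_mono\<close>)
  have nk3: "norm (ka * u\<^sup>2 / of_nat (Suc n)) \<le> \<Lambda> * t\<^sup>2" for n
    by (rule order_trans[OF nt]) (use u2 \<Lambda> \<Lambda>0 in \<open>auto simp: norm_mult intro!: mult_mono\<close>)
  have nc: "norm (c * u / of_nat (Suc n)) \<le> \<Lambda> * t" if "norm c \<le> \<Lambda>" for c n
    by (rule order_trans[OF nt]) (use u that \<Lambda>0 in \<open>auto simp: norm_mult intro!: mult_mono\<close>)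
  have ns: "norm (c * u) \<le> \<Lambda> * t" if "norm c \<le> \<Lambda>" for c
    using u that \<Lambda>0 by (auto simp: norm_mult intro!: mult_mono)
  have n2n: "norm (2 / of_nat (Suc n) :: complex) \<le> 2" "norm (1 / of_nat (Suc n) :: complex) \<le> 1" for n
    using nt[of 2 n] nt[of 1 n] by (auto simp del: of_nat_Suc)
  have s2: "norm (- (sg - 2)) \<le> \<Lambda>" unfolding norm_minus_cancel using \<Lambda>(7) by linarith
  have s3: "norm (- ((1 + of_nat (Suc n) * (sg - 2)) / of_nat (Suc n))) \<le> \<Lambda>" for n
  proof -
    have "(1 + of_nat (Suc n) * (sg - 2)) / of_nat (Suc n) = 1 / of_nat (Suc n) + (sg - 2)"
      by (simp add: field_simps del: of_nat_Suc)
    then show ?thesis unfolding norm_minus_cancel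
      using norm_triangle_ineq[of "1 / of_nat (Suc n)" "sg - 2"] n2n(2)[of n] \<Lambda>(7) by simp
  qed
  have r: "norm (of_nat (Suc n) / of_nat (Suc (Suc n)) :: complex) \<le> 1" for n
    by (simp add: norm_divide del: of_nat_Suc)
  have s4: "norm (- (of_nat (Suc n) * (sg - 2) / of_nat (Suc (Suc n)))) \<le> \<Lambda>" for n
  proof -
    have "norm (of_nat (Suc n) / of_nat (Suc (Suc n)) * (sg - 2)) \<le> 1 * norm (sg - 2)"
      unfolding norm_mult by (intro mult_right_mono r) auto
    then show ?thesis unfolding norm_minus_cancel using \<Lambda>(7) by simp
  qed
  have s5: "norm (- ((sg + of_nat (Suc n) * (sg - 2)) / of_nat (Suc (Suc n)))) \<le> \<Lambda>" for n
  proof -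
    have "norm (of_nat (Suc n) / of_nat (Suc (Suc n)) * (sg - 2)) \<le> 1 * norm (sg - 2)"
      unfolding norm_mult by (intro mult_right_mono r) auto
    then show ?thesis unfolding norm_minus_cancel add_divide_distrib
      using norm_triangle_ineq[of "sg / of_nat (Suc (Suc n))" "of_nat (Suc n) * (sg - 2) / of_nat (Suc (Suc n))"]
        nt[of sg "Suc n"] \<Lambda>(8) by simp
  qed
  have nth: "norm (- th) \<le> \<Lambda>" "norm (- ta) \<le> \<Lambda>" using \<Lambda> by auto
  note LL = lip2_cmult[OF _ lip1_imp_lip2]
  have mm: "0 \<le> \<Lambda> * t * wt \<rho> n" "0 \<le> \<Lambda> * t\<^sup>2 * \<xi> * \<rho> * wt \<rho> n" for n
    using \<Lambda>0 pos wp[of n] by auto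
  show ?thesis
  proof (cases i)
    case IA
    have "lip2 d (rhs th ta ka sg IA y u) (rhs th ta ka sg IA y' u) (\<Lambda> * M + 2 * (M\<^sup>2 * 3))"
      unfolding rhs.simps by (rule lip2_diff[OF LL[OF \<Lambda>(2) yB] lip2_cmult[OF n2 lip1_mult[OF a0 W]]])
    from lip2_mono[OF this] show ?thesis by (simp add: IA)
  next
    case IB
    have "lip2 d (rhs th ta ka sg IB y u) (rhs th ta ka sg IB y' u) (\<Lambda> * 1 + \<Lambda> * 2 + 2 * t * (M\<^sup>2 * 3))"
      unfolding rhs.simps
      by (rule lip2_add[OF lip2_diff[OF LL[OF \<Lambda>(4) b] LL[OF \<Lambda>(1) A]] lip2_cmult[OF n2u lip1_mult[OF a0 W]]])
    from lip2_mono[OF this] show ?thesis by (simp add: IB)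
  next
    case i: (Ia n)
    show ?thesis
    proof (cases n)
      case 0
      have "lip2 d (rhs th ta ka sg (Ia 0) y u) (rhs th ta ka sg (Ia 0) y' u)
          (\<Lambda> * (M * (2 * wt \<rho> 0) + M * 2))"
        unfolding rhs.simps by (rule lip2_cmult[OF \<Lambda>(3) lip2_diff[OF lip1_mult[OF yB ph] lip1_mult[OF g0 A]]])
      from lip2_mono[OF this] show ?thesis by (simp add: i 0)
    next
      case (Suc m)
      have "lip2 d (rhs th ta ka sg (Ia (Suc m)) y u) (rhs th ta ka sg (Ia (Suc m)) y' u)
          (\<Lambda> * t * (\<xi> * wt \<rho> (Suc m)) + \<Lambda> * t\<^sup>2 * (1 * (2 * wt \<rho> (Suc m)) + 2 * wt \<rho> (Suc m) * 2)
            + 1 * (256 / \<rho> * wt \<rho> (Suc m)))"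
        unfolding rhs.simps
        by (rule lip2_add[OF lip2_add[OF LL[OF ns[OF s3] va]
              lip2_cmult[OF nk3 lip2_diff[OF lip1_mult[OF b ph] lip1_mult[OF vg A]]]] lip2_cmult[OF n2n(2) cQ]])
      from lip2_mono[OF this] show ?thesis by (simp add: i Suc algebra_simps)
    qed
  next
    case i: (Iph n)
    show ?thesis
    proof (cases n)
      case 0
      have "lip2 d (rhs th ta ka sg (Iph 0) y u) (rhs th ta ka sg (Iph 0) y' u)
          (\<Lambda> * M + 2 * (M\<^sup>2 * (4 * wt \<rho> 0)))"
        unfolding rhs.simps by (rule lip2_add[OF LL[OF nth(2) g0] lip2_cmult[OF n2 lip1_mult[OF a0 gp]]])
      from lip2_mono[OF this] show ?thesis by (simp add: i 0)
    next
      case (Suc m)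
      have "lip2 d (rhs th ta ka sg (Iph (Suc m)) y u) (rhs th ta ka sg (Iph (Suc m)) y' u)
          (\<Lambda> * t * (2 * wt \<rho> (Suc m)) + \<Lambda> * t * (2 * wt \<rho> (Suc m)) + 2 * (32 * \<xi> * wt \<rho> (Suc m)))"
        unfolding rhs.simps
        by (rule lip2_add[OF lip2_diff[OF LL[OF ns[OF s2] ph] LL[OF nc[OF \<Lambda>(2)] vg]] lip2_cmult[OF n2n(1) cG]])
      from lip2_mono[OF this] show ?thesis using mm[of "Suc m"] by (simp add: i Suc algebra_simps)
    qed
  next
    case i: (Iga n)
    show ?thesis
    proof (cases n)
      case 0
      have "lip2 d (rhs th ta ka sg (Iga 0) y u) (rhs th ta ka sg (Iga 0) y' u)
          (\<Lambda> * (2 * wt \<rho> 0) + \<Lambda> * (2 * wt \<rho> 0) + 2 * t * (M\<^sup>2 * (4 * wt \<rho> 0)))"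
        unfolding rhs.simps
        by (rule lip2_diff[OF lip2_add[OF LL[OF \<Lambda>(5) vg] LL[OF \<Lambda>(1) ph]] lip2_cmult[OF n2u lip1_mult[OF a0 gp]]])
      from lip2_mono[OF this] show ?thesis by (simp add: i 0)
    next
      case (Suc m)
      have "lip2 d (rhs th ta ka sg (Iga (Suc m)) y u) (rhs th ta ka sg (Iga (Suc m)) y' u)
          (\<Lambda> * t * (2 * wt \<rho> (Suc m)) + \<Lambda> * t * (2 * wt \<rho> (Suc m)) + \<Lambda> * t * (2 * wt \<rho> (Suc m))
            + 2 * (32 * \<xi> * wt \<rho> (Suc m)))"
        unfolding rhs.simps
        by (rule lip2_diff[OF lip2_add[OF lip2_add[OF LL[OF ns[OF s4] vg] LL[OF nc[OF \<Lambda>(9)] vg]]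
              LL[OF nc[OF \<Lambda>(1)] ph]] lip2_cmult[OF n2n(1) cG]])
      from lip2_mono[OF this] show ?thesis using mm[of "Suc m"] by (simp add: i Suc algebra_simps)
    qed
  next
    case i: (Ip n)
    show ?thesis
    proof (cases n)
      case 0
      have "lip2 d (rhs th ta ka sg (Ip 0) y u) (rhs th ta ka sg (Ip 0) y' u)
          (\<Lambda> * (2 * wt \<rho> 0) + \<Lambda> * (2 * wt \<rho> 0) + 2 * t * (M\<^sup>2 * (4 * wt \<rho> 0))
            + 2 * \<Lambda> * t * (\<xi> * (\<rho> * wt \<rho> 0) * 3))"
        unfolding rhs.simps One_nat_def
        by (rule lip2_diff[OF lip2_diff[OF lip2_add[OF LL[OF \<Lambda>(6) vp] LL[OF \<Lambda>(2) q]]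
              lip2_cmult[OF n2u lip1_mult[OF a0 pq]]] lip2_cmult[OF nk(1) lip1_mult[OF aS W]]])
      from lip2_mono[OF this] show ?thesis by (simp add: i 0)
    next
      case (Suc m)
      have "lip2 d (rhs th ta ka sg (Ip (Suc m)) y u) (rhs th ta ka sg (Ip (Suc m)) y' u)
          (\<Lambda> * t * (2 * wt \<rho> (Suc m)) + \<Lambda> * t * (2 * wt \<rho> (Suc m)) + 2 * (32 * \<xi> * wt \<rho> (Suc m))
            + 2 * \<Lambda> * t\<^sup>2 * (\<xi> * (\<rho> * wt \<rho> (Suc m)) * 3))"
        unfolding rhs.simps
        by (rule lip2_diff[OF lip2_diff[OF lip2_add[OF LL[OF ns[OF s5] vp] LL[OF nc[OF \<Lambda>(2)] q]]
              lip2_cmult[OF n2n(1) cP]] lip2_cmult[OF nk2 lip1_mult[OF aS W]]])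
      from lip2_mono[OF this] show ?thesis using mm[of "Suc m"] by (simp add: i Suc algebra_simps)
    qed
  next
    case i: (Iq n)
    show ?thesis
    proof (cases n)
      case 0
      have "lip2 d (rhs th ta ka sg (Iq 0) y u) (rhs th ta ka sg (Iq 0) y' u)
          (\<Lambda> * M + 2 * (M\<^sup>2 * (4 * wt \<rho> 0)) + 2 * \<Lambda> * (\<xi> * (\<rho> * wt \<rho> 0) * 3))"
        unfolding rhs.simps One_nat_def
        by (rule lip2_add[OF lip2_add[OF LL[OF nth(1) p0] lip2_cmult[OF n2 lip1_mult[OF a0 pq]]]
              lip2_cmult[OF nk(2) lip1_mult[OF aS W]]])
      from lip2_mono[OF this] show ?thesis by (simp add: i 0)
    next
      case (Suc m)
      have "lip2 d (rhs th ta ka sg (Iq (Suc m)) y u) (rhs th ta ka sg (Iq (Suc m)) y' u)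
          (\<Lambda> * t * (2 * wt \<rho> (Suc m)) + \<Lambda> * t * (2 * wt \<rho> (Suc m)) + 2 * (32 * \<xi> * wt \<rho> (Suc m))
            + 2 * \<Lambda> * t\<^sup>2 * (\<xi> * (\<rho> * wt \<rho> (Suc m)) * 3))"
        unfolding rhs.simps
        by (rule lip2_add[OF lip2_add[OF lip2_diff[OF LL[OF ns[OF s2] q] LL[OF nc[OF \<Lambda>(1)] vp]]
              lip2_cmult[OF n2n(1) cP]] lip2_cmult[OF nk2 lip1_mult[OF aS W]]])
      from lip2_mono[OF this] show ?thesis using mm[of "Suc m"] by (simp add: i Suc algebra_simps)
    qed
  qed
qed

text \<open>The part n comes from w^n, since x dw/dx = (x + sg - 2) w. The additional 1 comes, for
  \<open>Iga\<close>, from the term - x g- of the system and, for \<open>Ip\<close>, from the factor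
  E in front of the series; for \<open>Iq\<close> that factor cancels against the term x g+, which
  alone acts on \<open>IB\<close>.\<close>

fun rate :: "idx \<Rightarrow> real" where
  "rate IA = 0"
| "rate IB = - 1"
| "rate (Ia n) = real n"
| "rate (Iph n) = real n"
| "rate (Iga n) = real (Suc n)"
| "rate (Ip n) = real (Suc n)"
| "rate (Iq n) = real n"

text \<open>Values at infinity of the three slow unknowns. The value 1 makes \<open>gpl\<close>,
  \<open>gmi\<close> and \<open>gxp\<close> the leading constants of the entries to which these
  unknowns belong.\<close>

definition init :: "idx \<Rightarrow> real" where
  "init i = (if i \<in> {IA, Iph 0, Iq 0} then 1 else 0)"

lemma holomorphic_rhs:
  assumes "\<And>j. Y j holomorphic_on D" "0 \<notin> D"
  shows "(\<lambda>x. rhs th ta ka sg i (\<lambda>j. Y j x) (inverse x)) holomorphic_on D"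
proof -
  have u: "inverse holomorphic_on D" using assms(2) by (auto intro!: holomorphic_intros)
  have va: "(\<lambda>x. va (\<lambda>j. Y j x) (inverse x) n) holomorphic_on D" for n
    unfolding va_def by (cases "n = 0") (use assms u in \<open>auto intro!: holomorphic_intros\<close>)
  have vg: "(\<lambda>x. vg (\<lambda>j. Y j x) (inverse x) n) holomorphic_on D" for n
    unfolding vg_def by (cases "n = 0") (use assms u in \<open>auto intro!: holomorphic_intros\<close>)
  have vp: "(\<lambda>x. vp (\<lambda>j. Y j x) (inverse x) n) holomorphic_on D" for n
    unfolding vp_def by (cases "n = 0") (use assms u in \<open>auto intro!: holomorphic_intros\<close>)
  have W: "(\<lambda>x. vW (\<lambda>j. Y j x) (inverse x)) holomorphic_on D"
    unfolding vW_def by (intro holomorphic_intros assms u)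
  have cG: "(\<lambda>x. cG (\<lambda>j. Y j x) (inverse x) n) holomorphic_on D" for n
    unfolding cG_def by (intro holomorphic_intros assms va vg)
  have cP: "(\<lambda>x. cP (\<lambda>j. Y j x) (inverse x) n) holomorphic_on D" for n
    unfolding cP_def by (intro holomorphic_intros assms va vp)
  have cQ: "(\<lambda>x. cQ (\<lambda>j. Y j x) (inverse x) n) holomorphic_on D" for n
    unfolding cQ_def by (intro holomorphic_intros assms vg vp)
  have nz: "of_nat (Suc n) \<noteq> (0::complex)" for n by (simp del: of_nat_Suc)
  note hs = holomorphic_intros(1,2) holomorphic_on_add holomorphic_on_diff holomorphic_on_minus
    holomorphic_on_mult holomorphic_on_divide holomorphic_on_power holomorphic_on_const nz
    u va vg vp W cG cP cQ assms(1)
  show ?thesis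
  proof (cases i)
    case i: (Ia n) show ?thesis unfolding i by (cases n; (simp only: rhs.simps, intro hs))
  next
    case i: (Iph n) show ?thesis unfolding i by (cases n; (simp only: rhs.simps, intro hs))
  next
    case i: (Iga n) show ?thesis unfolding i by (cases n; (simp only: rhs.simps, intro hs))
  next
    case i: (Ip n) show ?thesis unfolding i by (cases n; (simp only: rhs.simps, intro hs))
  next
    case i: (Iq n) show ?thesis unfolding i by (cases n; (simp only: rhs.simps, intro hs))
  qed (simp only: rhs.simps, intro hs)+
qed

section \<open>Inverting the linear part of each equation\<close>

context sector_dom
begin

text \<open>For \<open>Ia 0\<close> the slow solution g is the exponential-free part of f0 without
  its constant. It is O(1/x), and multiplication by x turns it into a bounded unknown.\<close>

definition Sol :: "idx \<Rightarrow> (complex \<Rightarrow> complex) \<Rightarrow> (complex \<Rightarrow> complex) \<Rightarrow> bool" where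
  "Sol i k h \<longleftrightarrow>
     (if i = Ia 0 then \<exists>g. ode_sol 0 (\<lambda>x. k x / x\<^sup>2) g \<and> h = (\<lambda>x. x * g x)
      else if rate i = 0 then ode_sol 0 (\<lambda>x. k x / x\<^sup>2) h
      else ode_sol (rate i) (\<lambda>x. of_real \<bar>rate i\<bar> * k x) h)"

lemma Sol_exists:
  assumes "k holomorphic_on D" "\<And>x. x \<in> D \<Longrightarrow> norm (k x) \<le> m"
  shows "\<exists>h. Sol i k h"
  using ode_sol_slow_exists[OF assms] ode_sol_exp_exists[OF assms, of "rate i"]
  by (cases "rate i = 0") (auto simp: Sol_def)

lemma Sol_zero: "Sol i (\<lambda>_. 0) (\<lambda>_. 0)"
  using ode_sol_zero[of 0] ode_sol_zero[of "rate i"] by (auto simp: Sol_def intro!: exI[of _ "\<lambda>_. 0"])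

lemma Sol_holomorphic: "Sol i k h \<Longrightarrow> h holomorphic_on D"
  unfolding Sol_def by (auto split: if_splits intro!: holomorphic_intros dest: ode_sol_holomorphic)

text \<open>A slow solution gains the factor 1/|x| \<le> (1 + s)/R, which the choice of R makes
  small. For \<open>Ia 0\<close> the multiplication by x uses this gain up, so the constant is that
  of the nonzero rates.\<close>

lemma Sol_diff_bound:
  assumes h: "Sol i k h" "Sol i k' h'" and m: "\<And>x. x \<in> D \<Longrightarrow> norm (k x - k' x) \<le> m" and x: "x \<in> D"
  shows "norm (h x - h' x) \<le>
    (if i \<noteq> Ia 0 \<and> rate i = 0 then (s + 2) * q\<^sup>2 * ((1 + s) / R) else (s + 2) * q\<^sup>2) * m"
proof -
  have m0: "0 \<le> m" using m[OF x] norm_ge_zero order_trans by blast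
  have m': "\<And>x. x \<in> D \<Longrightarrow> norm (k x - k' x) \<le> m / norm x ^ 0" using m by simp
  have xp: "0 < norm x" using D_nonzero[OF x] by simp
  have slow: "norm (g x - g' x) \<le> (s + 2) * q\<^sup>2 * m / norm x"
    if "ode_sol 0 (\<lambda>x. k x / x\<^sup>2) g" "ode_sol 0 (\<lambda>x. k' x / x\<^sup>2) g'" for g g'
    using ode_sol_slow_bound[of "\<lambda>x. k x - k' x" "\<lambda>x. g x - g' x", OF _ m' x] ode_sol_diff[OF that]
    by (simp add: diff_divide_distrib power2_eq_square)
  consider (a) "i = Ia 0" | (b) "i \<noteq> Ia 0" "rate i = 0" | (c) "i \<noteq> Ia 0" "rate i \<noteq> 0" by blast
  then show ?thesis
  proof cases
    case a
    then obtain g g' where g: "ode_sol 0 (\<lambda>x. k x / x\<^sup>2) g" "h = (\<lambda>x. x * g x)"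
      "ode_sol 0 (\<lambda>x. k' x / x\<^sup>2) g'" "h' = (\<lambda>x. x * g' x)"
      using h by (auto simp: Sol_def)
    have "norm (h x - h' x) = norm x * norm (g x - g' x)"
      by (simp add: g norm_mult[symmetric] algebra_simps)
    also have "\<dots> \<le> norm x * ((s + 2) * q\<^sup>2 * m / norm x)"
      by (intro mult_left_mono slow g) auto
    also have "\<dots> = (s + 2) * q\<^sup>2 * m" using xp by simp
    finally show ?thesis using a by simp
  next
    case b
    have "norm (h x - h' x) \<le> (s + 2) * q\<^sup>2 * m / norm x"
      using h b by (intro slow) (auto simp: Sol_def)
    also have "\<dots> = (s + 2) * q\<^sup>2 * m * norm (inverse x)" by (simp add: norm_inverse divide_inverse)
    also have "\<dots> \<le> (s + 2) * q\<^sup>2 * m * ((1 + s) / R)"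
      using s m0 D_inverse[OF x] by (intro mult_left_mono) auto
    finally show ?thesis using b by (simp add: mult_ac)
  next
    case c
    have "norm (h x - h' x) \<le> (s + 2) * q ^ 0 * m / norm x ^ 0"
      using h c ode_sol_diff[of "rate i" _ h _ h'] ode_sol_exp_bound[of "rate i" "\<lambda>x. k x - k' x" "\<lambda>x. h x - h' x", OF _ _ m' x]
      by (simp add: Sol_def algebra_simps)
    also have "\<dots> \<le> (s + 2) * q\<^sup>2 * m"
      using s m0 one_le_power[OF q_ge1, of 2] mult_right_mono[of 1 "q\<^sup>2" "(s + 2) * m"] by (simp add: mult_ac)
    finally show ?thesis using c by simp
  qed
qed

end

section \<open>Choice of the constants and solution of the system\<close>

lemma eventually_small:
  assumes "(f \<longlongrightarrow> (a::real)) F" "a < b"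
  shows "\<forall>\<^sub>F t in F. f t \<le> b"
  using order_tendstoD(2)[OF assms] by eventually_elim simp

text \<open>First \<xi> absorbs \<open>cG\<close> and \<open>cP\<close> (64 C \<xi> = 1/8), then
  \<rho> absorbs \<open>cQ\<close> (256 C / \<rho> = \<xi>/8), and \<open>M\<close> absorbs the
  linear sources (4 C \<Lambda> M is a sixteenth of the square of M). Every other term contains t,
  through |1/x| or through the gain of the slow equations, so t is chosen last and small.\<close>

lemma constants_exist:
  fixes C \<Lambda> :: real
  assumes C: "1 \<le> C" and \<Lambda>: "1 \<le> \<Lambda>"
  obtains M \<xi> \<rho> t where "0 < M" "0 < \<xi>" "0 < \<rho>" "0 < t" "t \<le> 1" "t * M \<le> 1" "t\<^sup>2 * M\<^sup>2 \<le> \<xi>"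
    "\<And>i. (if i \<noteq> Ia 0 \<and> rate i = 0 then C * t else C) * rbnd \<Lambda> M \<xi> \<rho> t i \<le> bnd M \<xi> \<rho> i / 4"
    "\<And>i. \<bar>init i\<bar> \<le> 3 * bnd M \<xi> \<rho> i / 4"
proof -
  define \<xi> where "\<xi> = 1 / (512 * C)"
  define \<rho> where "\<rho> = 2048 * C / \<xi>"
  define M where "M = 64 * C * \<Lambda>"
  have pos: "0 < \<xi>" "0 < \<rho>" "0 < M" using C \<Lambda> by (auto simp: \<xi>_def \<rho>_def M_def)
  have CL: "C \<le> C * \<Lambda>" "0 < C * \<Lambda>" using C \<Lambda> by auto
  have ev: "\<forall>\<^sub>F t in at_right 0. 0 < t \<and> t \<le> 1 \<and> t * M \<le> 1 \<and> t\<^sup>2 * M\<^sup>2 \<le> \<xi> \<and>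
     C * t * (\<Lambda> * M + 6 * M\<^sup>2) \<le> 1/2 \<and>
     C * (3 * \<Lambda> + 6 * t * M\<^sup>2) \<le> M / 4 \<and>
     C * t * (\<Lambda> * M + 8 * M\<^sup>2) \<le> 1/2 \<and>
     C * t * (\<Lambda> * M + 8 * M\<^sup>2 + 6 * \<Lambda> * \<xi> * \<rho>) \<le> 1/2 \<and>
     C * (4 * \<Lambda> + 8 * t * M\<^sup>2) \<le> M / 4 \<and>
     C * (4 * \<Lambda> + 8 * t * M\<^sup>2 + 6 * \<Lambda> * t * \<xi> * \<rho>) \<le> M / 4 \<and>
     C * (\<Lambda> * t * \<xi> + 6 * \<Lambda> * t\<^sup>2 + 256 / \<rho>) \<le> \<xi> / 4 \<and>
     C * (6 * \<Lambda> * t + 64 * \<xi> + 6 * \<Lambda> * t\<^sup>2 * \<xi> * \<rho>) \<le> 1/2"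
  proof (intro eventually_conj)
    show "\<forall>\<^sub>F t::real in at_right 0. 0 < t" by (rule eventually_at_right_less)
    have a: "C * (3 * \<Lambda> + 6 * 0 * M\<^sup>2) < M / 4" "C * (4 * \<Lambda> + 8 * 0 * M\<^sup>2) < M / 4"
      "C * (4 * \<Lambda> + 8 * 0 * M\<^sup>2 + 6 * \<Lambda> * 0 * \<xi> * \<rho>) < M / 4"
      using CL(2) by (auto simp: M_def)
    have b: "C * (\<Lambda> * 0 * \<xi> + 6 * \<Lambda> * 0\<^sup>2 + 256 / \<rho>) < \<xi> / 4"
      using C pos by (simp add: \<rho>_def)
    have c: "C * (6 * \<Lambda> * 0 + 64 * \<xi> + 6 * \<Lambda> * 0\<^sup>2 * \<xi> * \<rho>) < 1/2"
      using C by (simp add: \<xi>_def)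
    show "\<forall>\<^sub>F t in at_right 0. t \<le> (1::real)" by (rule eventually_small[of _ 0]) (auto intro!: tendsto_eq_intros)
    show "\<forall>\<^sub>F t in at_right 0. t * M \<le> 1"
      by (rule eventually_small[of _ "0 * M"]) (intro tendsto_intros, simp)
    show "\<forall>\<^sub>F t in at_right 0. t\<^sup>2 * M\<^sup>2 \<le> \<xi>"
      by (rule eventually_small[of _ "0\<^sup>2 * M\<^sup>2"]) (intro tendsto_intros, use pos in simp)
    show "\<forall>\<^sub>F t in at_right 0. C * t * (\<Lambda> * M + 6 * M\<^sup>2) \<le> 1/2"
      by (rule eventually_small[of _ "C * 0 * (\<Lambda> * M + 6 * M\<^sup>2)"]) (intro tendsto_intros, simp)
    show "\<forall>\<^sub>F t in at_right 0. C * t * (\<Lambda> * M + 8 * M\<^sup>2) \<le> 1/2"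
      by (rule eventually_small[of _ "C * 0 * (\<Lambda> * M + 8 * M\<^sup>2)"]) (intro tendsto_intros, simp)
    show "\<forall>\<^sub>F t in at_right 0. C * t * (\<Lambda> * M + 8 * M\<^sup>2 + 6 * \<Lambda> * \<xi> * \<rho>) \<le> 1/2"
      by (rule eventually_small[of _ "C * 0 * (\<Lambda> * M + 8 * M\<^sup>2 + 6 * \<Lambda> * \<xi> * \<rho>)"]) (intro tendsto_intros, simp)
    show "\<forall>\<^sub>F t in at_right 0. C * (3 * \<Lambda> + 6 * t * M\<^sup>2) \<le> M / 4"
      by (rule eventually_small[OF _ a(1)]) (intro tendsto_intros)
    show "\<forall>\<^sub>F t in at_right 0. C * (4 * \<Lambda> + 8 * t * M\<^sup>2) \<le> M / 4"
      by (rule eventually_small[OF _ a(2)]) (intro tendsto_intros)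
    show "\<forall>\<^sub>F t in at_right 0. C * (4 * \<Lambda> + 8 * t * M\<^sup>2 + 6 * \<Lambda> * t * \<xi> * \<rho>) \<le> M / 4"
      by (rule eventually_small[OF _ a(3)]) (intro tendsto_intros)
    show "\<forall>\<^sub>F t in at_right 0. C * (\<Lambda> * t * \<xi> + 6 * \<Lambda> * t\<^sup>2 + 256 / \<rho>) \<le> \<xi> / 4"
      by (rule eventually_small[OF _ b]) (intro tendsto_intros)
    show "\<forall>\<^sub>F t in at_right 0. C * (6 * \<Lambda> * t + 64 * \<xi> + 6 * \<Lambda> * t\<^sup>2 * \<xi> * \<rho>) \<le> 1/2"
      by (rule eventually_small[OF _ c]) (intro tendsto_intros)
  qed
  then obtain t where t: "0 < t" "t \<le> 1" "t * M \<le> 1" "t\<^sup>2 * M\<^sup>2 \<le> \<xi>"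
     "C * t * (\<Lambda> * M + 6 * M\<^sup>2) \<le> 1/2"
     "C * (3 * \<Lambda> + 6 * t * M\<^sup>2) \<le> M / 4"
     "C * t * (\<Lambda> * M + 8 * M\<^sup>2) \<le> 1/2"
     "C * t * (\<Lambda> * M + 8 * M\<^sup>2 + 6 * \<Lambda> * \<xi> * \<rho>) \<le> 1/2"
     "C * (4 * \<Lambda> + 8 * t * M\<^sup>2) \<le> M / 4"
     "C * (4 * \<Lambda> + 8 * t * M\<^sup>2 + 6 * \<Lambda> * t * \<xi> * \<rho>) \<le> M / 4"
     "C * (\<Lambda> * t * \<xi> + 6 * \<Lambda> * t\<^sup>2 + 256 / \<rho>) \<le> \<xi> / 4"
     "C * (6 * \<Lambda> * t + 64 * \<xi> + 6 * \<Lambda> * t\<^sup>2 * \<xi> * \<rho>) \<le> 1/2"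
    using eventually_happens'[OF trivial_limit_at_right_real ev] by blast
  note wp = wt_pos[OF pos(2)]
  have a0: "C * (4 * \<Lambda> * M) \<le> M\<^sup>2 / 4"
  proof -
    have "M\<^sup>2 = 64 * (C * \<Lambda> * M)" by (simp add: power2_eq_square M_def)
    moreover have "0 < C * \<Lambda> * M" using CL(2) pos(3) by (rule mult_pos_pos)
    moreover have "C * (4 * \<Lambda> * M) = 4 * (C * \<Lambda> * M)" by simp
    ultimately show ?thesis by linarith
  qed
  have big: "C * (X * wt \<rho> n) \<le> b / 2 * wt \<rho> n" if "C * X \<le> b / 2" for X n b
    using mult_right_mono[OF that less_imp_le[OF wp[of n]]] by (simp add: mult_ac)
  have A: "C * ((\<Lambda> * t * \<xi> + 6 * \<Lambda> * t\<^sup>2 + 256 / \<rho>) * wt \<rho> n) \<le> \<xi> * wt \<rho> n / 4" for n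
    using big[of "\<Lambda> * t * \<xi> + 6 * \<Lambda> * t\<^sup>2 + 256 / \<rho>" "\<xi> / 2" n] t(11) by simp
  have B: "C * ((6 * \<Lambda> * t + 64 * \<xi> + 6 * \<Lambda> * t\<^sup>2 * \<xi> * \<rho>) * wt \<rho> n) \<le> 2 * wt \<rho> n / 4" for n
    using big[of "6 * \<Lambda> * t + 64 * \<xi> + 6 * \<Lambda> * t\<^sup>2 * \<xi> * \<rho>" 1 n] t(12) by simp
  show ?thesis
  proof (rule that[OF pos(3,1,2) t(1-4)])
    fix i
    show "(if i \<noteq> Ia 0 \<and> rate i = 0 then C * t else C) * rbnd \<Lambda> M \<xi> \<rho> t i \<le> bnd M \<xi> \<rho> i / 4"
    proof (cases i)
      case IA then show ?thesis using t(5) by simp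
    next
      case IB then show ?thesis using t(6) by simp
    next
      case i: (Ia n) then show ?thesis using a0 A[of n] by (cases n) auto
    next
      case i: (Iph n) then show ?thesis using t(7) B[of n] by (cases n) auto
    next
      case i: (Iga n) then show ?thesis using t(9) B[of n] by (cases n) auto
    next
      case i: (Ip n) then show ?thesis using t(10) B[of n] by (cases n) auto
    next
      case i: (Iq n) then show ?thesis using t(8) B[of n] by (cases n) auto
    qed
    show "\<bar>init i\<bar> \<le> 3 * bnd M \<xi> \<rho> i / 4"
      using pos wp by (cases i) (auto simp: init_def less_imp_le)
  qed
qed

theorem system_solution:
  fixes th ta ka sg :: complex and s :: real
  assumes s: "1 \<le> s"
  obtains R M \<xi> \<rho> Y where "sector_dom s R" "(1 + s) / R \<le> 1" "0 < \<rho>" "0 < M" "0 < \<xi>" "M \<le> R / (1 + s)"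
    "\<And>i. Y i holomorphic_on sector_dom.D s R"
    "\<And>i x. x \<in> sector_dom.D s R \<Longrightarrow> norm (Y i x) \<le> bnd M \<xi> \<rho> i"
    "\<And>i. \<exists>h. sector_dom.Sol s R i (\<lambda>x. rhs th ta ka sg i (\<lambda>j. Y j x) (inverse x)) h \<and>
       (\<forall>x\<in>sector_dom.D s R. Y i x = of_real (init i) + h x)"
proof -
  \<comment> \<open>This is \<open>q\<close>, which depends on \<open>s\<close> alone; it is needed
    here before R is chosen.\<close>
  define q0 :: real where "q0 = 1 + (1 + s) * (3 + s)"
  define C where "C = (s + 2) * q0\<^sup>2"
  have "1 \<le> q0" using s by (simp add: q0_def)
  then have C: "1 \<le> C"
    unfolding C_def using s mult_mono[of 1 "s + 2" 1 "q0\<^sup>2"] by (simp add: one_le_power)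
  define \<Lambda> where "\<Lambda> = 4 + 2 * norm th + 2 * norm ta + norm ka + 2 * norm sg"
  have \<Lambda>: "1 \<le> \<Lambda>" by (simp add: \<Lambda>_def)
  have tri: "norm (1 - th - ta) \<le> 1 + norm th + norm ta" "norm (1 + th + ta) \<le> 1 + norm th + norm ta"
    "norm (1 - sg) \<le> 1 + norm sg" "norm (sg - 2) \<le> norm sg + 2" "norm (th + ta) \<le> norm th + norm ta"
    using norm_triangle_ineq4[of "1 - th" ta] norm_triangle_ineq4[of 1 th] norm_triangle_ineq[of "1 + th" ta]
      norm_triangle_ineq[of 1 th] norm_triangle_ineq4[of 1 sg] norm_triangle_ineq4[of sg 2] norm_triangle_ineq[of th ta]
    by auto
  have L: "norm th \<le> \<Lambda>" "norm ta \<le> \<Lambda>" "norm ka \<le> \<Lambda>" "norm (1 - th - ta) \<le> \<Lambda>"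
      "norm (1 + th + ta) \<le> \<Lambda>" "norm (1 - sg) \<le> \<Lambda>" "1 + norm (sg - 2) \<le> \<Lambda>" "norm sg + norm (sg - 2) \<le> \<Lambda>"
      "norm (th + ta) \<le> \<Lambda>"
    unfolding \<Lambda>_def
    using tri norm_ge_zero[of th] norm_ge_zero[of ta] norm_ge_zero[of ka] norm_ge_zero[of sg] by linarith+
  obtain M \<xi> \<rho> t where c: "0 < M" "0 < \<xi>" "0 < \<rho>" "0 < t" "t \<le> 1" "t * M \<le> 1" "t\<^sup>2 * M\<^sup>2 \<le> \<xi>"
    and small: "\<And>i. (if i \<noteq> Ia 0 \<and> rate i = 0 then C * t else C) * rbnd \<Lambda> M \<xi> \<rho> t i \<le> bnd M \<xi> \<rho> i / 4"
    and start: "\<And>i. \<bar>init i\<bar> \<le> 3 * bnd M \<xi> \<rho> i / 4"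
    using constants_exist[OF C \<Lambda>] by metis
  \<comment> \<open>On D the norm of 1/x is at most (1 + s)/R, so this R makes it at most t.\<close>
  define R where "R = (1 + s) / t"
  have RR: "0 < R" "(1 + s) / R = t" using s c by (auto simp: R_def)
  interpret sector_dom s R using s RR by unfold_locales
  have Cq: "(s + 2) * q\<^sup>2 = C" by (simp add: C_def q_def q0_def)
  have lip: "lip2 d (rhs th ta ka sg i (\<lambda>j. Y j x) (inverse x)) (rhs th ta ka sg i (\<lambda>j. Y' j x) (inverse x))
      (rbnd \<Lambda> M \<xi> \<rho> t i)"
    if "x \<in> D" "\<And>j. lip1 d (Y j x) (Y' j x) (bnd M \<xi> \<rho> j)" for d i x Y Y'
    using D_inverse[OF that(1)] RR(2) c that(2) by (intro rhs_lip L) auto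
  have "\<exists>Y. (\<forall>i. Y i holomorphic_on D) \<and> (\<forall>i. \<forall>x\<in>D. norm (Y i x) \<le> bnd M \<xi> \<rho> i) \<and>
     (\<forall>i. \<exists>h. Sol i (\<lambda>x. rhs th ta ka sg i (\<lambda>j. Y j x) (inverse x)) h \<and> (\<forall>x\<in>D. Y i x = of_real (init i) + h x))"
  proof (rule picard_system[where K = "\<lambda>i Y x. rhs th ta ka sg i (\<lambda>j. Y j x) (inverse x)"
        and D = D and Sol = Sol and B = "bnd M \<xi> \<rho>" and ini = init
        and M = "rbnd \<Lambda> M \<xi> \<rho> t" and C = "\<lambda>i. if i \<noteq> Ia 0 \<and> rate i = 0 then C * t else C"])
    show "open D" by (rule open_D)
    show "\<exists>h. Sol i k h" if "k holomorphic_on D" "\<forall>x\<in>D. norm (k x) \<le> m" for i k m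
      using that by (intro Sol_exists) auto
    show "norm (h x - h' x) \<le> (if i \<noteq> Ia 0 \<and> rate i = 0 then C * t else C) * m"
      if "Sol i k h" "Sol i k' h'" "\<forall>x\<in>D. norm (k x - k' x) \<le> m" "x \<in> D" for i k k' h h' m x
      using Sol_diff_bound[OF that(1,2) bspec[OF that(3)] that(4)] unfolding Cq RR(2) by simp
    show "(\<lambda>x. rhs th ta ka sg i (\<lambda>j. Y j x) (inverse x)) holomorphic_on D"
      if "\<forall>j. Y j holomorphic_on D" for i Y
      using that D_nonzero by (intro holomorphic_rhs) auto
    show "norm (rhs th ta ka sg i (\<lambda>j. Y j x) (inverse x)) \<le> rbnd \<Lambda> M \<xi> \<rho> t i"
      if "x \<in> D" "\<forall>j. norm (Y j x) \<le> bnd M \<xi> \<rho> j" for i Y x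
      \<comment> \<open>The plain bound is the case d = 0 of the Lipschitz estimate, with both
        arguments equal.\<close>
      using lip[OF that(1), of 0 Y Y i] that(2) by (simp add: lip1_def lip2_def)
    show "norm (rhs th ta ka sg i (\<lambda>j. Y j x) (inverse x) - rhs th ta ka sg i (\<lambda>j. Y' j x) (inverse x))
        \<le> 2 * d * rbnd \<Lambda> M \<xi> \<rho> t i"
      if "x \<in> D" "0 \<le> d" "\<forall>j. norm (Y j x) \<le> bnd M \<xi> \<rho> j" "\<forall>j. norm (Y' j x) \<le> bnd M \<xi> \<rho> j"
        "\<forall>j. norm (Y j x - Y' j x) \<le> d * bnd M \<xi> \<rho> j" for i Y Y' x d
      using lip[OF that(1), of d Y Y' i] that by (simp add: lip1_def lip2_def)
    show "Sol i (\<lambda>_. 0) (\<lambda>_. 0)" for i by (rule Sol_zero)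
    show "h holomorphic_on D" if "Sol i k h" for i k h using that by (rule Sol_holomorphic)
    show "0 \<le> (if i \<noteq> Ia 0 \<and> rate i = 0 then C * t else C)" for i using C c by simp
  qed (rule small start)+
  then obtain Y where Y: "\<And>i. Y i holomorphic_on D" "\<And>i x. x \<in> D \<Longrightarrow> norm (Y i x) \<le> bnd M \<xi> \<rho> i"
     "\<And>i. \<exists>h. Sol i (\<lambda>x. rhs th ta ka sg i (\<lambda>j. Y j x) (inverse x)) h \<and> (\<forall>x\<in>D. Y i x = of_real (init i) + h x)"
    by blast
  have "R / (1 + s) = 1 / t" using s by (simp add: R_def)
  then have "M \<le> R / (1 + s)" using c by (simp add: pos_le_divide_eq mult.commute)
  then show ?thesis using that[OF sector_dom_axioms _ c(3,1,2) _ Y] RR(2) c by simp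
qed

section \<open>Asymptotic expansions in inverse powers\<close>

text \<open>Only a subring containing the rationals is asked for: all recursions for the
  coefficients divide by nonzero rational numbers only.\<close>

locale coeff_field =
  fixes Kf :: "complex set"
  assumes Kf_rat: "c \<in> \<rat> \<Longrightarrow> c \<in> Kf"
    and Kf_add: "a \<in> Kf \<Longrightarrow> b \<in> Kf \<Longrightarrow> a + b \<in> Kf"
    and Kf_mult: "a \<in> Kf \<Longrightarrow> b \<in> Kf \<Longrightarrow> a * b \<in> Kf"
begin

lemma Kf_uminus: "a \<in> Kf \<Longrightarrow> - a \<in> Kf"
  using Kf_mult[OF Kf_rat, of "-1" a] by simp

lemma Kf_diff: "a \<in> Kf \<Longrightarrow> b \<in> Kf \<Longrightarrow> a - b \<in> Kf"
  using Kf_add[of a "- b"] Kf_uminus by simp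

lemma Kf_divide_nat: "a \<in> Kf \<Longrightarrow> a / of_nat n \<in> Kf"
  using Kf_mult[of a "1 / of_nat n"] Kf_rat[of "1 / of_nat n"] by simp

lemma Kf_consts: "0 \<in> Kf" "1 \<in> Kf" "numeral w \<in> Kf" "of_nat n \<in> Kf"
  by (auto intro: Kf_rat)

lemma Kf_sum: "(\<And>j. j \<in> A \<Longrightarrow> f j \<in> Kf) \<Longrightarrow> (\<Sum>j\<in>A. f j) \<in> Kf"
  by (induction A rule: infinite_finite_induct) (auto intro: Kf_consts Kf_add)

lemmas Kf_intros = Kf_consts Kf_add Kf_diff Kf_mult Kf_uminus Kf_divide_nat

definition Kpoly :: "complex poly \<Rightarrow> bool" where
  "Kpoly p \<longleftrightarrow> (\<forall>j. coeff p j \<in> Kf)"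

lemma Kpoly_add: "Kpoly p \<Longrightarrow> Kpoly r \<Longrightarrow> Kpoly (p + r)"
  by (simp add: Kpoly_def Kf_add)

lemma Kpoly_mult: "Kpoly p \<Longrightarrow> Kpoly r \<Longrightarrow> Kpoly (p * r)"
  by (auto simp: Kpoly_def coeff_mult intro!: Kf_sum Kf_mult)

lemma Kpoly_pCons: "c \<in> Kf \<Longrightarrow> Kpoly p \<Longrightarrow> Kpoly (pCons c p)"
  by (simp add: Kpoly_def coeff_pCons split: nat.split)

lemma Kpoly_0: "Kpoly 0"
  by (simp add: Kpoly_def Kf_consts)

end

lemma poly_with_coeffs: "\<exists>p. \<forall>j. coeff p j = (if j < N then c j else (0::complex))"
  by (intro exI[of _ "\<Sum>i<N. monom (c i) i"]) (auto simp: coeff_sum if_distrib cong: if_cong)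

lemma poly_small_if_low_coeffs_zero:
  assumes "\<And>j. j < N \<Longrightarrow> coeff p j = 0"
  shows "\<exists>C. \<forall>u. norm u \<le> 1 \<longrightarrow> norm (poly p u :: complex) \<le> C * norm u ^ N"
  using assms
proof (induction N arbitrary: p)
  case 0
  have "bounded (poly p ` cball 0 1)"
    by (intro compact_imp_bounded compact_continuous_image continuous_intros) auto
  then obtain C where "\<And>u. u \<in> cball 0 1 \<Longrightarrow> norm (poly p u) \<le> C"
    unfolding bounded_iff by blast
  then show ?case by (intro exI[of _ C]) auto
next
  case (Suc N)
  obtain a r where p: "p = pCons a r" by (cases p)
  have "a = 0" using Suc.prems[of 0] by (simp add: p)
  have "coeff r j = 0" if "j < N" for j using Suc.prems[of "Suc j"] that by (simp add: p)
  from Suc.IH[OF this] obtain C where C: "\<And>u. norm u \<le> 1 \<Longrightarrow> norm (poly r u) \<le> C * norm u ^ N" by blast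
  have "norm (poly p u) \<le> C * norm u ^ Suc N" if "norm u \<le> 1" for u
    using mult_left_mono[OF C[OF that] norm_ge_zero[of u]] by (simp add: p \<open>a = 0\<close> norm_mult mult_ac)
  then show ?case by blast
qed

text \<open>This gives uniqueness of asymptotic coefficients. Smallness along a null sequence forces
  the constant term to vanish; then one factor of the variable is divided out.\<close>

lemma low_coeffs_zero_if_poly_small:
  fixes U :: "nat \<Rightarrow> complex"
  assumes "\<And>n. norm (poly p (U n)) \<le> C * norm (U n) ^ N" "U \<longlonglongrightarrow> 0" "\<And>n. U n \<noteq> 0" "j < N"
  shows "coeff p j = 0"
  using assms(1,4)
proof (induction N arbitrary: p j)
  case (Suc N)
  obtain a r where p: "p = pCons a r" by (cases p)
  have "(\<lambda>n. poly p (U n)) \<longlonglongrightarrow> poly p 0" using assms(2) by (intro tendsto_intros)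
  moreover have "(\<lambda>n. C * norm (U n) ^ Suc N) \<longlonglongrightarrow> C * norm (0::complex) ^ Suc N"
    using assms(2) by (intro tendsto_intros)
  then have "(\<lambda>n. poly p (U n)) \<longlonglongrightarrow> 0"
    using Suc.prems(1) by (intro Lim_null_comparison[of "\<lambda>n. poly p (U n)"]) auto
  ultimately have a: "a = 0" using LIMSEQ_unique by (fastforce simp: p)
  have "norm (poly r (U n)) \<le> C * norm (U n) ^ N" for n
    using Suc.prems(1)[of n] assms(3)[of n] by (simp add: p a norm_mult mult_ac)
  from Suc.IH[OF this] show ?case using Suc.prems(2) by (cases j) (auto simp: p a)
qed simp

locale sector_asy = sector_dom + coeff_field +
  assumes R_large: "(1 + s) / R \<le> 1"
begin

lemma D_norm_ge1: "x \<in> D \<Longrightarrow> 1 \<le> norm x"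
proof -
  assume "x \<in> D"
  moreover have "1 \<le> R / (1 + s)" using R_large R s by (simp add: field_simps)
  ultimately show ?thesis using D_norm[of x] by linarith
qed

lemma D_inverse_le1: "x \<in> D \<Longrightarrow> norm (inverse x) \<le> 1"
  using D_norm_ge1[of x] by (simp add: norm_inverse inverse_le_1_iff)

text \<open>The polynomial may depend on \<open>N\<close> and its degree is not restricted. So
  products need no truncation, and the orders can be raised one by one;
  \<open>asy_all_orders\<close> merges the polynomials afterwards.\<close>

definition asy :: "nat \<Rightarrow> (complex \<Rightarrow> complex) \<Rightarrow> bool" where
  "asy N h \<longleftrightarrow> (\<exists>p C. Kpoly p \<and> (\<forall>x\<in>D. norm (h x - poly p (inverse x)) \<le> C / norm x ^ N))"

lemma asyE:
  assumes "asy N h"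
  obtains p C where "Kpoly p" "\<And>x. x \<in> D \<Longrightarrow> norm (h x - poly p (inverse x)) \<le> C / norm x ^ N"
  using assms unfolding asy_def by blast

lemma poly_bounded_D: "\<exists>C. 0 \<le> C \<and> (\<forall>x\<in>D. norm (poly p (inverse x)) \<le> C)"
proof -
  obtain C where C: "\<And>u. norm u \<le> 1 \<Longrightarrow> norm (poly p u) \<le> C * norm u ^ 0"
    using poly_small_if_low_coeffs_zero[of 0 p] by blast
  have "norm (poly p 0) \<le> C" using C[of 0] by simp
  then have "0 \<le> C" using norm_ge_zero order_trans by blast
  then show ?thesis using C D_inverse_le1 by (auto intro!: exI[of _ C])
qed

lemma asy_poly: "Kpoly p \<Longrightarrow> asy N (\<lambda>x. poly p (inverse x))"
  unfolding asy_def by (rule exI[of _ p], rule exI[of _ 0]) auto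

lemma asy_const: "c \<in> Kf \<Longrightarrow> asy N (\<lambda>_. c)"
  using asy_poly[of "[:c:]" N] by (simp add: Kpoly_pCons Kpoly_0)

lemma asy_inverse: "asy N inverse"
  using asy_poly[of "[:0, 1:]" N] by (simp add: Kpoly_pCons Kpoly_0 Kf_consts)

lemma asy_cong: "asy N h \<Longrightarrow> (\<And>x. x \<in> D \<Longrightarrow> h' x = h x) \<Longrightarrow> asy N h'"
  unfolding asy_def by auto

lemma asy_0: "(\<And>x. x \<in> D \<Longrightarrow> norm (h x) \<le> C) \<Longrightarrow> asy 0 h"
  unfolding asy_def by (rule exI[of _ 0], rule exI[of _ C]) (auto simp: Kpoly_0)

lemma const_nonneg_D: "x \<in> D \<Longrightarrow> norm (y::complex) \<le> C / norm x ^ N \<Longrightarrow> 0 \<le> C"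
proof -
  assume "x \<in> D" "norm (y::complex) \<le> C / norm x ^ N"
  then have "0 \<le> C / norm x ^ N" "0 < norm x ^ N" using norm_ge_zero order_trans D_nonzero by (blast, simp)
  then show ?thesis using zero_le_divide_iff by (metis linorder_not_less)
qed

lemma asy_Suc_D: "asy (Suc N) h \<Longrightarrow> asy N h"
proof -
  assume "asy (Suc N) h"
  then obtain p C where p: "Kpoly p" "\<And>x. x \<in> D \<Longrightarrow> norm (h x - poly p (inverse x)) \<le> C / norm x ^ Suc N"
    by (auto simp: asy_def)
  have "norm (h x - poly p (inverse x)) \<le> C / norm x ^ N" if x: "x \<in> D" for x
  proof -
    have "0 \<le> C" using p(2)[OF x] const_nonneg_D[OF x] by blast
    moreover have "norm x ^ N \<le> norm x ^ Suc N" "0 < norm x ^ N" "0 < norm x ^ Suc N"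
      using D_norm_ge1[OF x] D_nonzero[OF x] by (auto intro!: power_increasing simp del: power_Suc)
    ultimately have "C / norm x ^ Suc N \<le> C / norm x ^ N"
      by (intro divide_left_mono mult_pos_pos) auto
    then show ?thesis using p(2)[OF x] by simp
  qed
  with p(1) show ?thesis by (auto simp: asy_def)
qed

lemma asy_bounded: "asy N h \<Longrightarrow> \<exists>C. 0 \<le> C \<and> (\<forall>x\<in>D. norm (h x) \<le> C)"
proof -
  assume "asy N h"
  then have "asy 0 h" by (induction N) (auto dest: asy_Suc_D)
  then obtain p C where p: "\<And>x. x \<in> D \<Longrightarrow> norm (h x - poly p (inverse x)) \<le> C"
    by (auto simp: asy_def)
  obtain C' where C': "\<forall>x\<in>D. norm (poly p (inverse x)) \<le> C'" using poly_bounded_D by blast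
  have "norm (h x) \<le> \<bar>C\<bar> + \<bar>C'\<bar>" if "x \<in> D" for x
    using p[OF that] C' that norm_triangle_sub[of "h x" "poly p (inverse x)"] by fastforce
  then show ?thesis by (intro exI[of _ "\<bar>C\<bar> + \<bar>C'\<bar>"]) auto
qed

lemma asy_add: "asy N h \<Longrightarrow> asy N g \<Longrightarrow> asy N (\<lambda>x. h x + g x)"
proof -
  assume h: "asy N h" and g: "asy N g"
  obtain p C where p: "Kpoly p" "\<And>x. x \<in> D \<Longrightarrow> norm (h x - poly p (inverse x)) \<le> C / norm x ^ N"
    by (rule asyE[OF h]) blast
  obtain r C' where r: "Kpoly r" "\<And>x. x \<in> D \<Longrightarrow> norm (g x - poly r (inverse x)) \<le> C' / norm x ^ N"
    by (rule asyE[OF g]) blast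
  have "norm (h x + g x - poly (p + r) (inverse x)) \<le> (C + C') / norm x ^ N" if "x \<in> D" for x
  proof -
    have "h x + g x - poly (p + r) (inverse x) = (h x - poly p (inverse x)) + (g x - poly r (inverse x))"
      by simp
    then show ?thesis using norm_triangle_mono[OF p(2)[OF that] r(2)[OF that]]
      by (simp only: add_divide_distrib)
  qed
  then show ?thesis using Kpoly_add[OF p(1) r(1)] unfolding asy_def by blast
qed

lemma asy_mult: "asy N h \<Longrightarrow> asy N g \<Longrightarrow> asy N (\<lambda>x. h x * g x)"
proof -
  assume h: "asy N h" and g: "asy N g"
  obtain p C where p: "Kpoly p" "\<And>x. x \<in> D \<Longrightarrow> norm (h x - poly p (inverse x)) \<le> C / norm x ^ N"
    by (rule asyE[OF h]) blast
  obtain r C' where r: "Kpoly r" "\<And>x. x \<in> D \<Longrightarrow> norm (g x - poly r (inverse x)) \<le> C' / norm x ^ N"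
    by (rule asyE[OF g]) blast
  obtain A where A: "0 \<le> A" "\<And>x. x \<in> D \<Longrightarrow> norm (h x) \<le> A" using asy_bounded[OF h] by blast
  obtain B where B: "0 \<le> B" "\<And>x. x \<in> D \<Longrightarrow> norm (poly r (inverse x)) \<le> B" using poly_bounded_D by blast
  have "norm (h x * g x - poly (p * r) (inverse x)) \<le> (A * C' + C * B) / norm x ^ N" if x: "x \<in> D" for x
  proof -
    have "h x * g x - poly (p * r) (inverse x) =
        h x * (g x - poly r (inverse x)) + (h x - poly p (inverse x)) * poly r (inverse x)"
      by (simp add: algebra_simps)
    also have "norm \<dots> \<le> norm (h x) * norm (g x - poly r (inverse x)) + norm (h x - poly p (inverse x)) * norm (poly r (inverse x))"
      using norm_triangle_ineq unfolding norm_mult[symmetric] by blast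
    also have "\<dots> \<le> A * (C' / norm x ^ N) + (C / norm x ^ N) * B"
      using A B p(2)[OF x] r(2)[OF x] x order_trans[OF norm_ge_zero p(2)[OF x]]
      by (intro add_mono mult_mono) auto
    finally show ?thesis by (simp add: add_divide_distrib)
  qed
  then show ?thesis using Kpoly_mult[OF p(1) r(1)] unfolding asy_def by blast
qed

lemma asy_uminus: "asy N h \<Longrightarrow> asy N (\<lambda>x. - h x)"
proof -
  assume "asy N h"
  moreover have "- 1 \<in> Kf" by (rule Kf_rat) simp
  ultimately have "asy N (\<lambda>x. - 1 * h x)" by (intro asy_mult asy_const)
  then show ?thesis by simp
qed

lemma asy_diff: "asy N h \<Longrightarrow> asy N g \<Longrightarrow> asy N (\<lambda>x. h x - g x)"
proof -
  assume "asy N h" "asy N g"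
  then have "asy N (\<lambda>x. h x + - g x)" by (intro asy_add asy_uminus)
  then show ?thesis by simp
qed

lemma asy_sum: "(\<And>j. j \<in> A \<Longrightarrow> asy N (f j)) \<Longrightarrow> asy N (\<lambda>x. \<Sum>j\<in>A. f j x)"
  by (induction A rule: infinite_finite_induct) (auto intro: asy_const asy_add Kf_consts)

lemma asy_inverse_mult: "asy N h \<Longrightarrow> asy (Suc N) (\<lambda>x. inverse x * h x)"
proof -
  assume h: "asy N h"
  obtain p C where p: "Kpoly p" "\<And>x. x \<in> D \<Longrightarrow> norm (h x - poly p (inverse x)) \<le> C / norm x ^ N"
    by (rule asyE[OF h]) blast
  have "norm (inverse x * h x - poly (pCons 0 p) (inverse x)) \<le> C / norm x ^ Suc N" if x: "x \<in> D" for x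
  proof -
    have "inverse x * h x - poly (pCons 0 p) (inverse x) = inverse x * (h x - poly p (inverse x))"
      by (simp add: right_diff_distrib)
    then have "norm (inverse x * h x - poly (pCons 0 p) (inverse x)) = norm (h x - poly p (inverse x)) / norm x"
      by (simp only: norm_mult norm_inverse divide_inverse mult.commute)
    also have "\<dots> \<le> (C / norm x ^ N) / norm x"
      by (intro divide_right_mono p x) auto
    finally show ?thesis by (simp add: mult.commute)
  qed
  then show ?thesis using Kpoly_pCons[OF Kf_consts(1) p(1)] unfolding asy_def by blast
qed

lemma asy_inverse_scaled: "c \<in> Kf \<Longrightarrow> asy N h \<Longrightarrow> asy (Suc N) (\<lambda>x. c * inverse x * h x)"
  using asy_mult[OF asy_const[of c "Suc N"] asy_inverse_mult[of N h]] by (simp only: mult.assoc)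

lemma asy_inverse_scaled2: "c \<in> Kf \<Longrightarrow> asy N h \<Longrightarrow> asy (Suc N) (\<lambda>x. c * inverse x ^ 2 * h x)"
  using asy_inverse_scaled[of c N "\<lambda>x. inverse x * h x"] asy_mult[OF asy_inverse, of N h]
  by (simp only: power2_eq_square mult.assoc)

lemma asy_inverse_divide: "c \<in> Kf \<Longrightarrow> asy N h \<Longrightarrow> asy (Suc N) (\<lambda>x. c * inverse x / of_nat n * h x)"
  using asy_inverse_scaled[of "c / of_nat n" N h] Kf_divide_nat[of c n] by (simp only: times_divide_eq_left)

lemma asy_inverse_divide2: "c \<in> Kf \<Longrightarrow> asy N h \<Longrightarrow> asy (Suc N) (\<lambda>x. c * (inverse x)\<^sup>2 / of_nat n * h x)"
  using asy_inverse_scaled2[of "c / of_nat n" N h] Kf_divide_nat[of c n] by (simp only: times_divide_eq_left)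

lemma DERIV_poly_inverse:
  "x \<noteq> 0 \<Longrightarrow> ((\<lambda>x. poly p (inverse x)) has_field_derivative - (inverse x)\<^sup>2 * poly (pderiv p) (inverse x)) (at (x::complex))"
  by (rule derivative_eq_intros DERIV_chain2[OF poly_DERIV] refl | simp add: power2_eq_square)+

text \<open>The expansion is integrated termwise: the numbers - p_j/(j + 1) belong to the
  antiderivative of p(1/x)/x^2 that vanishes at infinity. Its difference from h solves the equation
  with the remainder as source, and \<open>ode_sol_slow_bound\<close> gains one power. The second
  claim gives that power back and serves \<open>Ia 0\<close>.\<close>

lemma asy_slow:
  assumes sol: "ode_sol 0 (\<lambda>x. k x / x\<^sup>2) h" and k: "asy N k"
  shows "asy (Suc N) h" "asy N (\<lambda>x. x * h x)"
proof -
  obtain p C where p: "Kpoly p" "\<And>x. x \<in> D \<Longrightarrow> norm (k x - poly p (inverse x)) \<le> C / norm x ^ N"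
    by (rule asyE[OF k]) blast
  obtain t where t: "\<And>j. coeff t j = (if j < Suc (degree p) then - (coeff p j / of_nat (Suc j)) else 0)"
    using poly_with_coeffs[of "Suc (degree p)" "\<lambda>j. - (coeff p j / of_nat (Suc j))"] by blast
  have t: "coeff t j = - (coeff p j / of_nat (Suc j))" for j
    using t[of j] coeff_eq_0[of p j] by (auto simp: not_less)
  have Kt: "Kpoly t" using p(1) unfolding Kpoly_def t by (auto intro: Kf_intros simp del: of_nat_Suc)
  define r where "r = pCons 0 t"
  have dr: "pderiv r = - p"
    by (rule poly_eqI) (simp add: coeff_pderiv r_def t del: of_nat_Suc)
  obtain B where B: "\<And>x. x \<in> D \<Longrightarrow> norm (poly t (inverse x)) \<le> B" using poly_bounded_D by blast
  have "ode_sol 0 (\<lambda>x. poly p (inverse x) / x\<^sup>2) (\<lambda>x. poly r (inverse x))"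
  proof (rule ode_sol_slowI)
    fix x assume x: "x \<in> D"
    show "((\<lambda>x. poly r (inverse x)) has_field_derivative poly p (inverse x) / x\<^sup>2) (at x)"
      using DERIV_poly_inverse[OF D_nonzero[OF x], of r] by (simp add: dr divide_inverse power_inverse mult.commute)
    have "norm (poly r (inverse x)) = norm (poly t (inverse x)) / norm x"
      by (simp add: r_def norm_mult norm_inverse divide_inverse mult.commute)
    also have "\<dots> \<le> B / norm x" using B[OF x] by (rule divide_right_mono) simp
    finally show "norm (poly r (inverse x)) \<le> B / norm x" .
  qed
  from ode_sol_diff[OF sol this]
  have sol': "ode_sol 0 (\<lambda>x. (k x - poly p (inverse x)) / x\<^sup>2) (\<lambda>x. h x - poly r (inverse x))"
    by (simp add: diff_divide_distrib)
  have bd: "norm (h x - poly r (inverse x)) \<le> (s + 2) * q ^ (N + 2) * C / norm x ^ (N + 1)" if "x \<in> D" for x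
    by (rule ode_sol_slow_bound[OF sol' p(2) that])
  have "Kpoly r" unfolding r_def by (intro Kpoly_pCons Kt Kf_consts)
  then show "asy (Suc N) h" using bd unfolding asy_def Suc_eq_plus1 by blast
  have "norm (x * h x - poly t (inverse x)) \<le> (s + 2) * q ^ (N + 2) * C / norm x ^ N" if x: "x \<in> D" for x
  proof -
    have "x * h x - poly t (inverse x) = x * (h x - poly r (inverse x))"
      using D_nonzero[OF x] by (simp add: r_def algebra_simps)
    then have "norm (x * h x - poly t (inverse x)) = norm x * norm (h x - poly r (inverse x))"
      by (simp add: norm_mult)
    also have "\<dots> \<le> norm x * ((s + 2) * q ^ (N + 2) * C / norm x ^ (N + 1))"
      by (intro mult_left_mono bd x) auto
    finally show ?thesis using D_nonzero[OF x] by simp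
  qed
  then show "asy N (\<lambda>x. x * h x)" using Kt unfolding asy_def by blast
qed

text \<open>Comparing powers of 1/x in the equation gives the formal solution \<open>\<mu> * c (Suc
  j) = \<bar>\<mu>\<bar> * coeff p (Suc j) + j * c j\<close>. Truncated at N, it solves the equation
  up to a residual of order N, and \<open>ode_sol_exp_bound\<close> controls the difference from h.
  Rationality of \<mu> keeps the coefficients in \<open>Kf\<close>.\<close>

lemma asy_exp:
  assumes sol: "ode_sol \<mu> (\<lambda>x. of_real \<bar>\<mu>\<bar> * k x) h" and k: "asy N k" and \<mu>: "\<mu> \<noteq> 0" "\<mu> \<in> \<rat>"
  shows "asy N h"
proof -
  obtain p C where p: "Kpoly p" "\<And>x. x \<in> D \<Longrightarrow> norm (k x - poly p (inverse x)) \<le> C / norm x ^ N"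
    by (rule asyE[OF k]) blast
  have Ki: "of_real a \<in> Kf" if a: "a \<in> \<rat>" for a
  proof (rule Kf_rat)
    obtain i j where "a = real_of_int i / real j" using a by (auto simp: Rats_eq_int_div_nat)
    then have "complex_of_real a = of_int i / of_nat j" by simp
    also have "\<dots> \<in> \<rat>" by (intro Rats_divide Rats_of_int Rats_of_nat)
    finally show "complex_of_real a \<in> \<rat>" .
  qed
  define c where "c = rec_nat (of_real (\<bar>\<mu>\<bar> / \<mu>) * coeff p 0)
    (\<lambda>j r. of_real (1 / \<mu>) * (of_real \<bar>\<mu>\<bar> * coeff p (Suc j) + of_nat j * r))"
  have c: "c 0 = of_real (\<bar>\<mu>\<bar> / \<mu>) * coeff p 0"
    "c (Suc j) = of_real (1 / \<mu>) * (of_real \<bar>\<mu>\<bar> * coeff p (Suc j) + of_nat j * c j)" for j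
    by (simp_all add: c_def)
  have cK: "c j \<in> Kf" for j
    using p(1) \<mu>(2) by (induction j) (auto simp: c Kpoly_def intro!: Kf_mult Kf_add Ki Kf_consts simp del: of_real_divide of_real_mult)
  obtain r where r: "\<And>j. coeff r j = (if j < N then c j else 0)"
    using poly_with_coeffs by blast
  have Kr: "Kpoly r" using cK by (simp add: Kpoly_def r Kf_consts)
  \<comment> \<open>The residual as a polynomial in u = 1/x, where d/dx acts as - u^2 d/du.\<close>
  define E where "E = smult (of_real \<mu>) r - monom 1 2 * pderiv r - smult (of_real \<bar>\<mu>\<bar>) p"
  have "coeff E j = 0" if "j < N" for j
  proof (cases j)
    case 0 then show ?thesis using that \<mu>(1) by (simp add: E_def r c coeff_monom_mult)
  next
    case (Suc i)
    have "coeff (monom 1 2 * pderiv r) j = of_nat i * c i"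
      using that by (cases i) (auto simp: Suc coeff_monom_mult coeff_pderiv r)
    then show ?thesis using that \<mu>(1) by (simp add: E_def r Suc c field_simps)
  qed
  then obtain A where A: "\<And>u. norm u \<le> 1 \<Longrightarrow> norm (poly E u) \<le> A * norm u ^ N"
    using poly_small_if_low_coeffs_zero by meson
  obtain B where B: "\<And>x. x \<in> D \<Longrightarrow> norm (poly r (inverse x)) \<le> B" using poly_bounded_D by blast
  have "ode_sol \<mu> (\<lambda>x. of_real \<bar>\<mu>\<bar> * (poly p (inverse x) + of_real (1 / \<bar>\<mu>\<bar>) * poly E (inverse x))) (\<lambda>x. poly r (inverse x))"
  proof (rule ode_sol_expI[OF _ B \<mu>(1)])
    fix x assume x: "x \<in> D"
    show "((\<lambda>x. poly r (inverse x)) has_field_derivative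
        of_real \<bar>\<mu>\<bar> * (poly p (inverse x) + of_real (1 / \<bar>\<mu>\<bar>) * poly E (inverse x)) - of_real \<mu> * poly r (inverse x)) (at x)"
      using DERIV_poly_inverse[OF D_nonzero[OF x], of r] \<mu>(1)
      by (simp add: E_def algebra_simps poly_monom)
  qed
  from ode_sol_diff[OF sol this]
  have sol': "ode_sol \<mu> (\<lambda>x. of_real \<bar>\<mu>\<bar> * (k x - poly p (inverse x) - of_real (1 / \<bar>\<mu>\<bar>) * poly E (inverse x)))
      (\<lambda>x. h x - poly r (inverse x))"
    by (simp add: algebra_simps)
  have le: "norm (k x - poly p (inverse x) - of_real (1 / \<bar>\<mu>\<bar>) * poly E (inverse x)) \<le> (C + A / \<bar>\<mu>\<bar>) / norm x ^ N"
    if x: "x \<in> D" for x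
  proof -
    have "norm (of_real (1 / \<bar>\<mu>\<bar>) * poly E (inverse x)) = norm (poly E (inverse x)) / \<bar>\<mu>\<bar>"
      by (simp add: norm_mult norm_divide)
    also have "\<dots> \<le> A * norm (inverse x) ^ N / \<bar>\<mu>\<bar>"
      using A[OF D_inverse_le1[OF x]] by (rule divide_right_mono) simp
    also have "\<dots> = (A / \<bar>\<mu>\<bar>) / norm x ^ N" by (simp add: norm_inverse power_inverse divide_inverse)
    finally show ?thesis using p(2)[OF x]
        norm_triangle_ineq4[of "k x - poly p (inverse x)" "of_real (1 / \<bar>\<mu>\<bar>) * poly E (inverse x)"]
      by (simp add: add_divide_distrib)
  qed
  show ?thesis using ode_sol_exp_bound[OF sol' \<mu>(1) le] Kr unfolding asy_def by blast
qed

lemma coeffs_zero_if_poly_inverse_small: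
  assumes "\<And>x. x \<in> D \<Longrightarrow> norm (poly p (inverse x)) \<le> C / norm x ^ N" "j < N"
  shows "coeff p j = 0"
proof -
  define U where "U n = inverse (Complex 0 (R + 1 + real n))" for n
  have inD: "Complex 0 (R + 1 + real n) \<in> D" for n by (simp add: D_def)
  have U0: "U n \<noteq> 0" for n using D_nonzero[OF inD[of n]] by (simp add: U_def)
  have nU: "norm (Complex 0 (R + 1 + real n)) = R + 1 + real n" for n
    using R by (simp add: complex_norm)
  have "(\<lambda>n. inverse (R + 1 + real n)) \<longlonglongrightarrow> 0"
    by (intro tendsto_inverse_0_at_top filterlim_tendsto_add_at_top[OF tendsto_const] filterlim_real_sequentially)
  then have "(\<lambda>n. norm (U n)) \<longlonglongrightarrow> 0" by (simp add: U_def norm_inverse nU)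
  then have U: "U \<longlonglongrightarrow> 0" by (rule tendsto_norm_zero_cancel)
  have "norm (poly p (U n)) \<le> C * norm (U n) ^ N" for n
    using assms(1)[OF inD[of n]] by (simp add: U_def norm_inverse power_inverse divide_inverse)
  from low_coeffs_zero_if_poly_small[OF this U U0 assms(2)] show ?thesis .
qed

text \<open>Approximations of orders N \<le> N' differ by O(x^(-N)), so by uniqueness their
  coefficients below N agree, and the diagonal \<open>f j = coeff (P (Suc j)) j\<close> is a series
  valid to every order.\<close>

lemma asy_all_orders:
  assumes "\<And>N. asy N h"
  shows "\<exists>f. (\<forall>j. f j \<in> Kf) \<and>
    (\<forall>N. \<exists>C. \<forall>x\<in>D. norm (h x - (\<Sum>j<N. f j * inverse x ^ j)) \<le> C / norm x ^ N)"
proof -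
  from assms obtain P C where P: "\<And>N. Kpoly (P N)"
      "\<And>N x. x \<in> D \<Longrightarrow> norm (h x - poly (P N) (inverse x)) \<le> C N / norm x ^ N"
    unfolding asy_def by metis
  have agree: "coeff (P N) j = coeff (P N') j" if "j < N" "N \<le> N'" for N N' j
  proof -
    have "norm (poly (P N - P N') (inverse x)) \<le> (\<bar>C N\<bar> + \<bar>C N'\<bar>) / norm x ^ N" if x: "x \<in> D" for x
    proof -
      have "norm x ^ N \<le> norm x ^ N'" "0 < norm x ^ N"
        using D_norm_ge1[OF x] \<open>N \<le> N'\<close> D_nonzero[OF x] by (auto intro!: power_increasing)
      then have "C N' / norm x ^ N' \<le> \<bar>C N'\<bar> / norm x ^ N"
        by (intro frac_le) auto
      moreover have "C N / norm x ^ N \<le> \<bar>C N\<bar> / norm x ^ N" by (intro divide_right_mono) auto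
      ultimately show ?thesis
        using P(2)[OF x, of N] P(2)[OF x, of N']
          norm_triangle_ineq4[of "h x - poly (P N') (inverse x)" "h x - poly (P N) (inverse x)"]
        by (simp add: add_divide_distrib)
    qed
    from coeffs_zero_if_poly_inverse_small[OF this that(1)] show ?thesis by simp
  qed
  define f where "f j = coeff (P (Suc j)) j" for j
  have "\<exists>C. \<forall>x\<in>D. norm (h x - (\<Sum>j<N. f j * inverse x ^ j)) \<le> C / norm x ^ N" for N
  proof -
    obtain r where r: "\<And>j. coeff r j = (if j < N then f j else 0)" using poly_with_coeffs by blast
    have pr: "poly r u = (\<Sum>j<N. f j * u ^ j)" for u
      unfolding poly_altdef
    proof (rule sum.mono_neutral_cong)
      show "f i * u ^ i = 0" if "i \<in> {..<N} - {..degree r}" for i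
        using that r[of i] coeff_eq_0[of r i] by simp
    qed (auto simp: r)
    have "coeff (P N - r) j = 0" if "j < N" for j
      using agree[of j "Suc j" N] that by (simp add: r f_def)
    then obtain A where A: "\<And>u. norm u \<le> 1 \<Longrightarrow> norm (poly (P N - r) u) \<le> A * norm u ^ N"
      using poly_small_if_low_coeffs_zero by meson
    have "norm (h x - (\<Sum>j<N. f j * inverse x ^ j)) \<le> (C N + A) / norm x ^ N" if x: "x \<in> D" for x
      unfolding pr[symmetric] using P(2)[OF x, of N] A[OF D_inverse_le1[OF x]]
        norm_triangle_ineq[of "h x - poly (P N) (inverse x)" "poly (P N - r) (inverse x)"]
      by (simp add: norm_inverse power_inverse divide_inverse distrib_right)
    then show ?thesis by blast
  qed
  moreover have "f j \<in> Kf" for j using P(1) by (simp add: f_def Kpoly_def)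
  ultimately show ?thesis by blast
qed

end

section \<open>Raising the order of all expansions\<close>

lemma rate_Rats: "rate i \<in> \<rat>"
  by (cases i) auto

context sector_asy
begin

lemma Sol_asy:
  assumes h: "Sol i k h" and Y: "\<And>x. x \<in> D \<Longrightarrow> Y x = of_real (init i) + h x" and k: "asy N k"
  shows "rate i = 0 \<Longrightarrow> i \<noteq> Ia 0 \<Longrightarrow> asy (Suc N) Y" "asy N Y"
proof -
  have iK: "of_real (init i) \<in> Kf" by (auto simp: init_def intro: Kf_consts)
  have Yc: "asy M Y" if "asy M h" for M
    using asy_add[OF asy_const[OF iK] that] Y by (rule asy_cong)
  show 1: "asy (Suc N) Y" if "rate i = 0" "i \<noteq> Ia 0"
    using h that asy_slow(1)[OF _ k] by (intro Yc) (auto simp: Sol_def)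
  consider "i = Ia 0" | "rate i = 0" "i \<noteq> Ia 0" | "rate i \<noteq> 0" "i \<noteq> Ia 0" by blast
  then show "asy N Y"
  proof cases
    case 1
    then show ?thesis using h asy_slow(2)[OF _ k] by (intro Yc) (auto simp: Sol_def)
  next
    case 2 then show ?thesis using 1 asy_Suc_D by blast
  next
    case 3 then show ?thesis using h asy_exp[OF _ k _ rate_Rats] by (intro Yc) (auto simp: Sol_def)
  qed
qed

end

locale system_sol = sector_asy +
  fixes th ta ka sg :: complex and Y :: "idx \<Rightarrow> complex \<Rightarrow> complex"
  assumes coeffs: "th \<in> Kf" "ta \<in> Kf" "ka \<in> Kf" "sg \<in> Kf"
    and Y_bounded: "\<And>i. \<exists>C. \<forall>x\<in>D. norm (Y i x) \<le> C"
    and Y_sol: "\<And>i. \<exists>h. Sol i (\<lambda>x. rhs th ta ka sg i (\<lambda>j. Y j x) (inverse x)) h \<and>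
       (\<forall>x\<in>D. Y i x = of_real (init i) + h x)"
begin

abbreviation "rhsY i \<equiv> \<lambda>x. rhs th ta ka sg i (\<lambda>j. Y j x) (inverse x)"
abbreviation "VA n \<equiv> \<lambda>x. va (\<lambda>j. Y j x) (inverse x) n"
abbreviation "VG n \<equiv> \<lambda>x. vg (\<lambda>j. Y j x) (inverse x) n"
abbreviation "VP n \<equiv> \<lambda>x. vp (\<lambda>j. Y j x) (inverse x) n"
abbreviation "VW \<equiv> \<lambda>x. vW (\<lambda>j. Y j x) (inverse x)"
abbreviation "CG n \<equiv> \<lambda>x. cG (\<lambda>j. Y j x) (inverse x) n"
abbreviation "CP n \<equiv> \<lambda>x. cP (\<lambda>j. Y j x) (inverse x) n"
abbreviation "CQ n \<equiv> \<lambda>x. cQ (\<lambda>j. Y j x) (inverse x) n"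

lemma Y_asy_slow:
  "asy N (rhsY i) \<Longrightarrow> rate i = 0 \<Longrightarrow> i \<noteq> Ia 0 \<Longrightarrow> asy (Suc N) (Y i)"
  using Y_sol[of i] Sol_asy(1) by blast

lemma Y_asy: "asy N (rhsY i) \<Longrightarrow> asy N (Y i)"
  using Y_sol[of i] Sol_asy(2) by blast

lemmas asy_rules = asy_add asy_diff asy_mult asy_uminus asy_const asy_inverse

lemma asy_VA0: "asy N (Y (Ia 0)) \<Longrightarrow> asy (Suc N) (VA 0)"
  using asy_inverse_scaled2[of 1 N "Y (Ia 0)"] by (simp add: va_def Kf_consts)

lemma asy_VA0': "asy N (Y (Ia 0)) \<Longrightarrow> asy N h \<Longrightarrow> asy (Suc N) (\<lambda>x. VA 0 x * h x)"
  using asy_inverse_scaled2[of 1 N "\<lambda>x. Y (Ia 0) x * h x"] asy_mult[of N "Y (Ia 0)" h]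
  by (simp add: va_def Kf_consts mult.assoc)

lemma asy_VG0: "asy N (Y (Iga 0)) \<Longrightarrow> asy (Suc N) (VG 0)"
  using asy_inverse_mult[of N "Y (Iga 0)"] by (simp add: vg_def)

lemma asy_VP0: "asy N (Y (Ip 0)) \<Longrightarrow> asy (Suc N) (VP 0)"
  using asy_inverse_mult[of N "Y (Ip 0)"] by (simp add: vp_def)

lemma asy_VW: "asy N (Y IA) \<Longrightarrow> asy N (Y IB) \<Longrightarrow> asy N VW"
  unfolding vW_def by (intro asy_rules)

text \<open>The order of the components matters. \<open>IA\<close>, \<open>Iph 0\<close> and
  \<open>Iq 0\<close> gain a power by slow integration. Nonzero rates gain nothing, so in
  \<open>IB\<close>, \<open>Iga 0\<close> and \<open>Ip 0\<close> every term must either carry 1/x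
  or consist of improved unknowns. The gain of \<open>Ia 0\<close> is lost in its scaling, so it has
  to wait for the four unknowns in its source.\<close>

lemma asy_step:
  assumes H: "\<And>i. asy N (Y i)"
  shows "asy (Suc N) (Y i)"
proof -
  have W: "asy N VW" by (intro asy_VW H)
  have vg0: "asy N (VG 0)" and vp0: "asy N (VP 0)" using asy_VG0[OF H] asy_VP0[OF H] asy_Suc_D by blast+
  note K = coeffs Kf_intros
  have A: "asy (Suc N) (Y IA)" by (rule Y_asy_slow) (simp only: rhs.simps, intro asy_rules K H W, auto)
  have F: "asy (Suc N) (Y (Iph 0))" by (rule Y_asy_slow) (simp only: rhs.simps, intro asy_rules K H W vg0, auto)
  have Q: "asy (Suc N) (Y (Iq 0))" by (rule Y_asy_slow) (simp only: rhs.simps, intro asy_rules K H W vp0, auto)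
  have u: "asy (Suc N) (\<lambda>x. inverse x * Y i x)" for i by (intro asy_inverse_mult H)
  have B: "asy (Suc N) (Y IB)"
    by (rule Y_asy) (simp only: rhs.simps, intro asy_add asy_diff asy_inverse_scaled asy_mult[OF asy_const]
      asy_mult[where h = "Y (Ia 0)"] K H W u A)
  have G0: "asy (Suc N) (Y (Iga 0))"
    by (rule Y_asy) (simp only: rhs.simps, intro asy_add asy_diff asy_inverse_scaled asy_mult[OF asy_const]
      asy_mult[where h = "Y (Ia 0)"] asy_add[OF vg0 H] K H W u F asy_VG0)
  have P0: "asy (Suc N) (Y (Ip 0))"
    by (rule Y_asy) (simp only: rhs.simps, intro asy_add asy_diff asy_inverse_scaled asy_mult[OF asy_const]
      asy_mult[where h = "Y (Ia 0)"] asy_mult[where h = "Y (Ia 1)"] asy_add[OF vp0 H] K H W u Q asy_VP0)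
  have a0: "asy (Suc N) (Y (Ia 0))"
    by (rule Y_asy) (simp only: rhs.simps, intro asy_rules K A B F G0)
  \<comment> \<open>Induction on the mode works because unimproved unknowns of the current mode
    occur only with a factor 1/x or \<open>VA 0\<close>, and the next mode only with u^2; order N
    suffices for them. Inside a mode \<open>Ia\<close> comes first, as \<open>cG\<close> and
    \<open>cP\<close> contain it at full index.\<close>
  have ord: "asy (Suc N) (Y (Ia n)) \<and> asy (Suc N) (Y (Iph n)) \<and> asy (Suc N) (Y (Iga n)) \<and>
      asy (Suc N) (Y (Ip n)) \<and> asy (Suc N) (Y (Iq n))" for n
  proof (induction n rule: less_induct)
    case (less n)
    show ?case
    proof (cases n)
      case 0 then show ?thesis using a0 F G0 P0 Q by simp
    next
      case (Suc m)
      have le: "asy (Suc N) (Y (Ia j))" "asy (Suc N) (Y (Iph j))" "asy (Suc N) (Y (Iga j))"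
        "asy (Suc N) (Y (Ip j))" "asy (Suc N) (Y (Iq j))" if "j \<le> m" for j
        using less[of j] that Suc by auto
      have VG: "asy (Suc N) (VG j)" if "j \<le> m" for j
        using le(3)[OF that] asy_VG0[OF H] by (cases "j = 0") (auto simp: vg_def)
      have VP: "asy (Suc N) (VP j)" if "j \<le> m" for j
        using le(4)[OF that] asy_VP0[OF H] by (cases "j = 0") (auto simp: vp_def)
      have VGn: "asy N (VG (Suc m))" "asy N (VP (Suc m))" "asy N (VA (Suc m))"
        using H by (auto simp: vg_def vp_def va_def)
      have cQ: "asy (Suc N) (CQ m)"
        unfolding cQ_def by (intro asy_sum asy_diff asy_mult le VG VP) auto
      have c1: "asy (Suc N) (\<lambda>x. 1 / of_nat (Suc m))" "asy (Suc N) (\<lambda>x. 2 / of_nat (Suc m))"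
        "asy (Suc N) (\<lambda>x. 2 / of_nat (Suc (Suc m)))"
        by (intro asy_const K)+
      have n1: "- ((1 + of_nat (Suc m) * (sg - 2)) / of_nat (Suc m)) \<in> Kf" "- (sg - 2) \<in> Kf"
        "- (of_nat (Suc m) * (sg - 2) / of_nat (Suc (Suc m))) \<in> Kf"
        "- ((sg + of_nat (Suc m) * (sg - 2)) / of_nat (Suc (Suc m))) \<in> Kf" "th + ta \<in> Kf" "2 * ka \<in> Kf"
        by (intro K)+
      have a: "asy (Suc N) (Y (Ia (Suc m)))"
        by (rule Y_asy) (simp only: rhs.simps, intro asy_add asy_inverse_scaled[OF n1(1)] asy_inverse_divide2[OF coeffs(3)]
          VGn asy_diff asy_mult[OF c1(1) cQ] asy_mult[OF asy_mult[OF asy_inverse H] H] asy_mult[OF VGn(1) H])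
      have VA: "asy (Suc N) (VA j)" if "j \<le> Suc m" for j
        using le(1)[of j] a that asy_VA0[OF H] by (cases "j = 0"; cases "j = Suc m") (auto simp: va_def)
      have cG: "asy (Suc N) (CG (Suc m))"
        unfolding cG_def
      proof (rule asy_sum)
        fix j assume j: "j \<in> {..Suc m}"
        show "asy (Suc N) (\<lambda>x. VA j x * (VG (Suc m - j) x + Y (Iph (Suc m - j)) x))"
        proof (cases "j = 0")
          case True
          then show ?thesis using asy_VA0'[OF H asy_add[OF VGn(1) H]] by simp
        next
          case False
          with j show ?thesis by (intro asy_mult asy_add VA VG le) auto
        qed
      qed
      have cP: "asy (Suc N) (CP (Suc m))"
        unfolding cP_def
      proof (rule asy_sum)
        fix j assume j: "j \<in> {..Suc m}"
        show "asy (Suc N) (\<lambda>x. VA j x * (VP (Suc m - j) x + Y (Iq (Suc m - j)) x))"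
        proof (cases "j = 0")
          case True
          then show ?thesis using asy_VA0'[OF H asy_add[OF VGn(2) H]] by simp
        next
          case False
          with j show ?thesis by (intro asy_mult asy_add VA VP le) auto
        qed
      qed
      have F: "asy (Suc N) (Y (Iph (Suc m)))"
        by (rule Y_asy) (simp only: rhs.simps, intro asy_add asy_diff asy_inverse_scaled[OF n1(2)]
          asy_inverse_divide[OF coeffs(2)] VGn H asy_mult[OF c1(2) cG])
      have G: "asy (Suc N) (Y (Iga (Suc m)))"
        by (rule Y_asy) (simp only: rhs.simps, intro asy_add asy_diff asy_inverse_scaled[OF n1(3)]
          asy_inverse_divide[OF n1(5)] asy_inverse_divide[OF coeffs(1)] VGn H asy_mult[OF c1(3) cG])
      have P: "asy (Suc N) (Y (Ip (Suc m)))"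
        by (rule Y_asy) (simp only: rhs.simps, intro asy_add asy_diff asy_inverse_scaled[OF n1(4)]
          asy_inverse_divide[OF coeffs(2)] asy_inverse_divide2[OF n1(6)] VGn H asy_mult[OF c1(3) cP] asy_mult[OF H W])
      have Q: "asy (Suc N) (Y (Iq (Suc m)))"
        by (rule Y_asy) (simp only: rhs.simps, intro asy_add asy_diff asy_inverse_scaled[OF n1(2)]
          asy_inverse_divide[OF coeffs(1)] asy_inverse_divide2[OF n1(6)] VGn H asy_mult[OF c1(2) cP] asy_mult[OF H W])
      show ?thesis unfolding Suc using a F G P Q by blast
    qed
  qed
  show ?thesis using A B ord by (cases i) auto
qed

theorem Y_asy_all: "asy N (Y i)"
proof (induction N arbitrary: i)
  case 0
  then show ?case using Y_bounded[of i] asy_0 by blast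
next
  case (Suc N) then show ?case by (rule asy_step)
qed

end

section \<open>Leading coefficients\<close>

context sector_asy
begin

text \<open>\<open>asy\<close> asserts that coefficients exist without giving their values. This
  relation computes the constant term, with the error needed to peel it off in
  \<open>asy_shift\<close>.\<close>

definition lead :: "(complex \<Rightarrow> complex) \<Rightarrow> complex \<Rightarrow> bool" where
  "lead h v \<longleftrightarrow> (\<exists>C. \<forall>x\<in>D. norm (h x - v) \<le> C / norm x)"

lemma leadE:
  assumes "lead h v"
  obtains C where "\<And>x. x \<in> D \<Longrightarrow> norm (h x - v) \<le> C / norm x"
  using assms unfolding lead_def by blast

lemma lead_const: "lead (\<lambda>_. c) c"
  unfolding lead_def by (rule exI[of _ 0]) simp

lemma lead_add:
  assumes h: "lead h v" and g: "lead g w"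
  shows "lead (\<lambda>x. h x + g x) (v + w)"
proof -
  obtain C where C: "\<And>x. x \<in> D \<Longrightarrow> norm (h x - v) \<le> C / norm x" by (rule leadE[OF h]) blast
  obtain C' where C': "\<And>x. x \<in> D \<Longrightarrow> norm (g x - w) \<le> C' / norm x" by (rule leadE[OF g]) blast
  have "norm (h x + g x - (v + w)) \<le> (C + C') / norm x" if "x \<in> D" for x
  proof -
    have "h x + g x - (v + w) = (h x - v) + (g x - w)" by simp
    then show ?thesis using norm_triangle_mono[OF C[OF that] C'[OF that]] by (simp only: add_divide_distrib)
  qed
  then show ?thesis unfolding lead_def by blast
qed

lemma lead_imp_bounded:
  assumes "lead h v"
  shows "\<exists>B. \<forall>x\<in>D. norm (h x) \<le> B"
proof -
  obtain C where C: "\<And>x. x \<in> D \<Longrightarrow> norm (h x - v) \<le> C / norm x" by (rule leadE[OF assms]) blast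
  have "norm (h x) \<le> \<bar>C\<bar> + norm v" if x: "x \<in> D" for x
  proof -
    have "C / norm x \<le> \<bar>C\<bar> / 1" using D_norm_ge1[OF x] by (intro frac_le) auto
    then show ?thesis using C[OF x] norm_triangle_sub[of "h x" v] by simp
  qed
  then show ?thesis by blast
qed

lemma lead_mult:
  assumes h: "lead h v" and g: "lead g w"
  shows "lead (\<lambda>x. h x * g x) (v * w)"
proof -
  obtain C where C: "\<And>x. x \<in> D \<Longrightarrow> norm (h x - v) \<le> C / norm x" by (rule leadE[OF h]) blast
  obtain C' where C': "\<And>x. x \<in> D \<Longrightarrow> norm (g x - w) \<le> C' / norm x" by (rule leadE[OF g]) blast
  obtain B where B: "\<And>x. x \<in> D \<Longrightarrow> norm (h x) \<le> B" using lead_imp_bounded[OF h] by blast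
  have "norm (h x * g x - v * w) \<le> (B * C' + C * norm w) / norm x" if x: "x \<in> D" for x
  proof -
    have "h x * g x - v * w = h x * (g x - w) + (h x - v) * w" by (simp add: algebra_simps)
    also have "norm \<dots> \<le> norm (h x) * norm (g x - w) + norm (h x - v) * norm w"
      using norm_triangle_ineq unfolding norm_mult[symmetric] by blast
    also have "\<dots> \<le> B * (C' / norm x) + (C / norm x) * norm w"
      using B[OF x] C[OF x] C'[OF x] order_trans[OF norm_ge_zero B[OF x]] order_trans[OF norm_ge_zero C[OF x]]
      by (intro add_mono mult_mono) auto
    finally show ?thesis by (simp add: add_divide_distrib)
  qed
  then show ?thesis unfolding lead_def by blast
qed

lemma lead_uminus: "lead h v \<Longrightarrow> lead (\<lambda>x. - h x) (- v)"
  using lead_mult[OF lead_const[of "-1"], of h v] by simp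

lemma lead_diff: "lead h v \<Longrightarrow> lead g w \<Longrightarrow> lead (\<lambda>x. h x - g x) (v - w)"
  using lead_add[OF _ lead_uminus, of h v g w] by simp

lemma lead_inverse_mult:
  assumes "\<And>x. x \<in> D \<Longrightarrow> norm (h x) \<le> B"
  shows "lead (\<lambda>x. inverse x * h x) 0"
  unfolding lead_def
proof (intro exI ballI)
  fix x assume x: "x \<in> D"
  show "norm (inverse x * h x - 0) \<le> B / norm x"
    using divide_right_mono[OF assms[OF x], of "norm x"] by (simp add: norm_mult norm_inverse divide_inverse mult.commute)
qed

lemma lead_eq: "lead h v \<Longrightarrow> v = w \<Longrightarrow> lead h w"
  by simp

lemma lead_cong: "lead h v \<Longrightarrow> (\<And>x. x \<in> D \<Longrightarrow> h' x = h x) \<Longrightarrow> lead h' v"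
  unfolding lead_def by auto

lemma lead_scaledI:
  assumes "\<And>x. x \<in> D \<Longrightarrow> norm (h x - v * inverse x) \<le> C / norm x ^ 2"
  shows "lead (\<lambda>x. x * h x) v"
  unfolding lead_def
proof (intro exI ballI)
  fix x assume x: "x \<in> D"
  have "x * h x - v = x * (h x - v * inverse x)" using D_nonzero[OF x] by (simp add: right_diff_distrib)
  then have "norm (x * h x - v) = norm x * norm (h x - v * inverse x)" by (simp add: norm_mult)
  also have "\<dots> \<le> norm x * (C / norm x ^ 2)" by (intro mult_left_mono assms x) auto
  finally show "norm (x * h x - v) \<le> C / norm x" using D_nonzero[OF x] by (simp add: power2_eq_square)
qed

text \<open>The constant \<open>sgn \<mu> * v\<close> is the selected solution for the constant
  source \<open>\<bar>\<mu>\<bar> * v\<close>, and the difference has a source of order 1/x.\<close>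

lemma lead_exp:
  assumes sol: "ode_sol \<mu> (\<lambda>x. of_real \<bar>\<mu>\<bar> * k x) h" and \<mu>: "\<mu> \<noteq> 0" and k: "lead k v"
  shows "lead h (of_real (sgn \<mu>) * v)"
proof -
  obtain C where C: "\<And>x. x \<in> D \<Longrightarrow> norm (k x - v) \<le> C / norm x" by (rule leadE[OF k]) blast
  have "ode_sol \<mu> (\<lambda>x. of_real \<bar>\<mu>\<bar> * v) (\<lambda>x. of_real (sgn \<mu>) * v)"
  proof (rule ode_sol_expI[OF _ _ \<mu>])
    have "\<mu> * sgn \<mu> = \<bar>\<mu>\<bar>" by (simp add: abs_sgn)
    then have "of_real \<mu> * (of_real (sgn \<mu>) * v) = of_real \<bar>\<mu>\<bar> * v"
      by (simp only: mult.assoc[symmetric] of_real_mult[symmetric])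
    then show "((\<lambda>x. of_real (sgn \<mu>) * v) has_field_derivative of_real \<bar>\<mu>\<bar> * v - of_real \<mu> * (of_real (sgn \<mu>) * v)) (at x)" for x
      by (simp only: right_minus_eq cancel_comm_monoid_add_class.diff_cancel DERIV_const)
  qed auto
  from ode_sol_diff[OF sol this]
  have "ode_sol \<mu> (\<lambda>x. of_real \<bar>\<mu>\<bar> * (k x - v)) (\<lambda>x. h x - of_real (sgn \<mu>) * v)"
    by (simp add: right_diff_distrib)
  from ode_sol_exp_bound[OF this \<mu>, of C 1] C
  have "norm (h x - of_real (sgn \<mu>) * v) \<le> (s + 2) * q ^ 1 * C / norm x ^ 1" if "x \<in> D" for x
    using that by simp
  then show ?thesis unfolding lead_def power_one_right by blast
qed

text \<open>By uniqueness the approximating polynomial has constant term \<open>v\<close>; the rest,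
  divided by 1/x, approximates the scaled remainder with coefficients still in
  \<open>Kf\<close>.\<close>

lemma asy_shift:
  assumes h: "asy (Suc N) h" and v: "lead h v" "v \<in> Kf"
  shows "asy N (\<lambda>x. x * (h x - v))"
proof -
  obtain p C where p: "Kpoly p" "\<And>x. x \<in> D \<Longrightarrow> norm (h x - poly p (inverse x)) \<le> C / norm x ^ Suc N"
    by (rule asyE[OF h]) blast
  obtain B where B: "\<And>x. x \<in> D \<Longrightarrow> norm (h x - v) \<le> B / norm x" by (rule leadE[OF v(1)]) blast
  obtain a r where ar: "p = pCons a r" by (cases p)
  have "norm (poly (p - [:v:]) (inverse x)) \<le> (\<bar>C\<bar> + B) / norm x ^ 1" if x: "x \<in> D" for x
  proof -
    have "norm x ^ 1 \<le> norm x ^ Suc N" "0 < norm x ^ 1"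
      using D_norm_ge1[OF x] D_nonzero[OF x] by (intro power_increasing, auto)
    then have "C / norm x ^ Suc N \<le> \<bar>C\<bar> / norm x ^ 1" by (intro frac_le) auto
    then have "norm (h x - poly p (inverse x)) \<le> \<bar>C\<bar> / norm x" using p(2)[OF x] by simp
    then show ?thesis
      using B[OF x] norm_triangle_ineq4[of "h x - v" "h x - poly p (inverse x)"] by (simp add: add_divide_distrib)
  qed
  from coeffs_zero_if_poly_inverse_small[OF this, of 0] have av: "a = v" by (simp add: ar)
  have Kr: "Kpoly r" unfolding Kpoly_def
  proof
    fix j show "coeff r j \<in> Kf" using p(1)[unfolded Kpoly_def, rule_format, of "Suc j"] by (simp add: ar)
  qed
  have "norm (x * (h x - v) - poly r (inverse x)) \<le> C / norm x ^ N" if x: "x \<in> D" for x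
  proof -
    have "x * (h x - v) - poly r (inverse x) = x * (h x - poly p (inverse x))"
      using D_nonzero[OF x] by (simp add: ar av algebra_simps)
    then have "norm (x * (h x - v) - poly r (inverse x)) = norm x * norm (h x - poly p (inverse x))"
      by (simp add: norm_mult)
    also have "\<dots> \<le> norm x * (C / norm x ^ Suc N)" by (intro mult_left_mono p x) auto
    finally show ?thesis using D_nonzero[OF x] by simp
  qed
  then show ?thesis using Kr unfolding asy_def by blast
qed

end

context system_sol
begin

lemma Y_deriv:
  assumes x: "x \<in> D"
  shows "(Y i has_field_derivative
    (if i = Ia 0 then (Y i x + rhsY i x) / x else if rate i = 0 then rhsY i x / x\<^sup>2
     else of_real \<bar>rate i\<bar> * rhsY i x - of_real (rate i) * Y i x)) (at x)"
proof -
  obtain h where h: "Sol i (rhsY i) h" and Yh: "\<And>x. x \<in> D \<Longrightarrow> Y i x = of_real (init i) + h x"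
    using Y_sol[of i] by blast
  have tr: "(Y i has_field_derivative d) (at x)" if "(h has_field_derivative d) (at x)" for d
  proof (rule has_field_derivative_transform_within_open[OF _ open_D x])
    show "((\<lambda>x. of_real (init i) + h x) has_field_derivative d) (at x)"
      using that by (auto intro!: derivative_eq_intros)
  qed (simp add: Yh)
  have x0: "x \<noteq> 0" using D_nonzero[OF x] .
  consider "i = Ia 0" | "i \<noteq> Ia 0" "rate i = 0" | "i \<noteq> Ia 0" "rate i \<noteq> 0" by blast
  then show ?thesis
  proof cases
    case 1
    then obtain g where g: "ode_sol 0 (\<lambda>x. rhsY i x / x\<^sup>2) g" "h = (\<lambda>x. x * g x)"
      using h unfolding Sol_def by auto
    have "(g has_field_derivative rhsY i x / x\<^sup>2) (at x)" using g(1) x by (simp add: ode_sol_def)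
    then have "((\<lambda>x. x * g x) has_field_derivative (Y i x + rhsY i x) / x) (at x)"
      using x0 Yh[OF x] 1 by (auto intro!: derivative_eq_intros simp: g(2) init_def field_simps power2_eq_square simp del: rhs.simps)
    then show ?thesis using 1 tr g(2) by simp
  next
    case 2
    then have "(h has_field_derivative rhsY i x / x\<^sup>2) (at x)" using h x by (simp add: Sol_def ode_sol_def)
    then show ?thesis using 2 tr by simp
  next
    case 3
    have "init i = 0" using 3(2) by (auto simp: init_def)
    moreover have "(h has_field_derivative of_real \<bar>rate i\<bar> * rhsY i x - of_real (rate i) * h x) (at x)"
      using 3 h x by (simp add: Sol_def ode_sol_def)
    ultimately show ?thesis using 3 tr Yh[OF x] by simp
  qed
qed

lemma lead_u: "lead (\<lambda>x. inverse x * Y i x) 0"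
  using Y_bounded[of i] lead_inverse_mult[of "Y i"] by blast

text \<open>The source is bounded, so integration of its quotient by x^2 leaves only O(1/x) besides
  the prescribed value at infinity.\<close>

lemma lead_slow:
  assumes "rate i = 0" "i \<noteq> Ia 0"
  shows "lead (Y i) (of_real (init i))"
proof -
  obtain h where h: "Sol i (rhsY i) h" and Yh: "\<And>x. x \<in> D \<Longrightarrow> Y i x = of_real (init i) + h x"
    using Y_sol[of i] by blast
  have "i = IA \<or> i = Iph 0 \<or> i = Iq 0" using assms by (cases i) auto
  then have "asy 0 (rhsY i)"
  proof (elim disjE)
    note H = Y_asy_all asy_VW[OF Y_asy_all Y_asy_all] asy_Suc_D[OF asy_VG0[OF Y_asy_all]] asy_Suc_D[OF asy_VP0[OF Y_asy_all]]
      coeffs Kf_intros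
    show ?thesis if "i = IA" unfolding that rhs.simps by (intro asy_rules H)
    show ?thesis if "i = Iph 0" unfolding that rhs.simps by (intro asy_rules H)
    show ?thesis if "i = Iq 0" unfolding that rhs.simps by (intro asy_rules H)
  qed
  then obtain m where m: "\<And>x. x \<in> D \<Longrightarrow> norm (rhsY i x) \<le> m / norm x ^ 0"
    using asy_bounded[of 0 "rhsY i"] by auto
  have "ode_sol 0 (\<lambda>x. rhsY i x / x\<^sup>2) h" using h assms by (simp add: Sol_def)
  from ode_sol_slow_bound[OF this m] show ?thesis
    unfolding lead_def using Yh by (intro exI[of _ "(s + 2) * q ^ (0 + 2) * m"]) auto
qed

lemma lead_rate:
  assumes "rate i \<noteq> 0" "lead (rhsY i) v"
  shows "lead (Y i) (of_real (sgn (rate i)) * v)"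
proof -
  obtain h where h: "Sol i (rhsY i) h" and Yh: "\<And>x. x \<in> D \<Longrightarrow> Y i x = of_real (init i) + h x"
    using Y_sol[of i] by blast
  have "init i = 0" "i \<noteq> Ia 0" using assms by (auto simp: init_def)
  then show ?thesis using lead_exp[OF _ assms] h Yh lead_cong[of h _ "Y i"] assms by (auto simp: Sol_def)
qed

lemma lead_IA: "lead (Y IA) 1" and lead_F0: "lead (Y (Iph 0)) 1" and lead_Q0: "lead (Y (Iq 0)) 1"
  using lead_slow[of IA] lead_slow[of "Iph 0"] lead_slow[of "Iq 0"] by (auto simp: init_def)

lemma lead_u_mult:
  assumes "asy 0 h"
  shows "lead (\<lambda>x. c * inverse x * h x) 0"
proof -
  obtain B where "\<And>x. x \<in> D \<Longrightarrow> norm (h x) \<le> B" using asy_bounded[OF assms] by blast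
  from lead_mult[OF lead_const[of c] lead_inverse_mult[OF this]] show ?thesis by (simp add: mult.assoc)
qed

lemma asy_0s:
  "asy 0 (Y i)" "asy 0 VW" "asy 0 (VA n)" "asy 0 (VG n)" "asy 0 (VP n)"
  subgoal by (rule Y_asy_all)
  subgoal by (intro asy_VW Y_asy_all)
  subgoal using asy_Suc_D[OF asy_VA0[OF Y_asy_all]] Y_asy_all by (cases "n = 0") (auto simp: va_def)
  subgoal using asy_Suc_D[OF asy_VG0[OF Y_asy_all]] Y_asy_all by (cases "n = 0") (auto simp: vg_def)
  subgoal using asy_Suc_D[OF asy_VP0[OF Y_asy_all]] Y_asy_all by (cases "n = 0") (auto simp: vp_def)
  done

lemmas lead_rules = lead_add lead_diff lead_mult lead_uminus lead_const lead_u lead_u_mult asy_0s asy_mult asy_add asy_diff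

lemma lead_VG0: "lead (VG 0) 0" and lead_VP0: "lead (VP 0) 0"
  using lead_u by (simp_all add: vg_def vp_def)

lemma lead_IB: "lead (Y IB) th"
proof -
  have "lead (rhsY IB) ((1 - th - ta) * 0 - th * 1 + 0)"
    unfolding rhs.simps by (intro lead_rules lead_IA)
  from lead_rate[OF _ this] show ?thesis by simp
qed

lemma lead_G0: "lead (Y (Iga 0)) th"
proof -
  have "lead (rhsY (Iga 0)) ((1 + th + ta) * 0 + th * 1 - 0)"
    unfolding rhs.simps by (intro lead_rules lead_VG0 lead_F0)
  from lead_rate[OF _ this] show ?thesis by simp
qed

lemma lead_P0: "lead (Y (Ip 0)) ta"
proof -
  have "lead (rhsY (Ip 0)) ((1 - sg) * 0 + ta * 1 - 0 - 0)"
    unfolding rhs.simps by (intro lead_rules lead_VP0 lead_Q0)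
  from lead_rate[OF _ this] show ?thesis by simp
qed

lemma lead_u2_mult: "asy 0 h \<Longrightarrow> lead (\<lambda>x. c * (inverse x)\<^sup>2 / d * h x) 0"
  using lead_u_mult[OF asy_mult[OF asy_inverse], of h "c / d"] by (simp add: power2_eq_square mult_ac)

lemma lead_u_divide_mult: "asy 0 h \<Longrightarrow> lead (\<lambda>x. c * inverse x / d * h x) 0"
  using lead_u_mult[of h "c / d"] by simp

text \<open>In the source only the product of \<open>Iq 0\<close> and \<open>Iph 0\<close> in
  \<open>cQ\<close> survives at infinity, since \<open>VG 0\<close> and \<open>VP 0\<close>
  decay.\<close>

lemma lead_a1: "lead (Y (Ia (Suc 0))) 1"
proof -
  have q: "lead (CQ 0) (1 * 1 - 0 * 0)"
  proof (rule lead_cong)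
    show "lead (\<lambda>x. Y (Iq 0) x * Y (Iph 0) x - VG 0 x * VP 0 x) (1 * 1 - 0 * 0)"
      by (intro lead_diff lead_mult lead_Q0 lead_F0 lead_VG0 lead_VP0)
  qed (simp add: cQ_def)
  have "asy 0 (\<lambda>x. inverse x * Y IB x * Y (Iph (Suc 0)) x - VG (Suc 0) x * Y IA x)"
    by (intro asy_diff asy_mult asy_inverse asy_0s)
  then have "lead (rhsY (Ia (Suc 0))) (0 + 0 + 1 / of_nat (Suc 0) * (1 * 1 - 0 * 0))"
    unfolding rhs.simps by (intro lead_add lead_mult lead_const q lead_u_mult lead_u2_mult asy_0s)
  from lead_rate[OF _ this] show ?thesis by simp
qed

lemma lead_cG1: "lead (CG (Suc 0)) 1" and lead_cP1: "lead (CP (Suc 0)) 1"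
proof -
  have a1: "lead (VA (Suc 0)) 1" using lead_a1 by (simp add: va_def)
  have z: "lead (\<lambda>x. VA 0 x * h x) 0" if "asy 0 h" for h
  proof -
    have "lead (\<lambda>x. 1 * inverse x * (inverse x * Y (Ia 0) x * h x)) 0"
      by (intro lead_u_mult asy_mult asy_inverse asy_0s that)
    then show ?thesis by (rule lead_cong) (simp add: va_def power2_eq_square)
  qed
  have "lead (\<lambda>x. VA 0 x * (VG (Suc 0) x + Y (Iph (Suc 0)) x) + VA (Suc 0) x * (VG 0 x + Y (Iph 0) x)) (0 + 1 * (0 + 1))"
    by (intro lead_add z lead_mult a1 lead_VG0 lead_F0 asy_add asy_0s)
  then show "lead (CG (Suc 0)) 1" by (simp add: cG_def)
  have "lead (\<lambda>x. VA 0 x * (VP (Suc 0) x + Y (Iq (Suc 0)) x) + VA (Suc 0) x * (VP 0 x + Y (Iq 0) x)) (0 + 1 * (0 + 1))"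
    by (intro lead_add z lead_mult a1 lead_VP0 lead_Q0 asy_add asy_0s)
  then show "lead (CP (Suc 0)) 1" by (simp add: cP_def)
qed

lemma lead_F1: "lead (Y (Iph (Suc 0))) 2"
proof -
  have "lead (rhsY (Iph (Suc 0))) (0 - 0 + 2 / of_nat (Suc 0) * 1)"
    unfolding rhs.simps
    by (intro lead_add lead_diff lead_mult[OF lead_const lead_cG1] lead_u_mult lead_u_divide_mult asy_0s)
  from lead_rate[OF _ this] show ?thesis by simp
qed

lemma lead_G1: "lead (Y (Iga (Suc 0))) (-1)"
proof -
  have "lead (rhsY (Iga (Suc 0))) (0 + 0 + 0 - 2 / of_nat (Suc (Suc 0)) * 1)"
    unfolding rhs.simps
    by (intro lead_add lead_diff lead_mult[OF lead_const lead_cG1] lead_u_mult lead_u_divide_mult asy_0s)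
  from lead_rate[OF _ this] show ?thesis by simp
qed

lemma lead_P1: "lead (Y (Ip (Suc 0))) (-1)"
proof -
  have "lead (rhsY (Ip (Suc 0))) (0 + 0 - 2 / of_nat (Suc (Suc 0)) * 1 - 0)"
    unfolding rhs.simps
    by (intro lead_add lead_diff lead_mult[OF lead_const lead_cP1] lead_u_mult lead_u_divide_mult lead_u2_mult asy_mult asy_0s)
  from lead_rate[OF _ this] show ?thesis by simp
qed

lemma lead_Q1: "lead (Y (Iq (Suc 0))) 2"
proof -
  have "lead (rhsY (Iq (Suc 0))) (0 - 0 + 2 / of_nat (Suc 0) * 1 + 0)"
    unfolding rhs.simps
    by (intro lead_add lead_diff lead_mult[OF lead_const lead_cP1] lead_u_mult lead_u_divide_mult lead_u2_mult asy_mult asy_0s)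
  from lead_rate[OF _ this] show ?thesis by simp
qed

text \<open>The term d/x with \<mu> d = c balances the source c/x up to O(x^(-2)); for |\<mu>| = 1
  this means d = \<mu> c. Subtracting it leaves an equation whose source, and hence whose solution,
  is O(x^(-2)).\<close>

lemma lead_second_order:
  assumes h: "\<And>x. x \<in> D \<Longrightarrow> (h has_field_derivative inverse x * M x - of_real \<mu> * h x) (at x)"
    and h0: "lead h 0" and M: "lead M c" and \<mu>: "\<bar>\<mu>\<bar> = 1"
  shows "lead (\<lambda>x. x * h x) (of_real \<mu> * c)"
proof -
  define d where "d = of_real \<mu> * c"
  have dc: "of_real \<mu> * d = c"
    using \<mu> unfolding d_def mult.assoc[symmetric] of_real_mult[symmetric] abs_mult_self_eq[of \<mu>, symmetric] by simp
  obtain C where C: "\<And>x. x \<in> D \<Longrightarrow> norm (M x - c) \<le> C / norm x" by (rule leadE[OF M]) blast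
  obtain B where B: "\<And>x. x \<in> D \<Longrightarrow> norm (h x) \<le> B" using lead_imp_bounded[OF h0] by blast
  have sol: "ode_sol \<mu> (\<lambda>x. of_real \<bar>\<mu>\<bar> * (inverse x * (M x - c) + d * (inverse x)\<^sup>2)) (\<lambda>x. h x - d * inverse x)"
  proof (rule ode_sol_expI)
    fix x assume x: "x \<in> D"
    show "((\<lambda>x. h x - d * inverse x) has_field_derivative
        of_real \<bar>\<mu>\<bar> * (inverse x * (M x - c) + d * (inverse x)\<^sup>2) - of_real \<mu> * (h x - d * inverse x)) (at x)"
      using D_nonzero[OF x]
      by (rule_tac derivative_eq_intros h[OF x] refl | simp add: \<mu> dc[symmetric] power2_eq_square algebra_simps)+
    have "norm (h x - d * inverse x) \<le> norm (h x) + norm d * norm (inverse x)"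
      using norm_triangle_ineq4[of "h x" "d * inverse x"] by (simp add: norm_mult)
    also have "\<dots> \<le> B + norm d * 1"
      using B[OF x] D_inverse_le1[OF x] by (intro add_mono mult_left_mono) auto
    finally show "norm (h x - d * inverse x) \<le> B + norm d * 1" .
  qed (use \<mu> in auto)
  have le: "norm (inverse x * (M x - c) + d * (inverse x)\<^sup>2) \<le> (C + norm d) / norm x ^ 2" if x: "x \<in> D" for x
  proof -
    have "norm (inverse x * (M x - c) + d * (inverse x)\<^sup>2) \<le> norm (inverse x) * norm (M x - c) + norm d * norm (inverse x) ^ 2"
      using norm_triangle_ineq[of "inverse x * (M x - c)" "d * (inverse x)\<^sup>2"] by (simp only: norm_mult norm_power)
    also have "\<dots> \<le> norm (inverse x) * (C / norm x) + norm d * norm (inverse x) ^ 2"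
      by (intro add_mono mult_left_mono C x) auto
    finally show ?thesis by (simp add: norm_inverse divide_inverse power2_eq_square algebra_simps)
  qed
  have "norm (h x - d * inverse x) \<le> (s + 2) * q ^ 2 * (C + norm d) / norm x ^ 2" if "x \<in> D" for x
    by (rule ode_sol_exp_bound[OF sol _ le that]) (use \<mu> in auto)
  then show ?thesis unfolding d_def[symmetric] by (rule lead_scaledI)
qed

lemma Ia0_eq:
  obtains g where "ode_sol 0 (\<lambda>x. rhsY (Ia 0) x / x\<^sup>2) g" "\<And>x. x \<in> D \<Longrightarrow> Y (Ia 0) x = x * g x"
  using Y_sol[of "Ia 0"] by (auto simp: Sol_def init_def simp del: rhs.simps)

text \<open>Both products in the source tend to \<open>th\<close> and cancel, so the source is
  O(1/x), the slow solution g is O(x^(-2)), and \<open>Y (Ia 0)\<close>, which is x g, still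
  decays.\<close>

lemma lead_a0: "lead (Y (Ia 0)) 0"
proof -
  obtain g where g: "ode_sol 0 (\<lambda>x. rhsY (Ia 0) x / x\<^sup>2) g" and Yg: "\<And>x. x \<in> D \<Longrightarrow> Y (Ia 0) x = x * g x"
    by (rule Ia0_eq) blast
  have "lead (rhsY (Ia 0)) (ka * (th * 1 - th * 1))"
    unfolding rhs.simps by (intro lead_mult lead_diff lead_const lead_IB lead_F0 lead_G0 lead_IA)
  then have "lead (rhsY (Ia 0)) 0" by simp
  then obtain C where C: "\<And>x. x \<in> D \<Longrightarrow> norm (rhsY (Ia 0) x - 0) \<le> C / norm x" by (rule leadE) blast
  then have k: "norm (rhsY (Ia 0) x) \<le> C / norm x ^ 1" if "x \<in> D" for x
    using that unfolding diff_0_right power_one_right by blast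
  have "norm (g x - 0 * inverse x) \<le> (s + 2) * q ^ (1 + 2) * C / norm x ^ 2" if "x \<in> D" for x
    using ode_sol_slow_bound[OF g k that] by (simp only: mult_zero_left diff_0_right one_add_one)
  then have "lead (\<lambda>x. x * g x) 0" by (rule lead_scaledI)
  then show ?thesis by (rule lead_cong) (rule Yg)
qed

lemma lead_u_mult': "asy 0 h \<Longrightarrow> lead (\<lambda>x. c * (inverse x * h x)) 0"
  using lead_u_mult[of h c] by (simp only: mult.assoc)

text \<open>After the cancellation behind \<open>lead_a0\<close> the terms of order 1/x decide. The
  source tends to - 2 th ka / x, and integrating - 2 th ka x^(-3) gives th ka x^(-2), the term of f0
  displayed in the theorem.\<close>

lemma lead_a0_scaled: "lead (\<lambda>x. x * Y (Ia 0) x) (th * ka)"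
proof -
  note K = coeffs Kf_intros
  \<comment> \<open>In this combination the terms without a factor 1/x reassemble into the
    combination itself, so \<open>lead_second_order\<close> applies with \<mu> = - 1; the
    combination of \<open>Iga 0\<close> and \<open>Iph 0\<close> below is its counterpart with \<mu>
    = 1.\<close>
  have bA: "lead (\<lambda>x. x * (Y IB x - th * Y IA x)) (of_real (-1) * ((1 - th - ta) * th + 2 * (0 * (1 + 0)) - 0))"
  proof (rule lead_second_order)
    let ?M = "\<lambda>x. (1 - th - ta) * Y IB x + 2 * (Y (Ia 0) x * VW x) - th * (inverse x * rhsY IA x)"
    have r: "asy 0 (rhsY IA)" unfolding rhs.simps by (intro asy_rules asy_0s K)
    show "((\<lambda>x. Y IB x - th * Y IA x) has_field_derivative inverse x * ?M x - of_real (-1) * (Y IB x - th * Y IA x)) (at x)"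
      if x: "x \<in> D" for x
      using Y_deriv[OF x, of IB] Y_deriv[OF x, of IA] D_nonzero[OF x]
      by (auto intro!: derivative_eq_intros simp: field_simps power2_eq_square)
    show "lead (\<lambda>x. Y IB x - th * Y IA x) 0"
      using lead_diff[OF lead_IB lead_mult[OF lead_const[of th] lead_IA]] by simp
    have "lead VW (1 + 0)" unfolding vW_def by (intro lead_add lead_IA lead_u)
    then show "lead ?M ((1 - th - ta) * th + 2 * (0 * (1 + 0)) - 0)"
      by (intro lead_diff lead_add lead_u_mult' r lead_mult[OF lead_const] lead_mult[OF lead_a0] lead_IB)
  qed simp
  have cF: "lead (\<lambda>x. x * (Y (Iga 0) x - th * Y (Iph 0) x)) (of_real 1 * ((1 + th + ta) * th - 2 * (0 * (0 + 1)) - 0))"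
  proof (rule lead_second_order)
    let ?M = "\<lambda>x. (1 + th + ta) * Y (Iga 0) x - 2 * (Y (Ia 0) x * (VG 0 x + Y (Iph 0) x)) - th * (inverse x * rhsY (Iph 0) x)"
    have r: "asy 0 (rhsY (Iph 0))" unfolding rhs.simps by (intro asy_rules asy_0s K)
    show "((\<lambda>x. Y (Iga 0) x - th * Y (Iph 0) x) has_field_derivative
        inverse x * ?M x - of_real 1 * (Y (Iga 0) x - th * Y (Iph 0) x)) (at x)"
      if x: "x \<in> D" for x
      using Y_deriv[OF x, of "Iga 0"] Y_deriv[OF x, of "Iph 0"] D_nonzero[OF x]
      by (auto intro!: derivative_eq_intros simp: vg_def field_simps power2_eq_square)
    show "lead (\<lambda>x. Y (Iga 0) x - th * Y (Iph 0) x) 0"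
      using lead_diff[OF lead_G0 lead_mult[OF lead_const[of th] lead_F0]] by simp
    show "lead ?M ((1 + th + ta) * th - 2 * (0 * (0 + 1)) - 0)"
      by (intro lead_diff lead_add[OF lead_VG0 lead_F0] lead_u_mult' r lead_mult[OF lead_const] lead_mult[OF lead_a0] lead_G0)
  qed simp
  \<comment> \<open>The mixed products of \<open>IA\<close> and \<open>Iph 0\<close> cancel, so this
    is x times the source of \<open>Ia 0\<close>.\<close>
  have "lead (\<lambda>x. ka * ((x * (Y IB x - th * Y IA x)) * Y (Iph 0) x - (x * (Y (Iga 0) x - th * Y (Iph 0) x)) * Y IA x))
     (ka * ((of_real (-1) * ((1 - th - ta) * th + 2 * (0 * (1 + 0)) - 0)) * 1 - (of_real 1 * ((1 + th + ta) * th - 2 * (0 * (0 + 1)) - 0)) * 1))"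
    by (intro lead_mult[OF lead_const] lead_diff lead_mult[OF bA lead_F0] lead_mult[OF cF lead_IA])
  then have "lead (\<lambda>x. ka * ((x * (Y IB x - th * Y IA x)) * Y (Iph 0) x - (x * (Y (Iga 0) x - th * Y (Iph 0) x)) * Y IA x))
     (- 2 * th * ka)"
    by (rule lead_eq) (simp add: algebra_simps)
  then have "lead (\<lambda>x. x * rhsY (Ia 0) x) (- 2 * th * ka)"
    by (rule lead_cong) (simp add: algebra_simps)
  then obtain C where C: "\<And>x. x \<in> D \<Longrightarrow> norm (x * rhsY (Ia 0) x - (- 2 * th * ka)) \<le> C / norm x" by (rule leadE) blast
  have k: "norm (rhsY (Ia 0) x + 2 * th * ka * inverse x) \<le> C / norm x ^ 2" if x: "x \<in> D" for x
  proof -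
    have "rhsY (Ia 0) x + 2 * th * ka * inverse x = (x * rhsY (Ia 0) x - (- 2 * th * ka)) / x"
      using D_nonzero[OF x] by (simp add: field_simps)
    then have "norm (rhsY (Ia 0) x + 2 * th * ka * inverse x) = norm (x * rhsY (Ia 0) x - (- 2 * th * ka)) / norm x"
      by (simp only: norm_divide)
    also have "\<dots> \<le> (C / norm x) / norm x" by (intro divide_right_mono C x) auto
    finally show ?thesis by (simp add: power2_eq_square)
  qed
  obtain g where g: "ode_sol 0 (\<lambda>x. rhsY (Ia 0) x / x\<^sup>2) g" and Yg: "\<And>x. x \<in> D \<Longrightarrow> Y (Ia 0) x = x * g x"
    by (rule Ia0_eq) blast
  have "ode_sol 0 (\<lambda>x. - (2 * th * ka * inverse x) / x\<^sup>2) (\<lambda>x. th * ka * (inverse x)\<^sup>2)"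
  proof (rule ode_sol_slowI)
    fix x assume x: "x \<in> D"
    show "((\<lambda>x. th * ka * (inverse x)\<^sup>2) has_field_derivative - (2 * th * ka * inverse x) / x\<^sup>2) (at x)"
      using D_nonzero[OF x] by (auto intro!: derivative_eq_intros simp: field_simps power2_eq_square)
    have "norm (th * ka * (inverse x)\<^sup>2) = norm (th * ka) * norm (inverse x) * norm (inverse x)"
      by (simp add: norm_mult power2_eq_square)
    also have "\<dots> \<le> norm (th * ka) * 1 * norm (inverse x)"
      by (intro mult_right_mono mult_left_mono D_inverse_le1 x) auto
    finally show "norm (th * ka * (inverse x)\<^sup>2) \<le> norm (th * ka) / norm x"
      by (simp only: mult_1_right norm_inverse divide_inverse)
  qed
  from ode_sol_diff[OF g this]
  have "ode_sol 0 (\<lambda>x. (rhsY (Ia 0) x + 2 * th * ka * inverse x) / x\<^sup>2) (\<lambda>x. g x - th * ka * (inverse x)\<^sup>2)"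
    by (simp only: diff_divide_distrib[symmetric] diff_minus_eq_add)
  from ode_sol_slow_bound[OF this k]
  have le: "norm (g x - th * ka * (inverse x)\<^sup>2) \<le> (s + 2) * q ^ 4 * C / norm x ^ 3" if "x \<in> D" for x
    using that by simp
  have "norm (Y (Ia 0) x - th * ka * inverse x) \<le> (s + 2) * q ^ 4 * C / norm x ^ 2" if x: "x \<in> D" for x
  proof -
    have "Y (Ia 0) x - th * ka * inverse x = x * (g x - th * ka * (inverse x)\<^sup>2)"
      using D_nonzero[OF x] by (simp add: Yg[OF x] field_simps power2_eq_square)
    then have "norm (Y (Ia 0) x - th * ka * inverse x) = norm x * norm (g x - th * ka * (inverse x)\<^sup>2)"
      by (simp add: norm_mult)
    also have "\<dots> \<le> norm x * ((s + 2) * q ^ 4 * C / norm x ^ 3)"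
      by (intro mult_left_mono le x) auto
    finally show ?thesis using D_nonzero[OF x] by (simp add: power2_eq_square power3_eq_cube)
  qed
  then show ?thesis by (rule lead_scaledI)
qed

end

section \<open>Power series in the exponential\<close>

context system_sol
begin

text \<open>Here and in the next lemmas the equations take the unscaled form of coefficients of w^n:
  the last term \<open>of_nat n * (x + sg - 2)\<close> is the contribution of the derivative of
  w^n.\<close>

lemma VA_deriv:
  assumes x: "x \<in> D"
  shows "(VA n has_field_derivative
    (- VA n x + ka * (inverse x * Y IB x * Y (Iph n) x - VG n x * Y IA x) / x
      + x * (if n = 0 then 0 else CQ (n - 1) x) - of_nat n * (x + sg - 2) * VA n x) / x) (at x)"
proof (cases n)
  case 0
  show ?thesis using Y_deriv[OF x, of "Ia 0"] D_nonzero[OF x] unfolding 0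
    by (auto simp: va_def vg_def intro!: derivative_eq_intros) (simp add: field_simps power2_eq_square)
next
  case (Suc m)
  have V: "VA n = Y (Ia n)" "VG n = Y (Iga n)" by (auto simp: va_def vg_def Suc)
  obtain k where k: "of_nat (Suc m) = (k :: complex)" by blast
  then have k0: "k \<noteq> 0" by (auto simp del: of_nat_Suc)
  show ?thesis
    by (rule DERIV_cong[OF Y_deriv[OF x, of "Ia n", folded V]])
      (use D_nonzero[OF x] k0 in \<open>simp add: Suc k va_def vg_def field_simps power2_eq_square del: of_nat_Suc\<close>)
qed

lemma VF_deriv:
  assumes x: "x \<in> D"
  shows "(Y (Iph n) has_field_derivative
    (- ta * VG n x + 2 * x * CG n x - of_nat n * (x + sg - 2) * Y (Iph n) x) / x) (at x)"
proof (cases n)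
  case 0
  show ?thesis
    by (rule DERIV_cong[OF Y_deriv[OF x]])
      (use D_nonzero[OF x] in \<open>simp add: 0 va_def vg_def cG_def field_simps power2_eq_square\<close>)
next
  case (Suc m)
  obtain k where k: "of_nat (Suc m) = (k :: complex)" by blast
  then have k0: "k \<noteq> 0" by (auto simp del: of_nat_Suc)
  show ?thesis
    by (rule DERIV_cong[OF Y_deriv[OF x]])
      (use D_nonzero[OF x] k0 in \<open>simp add: Suc k field_simps power2_eq_square del: of_nat_Suc\<close>)
qed

lemma VQ_deriv:
  assumes x: "x \<in> D"
  shows "(Y (Iq n) has_field_derivative
    (- th * VP n x + 2 * x * CP n x + 2 * ka * VA (Suc n) x * VW x / x - of_nat n * (x + sg - 2) * Y (Iq n) x) / x) (at x)"
proof (cases n)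
  case 0
  show ?thesis
    by (rule DERIV_cong[OF Y_deriv[OF x]])
      (use D_nonzero[OF x] in \<open>simp add: 0 va_def vp_def cP_def field_simps power2_eq_square\<close>)
next
  case (Suc m)
  obtain k where k: "of_nat (Suc m) = (k :: complex)" by blast
  then have k0: "k \<noteq> 0" by (auto simp del: of_nat_Suc)
  show ?thesis
    by (rule DERIV_cong[OF Y_deriv[OF x]])
      (use D_nonzero[OF x] k0 in \<open>simp add: Suc k va_def[of _ _ "Suc (Suc m)"] field_simps power2_eq_square del: of_nat_Suc\<close>)
qed

lemma VG_deriv:
  assumes x: "x \<in> D"
  shows "(VG n has_field_derivative
    (- x * VG n x + (th + ta) * VG n x + th * Y (Iph n) x - 2 * x * CG n x - of_nat n * (x + sg - 2) * VG n x) / x) (at x)"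
proof (cases n)
  case 0
  show ?thesis using Y_deriv[OF x, of "Iga 0"] D_nonzero[OF x] unfolding 0
    by (auto simp: va_def vg_def cG_def intro!: derivative_eq_intros) (simp add: field_simps power2_eq_square)
next
  case (Suc m)
  have V: "VG n = Y (Iga n)" by (auto simp: vg_def Suc)
  obtain k where k: "of_nat (Suc (Suc m)) = (k :: complex)" by blast
  then have k0: "k \<noteq> 0" by (auto simp del: of_nat_Suc)
  have k1: "of_nat (Suc m) = k - 1" using k by simp
  show ?thesis
    by (rule DERIV_cong[OF Y_deriv[OF x, of "Iga n", folded V]])
      (use D_nonzero[OF x] k0 in \<open>simp add: Suc k k1 vg_def field_simps power2_eq_square del: of_nat_Suc\<close>)
qed

lemma VP_deriv:
  assumes x: "x \<in> D"
  shows "(VP n has_field_derivative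
    (- x * VP n x - sg * VP n x + ta * Y (Iq n) x - 2 * x * CP n x - 2 * ka * VA (Suc n) x * VW x / x
      - of_nat n * (x + sg - 2) * VP n x) / x) (at x)"
proof (cases n)
  case 0
  show ?thesis using Y_deriv[OF x, of "Ip 0"] D_nonzero[OF x] unfolding 0
    by (auto simp: va_def vp_def cP_def intro!: derivative_eq_intros) (simp add: field_simps power2_eq_square)
next
  case (Suc m)
  have V: "VP n = Y (Ip n)" by (auto simp: vp_def Suc)
  obtain k where k: "of_nat (Suc (Suc m)) = (k :: complex)" by blast
  then have k0: "k \<noteq> 0" by (auto simp del: of_nat_Suc)
  have k1: "of_nat (Suc m) = k - 1" using k by simp
  show ?thesis
    by (rule DERIV_cong[OF Y_deriv[OF x, of "Ip n", folded V]])
      (use D_nonzero[OF x] k0 in \<open>simp add: Suc k k1 va_def[of _ _ "Suc (Suc m)"] vp_def field_simps power2_eq_square del: of_nat_Suc\<close>)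
qed

lemma A_deriv:
  assumes x: "x \<in> D"
  shows "(Y IA has_field_derivative (ta * (inverse x * Y IB x) - 2 * x * VA 0 x * VW x) / x) (at x)"
  by (rule DERIV_cong[OF Y_deriv[OF x]])
    (use D_nonzero[OF x] in \<open>simp add: va_def field_simps power2_eq_square\<close>)

lemma B_deriv:
  assumes x: "x \<in> D"
  shows "((\<lambda>x. inverse x * Y IB x) has_field_derivative
    (x * (inverse x * Y IB x) - (th + ta) * (inverse x * Y IB x) - th * Y IA x + 2 * x * VA 0 x * VW x) / x) (at x)"
  using Y_deriv[OF x, of IB] D_nonzero[OF x]
  by (auto simp: va_def intro!: derivative_eq_intros) (simp add: field_simps power2_eq_square)

end

text \<open>The total derivative is formed termwise under a summable majorant. Bounds for
  \<open>dh\<close> come from Cauchy's inequality on discs of radius r around nearby points; the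
  derivative in w costs a factor n + 1, harmless against the geometric decay t^n.\<close>

lemma parametric_power_series_derivative:
  fixes h dh :: "nat \<Rightarrow> complex \<Rightarrow> complex"
  assumes D: "open D" "x0 \<in> D"
    and dh: "\<And>n x. x \<in> D \<Longrightarrow> (h n has_field_derivative dh n x) (at x)"
    and bd: "\<And>n x. x \<in> D \<Longrightarrow> norm (h n x) \<le> C * \<rho> ^ n"
    and \<rho>: "0 < \<rho>" "norm w0 * \<rho> < 1"
  shows "\<exists>p q. ((\<lambda>(x, w). \<Sum>n. h n x * w ^ n) has_derivative (\<lambda>(u, v). p * u + q * v)) (at (x0, w0)) \<and>
    (\<lambda>n. dh n x0 * w0 ^ n) sums p \<and> (\<lambda>n. of_nat n * h n x0 * w0 ^ (n - 1)) sums q"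
proof -
  obtain r where r: "0 < r" "cball x0 (2 * r) \<subseteq> D"
    using D by (metis open_contains_cball half_gt_zero_iff field_sum_of_halves mult_2)
  \<comment> \<open>The midpoint between |w0| and the guaranteed radius of convergence: the disc of
    radius W contains w0 inside and still has W \<rho> < 1.\<close>
  define W where "W = (norm w0 + 1 / \<rho>) / 2"
  have "norm w0 < W" "W * \<rho> < 1"
    using \<rho> by (auto simp: W_def field_simps)
  then have W: "0 < W" "norm w0 < W" "W * \<rho> < 1" using norm_ge_zero[of w0] by linarith+
  define t where "t = W * \<rho>"
  have t: "0 < t" "t < 1" using W \<rho> by (auto simp: t_def)
  have "norm (h 0 x0) \<le> C" using bd[OF D(2), of 0] by simp
  then have C: "0 \<le> C" using norm_ge_zero order_trans by blast
  have dh_bd: "norm (dh n x) \<le> C * \<rho> ^ n / r" if "x \<in> ball x0 r" for n x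
  proof -
    have sub: "cball x r \<subseteq> D"
    proof
      fix y assume "y \<in> cball x r"
      then have "dist x0 y \<le> 2 * r" using that dist_triangle[of x0 y x] by simp
      then show "y \<in> D" using r(2) by auto
    qed
    have hol: "h n holomorphic_on D" using dh holomorphic_on_open[OF D(1)] by blast
    have "norm ((deriv ^^ 1) (h n) x) \<le> fact 1 * (C * \<rho> ^ n) / r ^ 1"
    proof (rule Cauchy_inequality)
      show "h n holomorphic_on ball x r" by (rule holomorphic_on_subset[OF hol subset_trans[OF ball_subset_cball sub]])
      show "continuous_on (cball x r) (h n)" by (rule continuous_on_subset[OF holomorphic_on_imp_continuous_on[OF hol] sub])
      show "norm (h n y) \<le> C * \<rho> ^ n" if "norm (x - y) = r" for y
        using sub that by (intro bd) (auto simp: dist_norm)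
    qed (rule r)
    moreover have "x \<in> D" using sub r by auto
    then have "deriv (h n) x = dh n x" using dh DERIV_imp_deriv by blast
    ultimately show ?thesis by simp
  qed
  define S where "S = ball x0 r \<times> ball (0::complex) W"
  have S: "convex S" "open S" "(x0, w0) \<in> S" using r W by (auto simp: S_def convex_Times open_Times)
  define f where "f n y = (case y of (x, w) \<Rightarrow> h n x * w ^ n)" for n and y :: "complex \<times> complex"
  define f' where "f' n y k = (case y of (x, w) \<Rightarrow> case k of (u, v) \<Rightarrow>
      dh n x * w ^ n * u + of_nat n * h n x * w ^ (n - 1) * v)" for n and y k :: "complex \<times> complex"
  define M where "M n = (C / r + C / W) * (real (Suc n) * t ^ n)" for n
  have xD: "x \<in> D" if "x \<in> ball x0 r" for x using that r by (auto intro!: subsetD[OF r(2)])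
  have M: "summable M"
    unfolding M_def using geometric_deriv_sums[of t] t by (intro summable_mult) (auto simp: sums_iff)
  have f'_bd: "norm (f' n y k) \<le> M n * norm k" if y: "y \<in> S" for n y k
  proof -
    obtain x w where yx: "y = (x, w)" "x \<in> ball x0 r" "norm w \<le> W" using y by (cases y) (auto simp: S_def)
    obtain u v where k: "k = (u, v)" by (cases k)
    have "norm (dh n x * w ^ n) \<le> (C * \<rho> ^ n / r) * W ^ n"
      unfolding norm_mult norm_power using yx dh_bd[OF yx(2)] C \<rho> r by (intro mult_mono power_mono) auto
    also have "\<dots> = C / r * t ^ n" by (simp add: t_def power_mult_distrib)
    finally have 1: "norm (dh n x * w ^ n) \<le> C / r * (real (Suc n) * t ^ n)"
      using mult_right_mono[of 1 "real (Suc n)" "t ^ n"] t C r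
      by (smt (verit) divide_nonneg_pos mult_left_mono of_nat_Suc of_nat_0_le_iff zero_le_power)
    have "norm (of_nat n * h n x * w ^ (n - 1)) \<le> C / W * (real (Suc n) * t ^ n)"
    proof (cases n)
      case 0 then show ?thesis using C W t by simp
    next
      case (Suc m)
      have "norm (of_nat n * h n x * w ^ (n - 1)) \<le> real n * (C * \<rho> ^ n) * W ^ m"
        unfolding norm_mult norm_power norm_of_nat Suc diff_Suc_1 using yx bd[OF xD[OF yx(2)], of "Suc m"] C \<rho>
        by (intro mult_mono power_mono) (auto simp del: power_Suc)
      also have "\<dots> = C / W * (real n * t ^ n)" using W by (simp add: Suc t_def power_mult_distrib)
      also have "\<dots> \<le> C / W * (real (Suc n) * t ^ n)"
        using C W t by (intro mult_left_mono mult_right_mono) auto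
      finally show ?thesis .
    qed
    note 2 = this
    have "norm (f' n y k) \<le> norm (dh n x * w ^ n) * norm u + norm (of_nat n * h n x * w ^ (n - 1)) * norm v"
      unfolding f'_def yx k prod.case norm_mult[symmetric] by (rule norm_triangle_ineq)
    also have "\<dots> \<le> C / r * (real (Suc n) * t ^ n) * norm k + C / W * (real (Suc n) * t ^ n) * norm k"
      using 1 2 norm_fst_le[of u v] norm_snd_le[of v u] order_trans[OF norm_ge_zero 1] order_trans[OF norm_ge_zero 2]
      by (intro add_mono mult_mono) (auto simp: k)
    finally show ?thesis by (simp add: M_def algebra_simps)
  qed
  have f'_sum: "summable (\<lambda>n. f' n y k)" if "y \<in> S" for y k
    by (rule summable_comparison_test'[where N = 0, OF summable_mult2[OF M, of "norm k"]]) (use f'_bd[OF that] in auto)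
  define g' where "g' y k = (\<Sum>n. f' n y k)" for y k
  have "\<exists>g. \<forall>y\<in>S. (\<lambda>n. f n y) sums g y \<and> (g has_derivative g' y) (at y within S)"
  proof (rule has_derivative_series[OF S(1) _ _ S(3)])
    show "(f n has_derivative f' n y) (at y within S)" if y: "y \<in> S" for n y
    proof -
      obtain x w where yx: "y = (x, w)" "x \<in> ball x0 r" using y by (cases y) (auto simp: S_def)
      have "(h n has_derivative (\<lambda>u. dh n x * u)) (at x)"
        using dh[OF xD[OF yx(2)]] by (simp add: has_field_derivative_def)
      then have "((\<lambda>y. h n (fst y)) has_derivative (\<lambda>k. dh n x * fst k)) (at y)"
        by (intro has_derivative_compose[of fst fst y UNIV "h n"] has_derivative_fst has_derivative_ident) (auto simp: yx)
      then have "((\<lambda>y. h n (fst y) * snd y ^ n) has_derivative f' n y) (at y)"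
        by (auto simp: f'_def yx algebra_simps intro!: derivative_eq_intros)
      moreover have "f n = (\<lambda>y. h n (fst y) * snd y ^ n)" by (auto simp: f_def)
      ultimately show ?thesis by (simp add: has_derivative_at_withinI)
    qed
    show "\<forall>\<^sub>F n in sequentially. \<forall>y\<in>S. \<forall>k. norm ((\<Sum>i<n. f' i y k) - g' y k) \<le> e * norm k" if e: "0 < e" for e
    proof -
      obtain N where N: "\<And>n. n \<ge> N \<Longrightarrow> norm (\<Sum>i. M (i + n)) < e"
        using suminf_exist_split[OF e M] by blast
      have "norm ((\<Sum>i<n. f' i y k) - g' y k) \<le> e * norm k" if "n \<ge> N" "y \<in> S" for n y k
      proof -
        have "(\<Sum>i<n. f' i y k) - g' y k = - (\<Sum>i. f' (i + n) y k)"
          unfolding g'_def using suminf_minus_initial_segment[OF f'_sum[OF that(2), of k], of n] by simp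
        then have "norm ((\<Sum>i<n. f' i y k) - g' y k) = norm (\<Sum>i. f' (i + n) y k)" by simp
        also have "\<dots> \<le> (\<Sum>i. M (i + n) * norm k)"
          using f'_bd[OF that(2)] summable_ignore_initial_segment[OF M, of n]
          by (intro norm_suminf_le summable_mult2) auto
        also have "\<dots> = (\<Sum>i. M (i + n)) * norm k"
          using summable_ignore_initial_segment[OF M, of n] by (rule suminf_mult2[symmetric])
        also have "\<dots> \<le> e * norm k" using N[OF that(1)] by (intro mult_right_mono) auto
        finally show ?thesis .
      qed
      then show ?thesis unfolding eventually_sequentially by blast
    qed
    show "(\<lambda>n. f n (x0, w0)) sums (\<Sum>n. f n (x0, w0))"
    proof (rule summable_sums, rule summable_comparison_test'[where N = 0])
      show "summable (\<lambda>n. C * t ^ n)" using t by (intro summable_mult summable_geometric) auto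
      have "norm (h n x0 * w0 ^ n) \<le> (C * \<rho> ^ n) * W ^ n" for n
        unfolding norm_mult norm_power using bd[OF D(2)] W C \<rho> by (intro mult_mono power_mono) auto
      then show "norm (f n (x0, w0)) \<le> C * t ^ n" for n by (simp add: f_def t_def power_mult_distrib mult_ac)
    qed
  qed
  then obtain g where g: "\<And>y. y \<in> S \<Longrightarrow> (\<lambda>n. f n y) sums g y" "\<And>y. y \<in> S \<Longrightarrow> (g has_derivative g' y) (at y within S)"
    by blast
  have "(g has_derivative g' (x0, w0)) (at (x0, w0))"
    using g(2)[OF S(3)] at_within_open[OF S(3,2)] by simp
  then have deriv: "((\<lambda>(x, w). \<Sum>n. h n x * w ^ n) has_derivative g' (x0, w0)) (at (x0, w0))"
    by (rule has_derivative_transform_within_open[OF _ S(2,3)])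
      (use g(1) in \<open>auto simp: f_def sums_iff split: prod.splits\<close>)
  define p q where "p = g' (x0, w0) (1, 0)" and "q = g' (x0, w0) (0, 1)"
  have p: "(\<lambda>n. dh n x0 * w0 ^ n) sums p"
    using f'_sum[OF S(3), of "(1, 0)"] by (simp add: p_def g'_def f'_def sums_iff)
  have q: "(\<lambda>n. of_nat n * h n x0 * w0 ^ (n - 1)) sums q"
    using f'_sum[OF S(3), of "(0, 1)"] by (simp add: q_def g'_def f'_def sums_iff)
  have g': "g' (x0, w0) = (\<lambda>(u, v). p * u + q * v)"
  proof (rule ext, clarify)
    fix u v :: complex
    have "(\<lambda>n. dh n x0 * w0 ^ n * u + of_nat n * h n x0 * w0 ^ (n - 1) * v) sums (p * u + q * v)"
      by (intro sums_add sums_mult2 p q)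
    then show "g' (x0, w0) (u, v) = p * u + q * v" by (simp add: g'_def f'_def sums_iff)
  qed
  show ?thesis using deriv[unfolded g'] p q by blast
qed

definition ser :: "(nat \<Rightarrow> complex \<Rightarrow> complex) \<Rightarrow> complex \<Rightarrow> complex \<Rightarrow> complex" where
  "ser h x w = (\<Sum>n. h n x * w ^ n)"

section \<open>The generating series and their differential equations\<close>

locale system_series = system_sol +
  fixes Cb \<rho> :: real
  assumes \<rho>: "0 < \<rho>"
    and Ybd: "\<And>n x. x \<in> D \<Longrightarrow> norm (Y (Ia n) x) \<le> Cb * \<rho> ^ n"
      "\<And>n x. x \<in> D \<Longrightarrow> norm (Y (Iph n) x) \<le> Cb * \<rho> ^ n"
      "\<And>n x. x \<in> D \<Longrightarrow> norm (Y (Iga n) x) \<le> Cb * \<rho> ^ n"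
      "\<And>n x. x \<in> D \<Longrightarrow> norm (Y (Ip n) x) \<le> Cb * \<rho> ^ n"
      "\<And>n x. x \<in> D \<Longrightarrow> norm (Y (Iq n) x) \<le> Cb * \<rho> ^ n"
begin

abbreviation "SA \<equiv> ser VA"
abbreviation "SF \<equiv> ser (\<lambda>n. Y (Iph n))"
abbreviation "SG \<equiv> ser VG"
abbreviation "SP \<equiv> ser VP"
abbreviation "SQ \<equiv> ser (\<lambda>n. Y (Iq n))"
abbreviation "SA1 \<equiv> ser (\<lambda>n. VA (Suc n))"
abbreviation "AA \<equiv> Y IA"
abbreviation "BB \<equiv> \<lambda>x. inverse x * Y IB x"

lemma norm_inverse_mult_le: "x \<in> D \<Longrightarrow> norm y \<le> C \<Longrightarrow> norm (inverse x * y) \<le> C"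
  using mult_mono[OF D_inverse_le1, of x "norm y" C] by (simp add: norm_mult)

lemma bds:
  assumes x: "x \<in> D"
  shows "norm (VA n x) \<le> Cb * \<rho> ^ n" "norm (VG n x) \<le> Cb * \<rho> ^ n" "norm (VP n x) \<le> Cb * \<rho> ^ n"
proof -
  have "norm (inverse x * (inverse x * Y (Ia 0) x)) \<le> Cb * \<rho> ^ 0"
    by (intro norm_inverse_mult_le x Ybd)
  then show "norm (VA n x) \<le> Cb * \<rho> ^ n"
    using Ybd(1)[OF x, of n] by (simp add: va_def power2_eq_square mult.assoc)
  show "norm (VG n x) \<le> Cb * \<rho> ^ n"
    using Ybd(3)[OF x, of n] norm_inverse_mult_le[OF x Ybd(3)[OF x, of 0]] by (simp add: vg_def)
  show "norm (VP n x) \<le> Cb * \<rho> ^ n"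
    using Ybd(4)[OF x, of n] norm_inverse_mult_le[OF x Ybd(4)[OF x, of 0]] by (simp add: vp_def)
qed

lemma abs_summable:
  fixes h :: "nat \<Rightarrow> complex"
  assumes "\<And>n. norm (h n) \<le> C * \<rho> ^ n" "norm w * \<rho> < 1"
  shows "summable (\<lambda>n. norm (h n * w ^ n))"
proof (rule summable_comparison_test'[where N = 0])
  show "summable (\<lambda>n. C * (norm w * \<rho>) ^ n)"
    using assms(2) \<rho> by (intro summable_mult summable_geometric) auto
  show "norm (norm (h n * w ^ n)) \<le> C * (norm w * \<rho>) ^ n" for n
    using mult_right_mono[OF assms(1)[of n], of "norm w ^ n"]
    by (simp add: norm_mult norm_power power_mult_distrib mult_ac)
qed

lemma sums_ser:
  assumes "\<And>n. norm (h n x) \<le> C * \<rho> ^ n" "norm w * \<rho> < 1"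
  shows "(\<lambda>n. h n x * w ^ n) sums ser h x w"
  unfolding ser_def using summable_norm_cancel[OF abs_summable[of "\<lambda>n. h n x", OF assms]] by (rule summable_sums)

lemma sums_product:
  assumes "\<And>n. norm (h n x) \<le> C * \<rho> ^ n" "\<And>n. norm (g n x) \<le> C' * \<rho> ^ n" "norm w * \<rho> < 1"
  shows "(\<lambda>n. (\<Sum>j\<le>n. h j x * g (n - j) x) * w ^ n) sums (ser h x w * ser g x w)"
proof -
  have "(\<lambda>n. \<Sum>j\<le>n. (h j x * w ^ j) * (g (n - j) x * w ^ (n - j))) sums (ser h x w * ser g x w)"
    unfolding ser_def
    by (intro Cauchy_product_sums abs_summable[of "\<lambda>n. h n x", OF assms(1,3)] abs_summable[of "\<lambda>n. g n x", OF assms(2,3)])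
  moreover have "(\<Sum>j\<le>n. (h j x * w ^ j) * (g (n - j) x * w ^ (n - j))) = (\<Sum>j\<le>n. h j x * g (n - j) x) * w ^ n" for n
    unfolding sum_distrib_right
  proof (intro sum.cong refl)
    fix j assume "j \<in> {..n}"
    then have "w ^ n = w ^ j * w ^ (n - j)" by (simp flip: power_add)
    then show "h j x * w ^ j * (g (n - j) x * w ^ (n - j)) = h j x * g (n - j) x * w ^ n" by simp
  qed
  ultimately show ?thesis by simp
qed

text \<open>T is the derivative of the series along the vector field x d/dx + (x + sg - 2) w d/dw,
  which on the curve w = \<open>wv c z\<close> over x = exp z becomes d/dz.\<close>

definition serd :: "(nat \<Rightarrow> complex \<Rightarrow> complex) \<Rightarrow> complex \<Rightarrow> complex \<Rightarrow> complex \<Rightarrow> bool" where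
  "serd h T x w \<longleftrightarrow> (\<exists>p r. ((\<lambda>(x, w). ser h x w) has_derivative (\<lambda>(u, v). p * u + r * v)) (at (x, w)) \<and>
     p * x + r * ((x + sg - 2) * w) = T)"

text \<open>Termwise, the contribution n (x + sg - 2) h_n w^n of the derivative in w cancels the
  last term in the equation of h_n, leaving \<open>RH n x * w ^ n\<close>.\<close>

lemma serdI:
  assumes x: "x \<in> D" and w: "norm w * \<rho> < 1"
    and d: "\<And>n y. y \<in> D \<Longrightarrow> (h n has_field_derivative (RH n y - of_nat n * (y + sg - 2) * h n y) / y) (at y)"
    and bd: "\<And>n y. y \<in> D \<Longrightarrow> norm (h n y) \<le> C * \<rho> ^ n"
    and T: "(\<lambda>n. RH n x * w ^ n) sums T"
  shows "serd h T x w"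
proof -
  obtain p r where pr: "((\<lambda>(x, w). \<Sum>n. h n x * w ^ n) has_derivative (\<lambda>(u, v). p * u + r * v)) (at (x, w))"
    "(\<lambda>n. (RH n x - of_nat n * (x + sg - 2) * h n x) / x * w ^ n) sums p"
    "(\<lambda>n. of_nat n * h n x * w ^ (n - 1)) sums r"
    using parametric_power_series_derivative[OF open_D x d bd \<rho> w] by blast
  have "(\<lambda>n. (RH n x - of_nat n * (x + sg - 2) * h n x) / x * w ^ n * x + of_nat n * h n x * w ^ (n - 1) * ((x + sg - 2) * w))
      sums (p * x + r * ((x + sg - 2) * w))"
    by (intro sums_add sums_mult2 pr)
  moreover have "(RH n x - of_nat n * (x + sg - 2) * h n x) / x * w ^ n * x + of_nat n * h n x * w ^ (n - 1) * ((x + sg - 2) * w)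
      = RH n x * w ^ n" for n
    using D_nonzero[OF x] by (cases n) (simp_all add: field_simps)
  ultimately have "p * x + r * ((x + sg - 2) * w) = T" using T sums_unique2 by fastforce
  then show ?thesis unfolding serd_def ser_def using pr(1) by blast
qed

lemma CG_sums:
  assumes "x \<in> D" "norm w * \<rho> < 1"
  shows "(\<lambda>n. CG n x * w ^ n) sums (SA x w * (SG x w + SF x w))"
proof -
  have "(\<lambda>n. (\<Sum>j\<le>n. VA j x * VG (n - j) x) * w ^ n + (\<Sum>j\<le>n. VA j x * Y (Iph (n - j)) x) * w ^ n)
      sums (SA x w * SG x w + SA x w * SF x w)"
    by (intro sums_add sums_product[where C = Cb and C' = Cb] bds Ybd assms)
  then show ?thesis by (simp add: cG_def distrib_left sum.distrib distrib_right)
qed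

lemma CP_sums:
  assumes "x \<in> D" "norm w * \<rho> < 1"
  shows "(\<lambda>n. CP n x * w ^ n) sums (SA x w * (SP x w + SQ x w))"
proof -
  have "(\<lambda>n. (\<Sum>j\<le>n. VA j x * VP (n - j) x) * w ^ n + (\<Sum>j\<le>n. VA j x * Y (Iq (n - j)) x) * w ^ n)
      sums (SA x w * SP x w + SA x w * SQ x w)"
    by (intro sums_add sums_product[where C = Cb and C' = Cb] bds Ybd assms)
  then show ?thesis by (simp add: cP_def distrib_left sum.distrib distrib_right)
qed

lemma CQ_sums:
  assumes "x \<in> D" "norm w * \<rho> < 1"
  shows "(\<lambda>n. (if n = 0 then 0 else CQ (n - 1) x) * w ^ n) sums (w * (SQ x w * SF x w - SG x w * SP x w))"
proof -
  have "(\<lambda>n. (\<Sum>j\<le>n. Y (Iq j) x * Y (Iph (n - j)) x) * w ^ n - (\<Sum>j\<le>n. VG j x * VP (n - j) x) * w ^ n)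
      sums (SQ x w * SF x w - SG x w * SP x w)"
    by (intro sums_diff sums_product[where C = Cb and C' = Cb] bds Ybd assms)
  then have "(\<lambda>n. CQ n x * w ^ n) sums (SQ x w * SF x w - SG x w * SP x w)"
    by (simp add: cQ_def sum_subtractf left_diff_distrib)
  from sums_mult[OF this, of w]
  have "(\<lambda>n. (if Suc n = 0 then 0 else CQ (Suc n - 1) x) * w ^ Suc n) sums (w * (SQ x w * SF x w - SG x w * SP x w))"
    by (simp add: mult_ac)
  then show ?thesis by (subst (asm) sums_Suc_iff) simp
qed

lemma VA1_bd: "x \<in> D \<Longrightarrow> norm (VA (Suc n) x) \<le> (Cb * \<rho>) * \<rho> ^ n"
  using bds(1)[of x "Suc n"] by (simp add: mult_ac)

text \<open>\<open>SA1\<close> is the difference quotient (SA - VA 0)/w, given by its series so that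
  w = 0 is allowed. It carries the coupling of f+ and g+ to the next mode of f0.\<close>

lemma SA_split:
  assumes "x \<in> D" "norm w * \<rho> < 1"
  shows "SA x w = VA 0 x + w * SA1 x w"
proof -
  have "(\<lambda>n. VA (Suc n) x * w ^ n) sums SA1 x w" by (intro sums_ser[of "\<lambda>n. VA (Suc n)" x "Cb * \<rho>"] VA1_bd assms)
  from sums_mult[OF this, of w] have "(\<lambda>n. VA (Suc n) x * w ^ Suc n) sums (w * SA1 x w)" by (simp add: mult_ac)
  then have "(\<lambda>n. VA n x * w ^ n) sums (w * SA1 x w + VA 0 x)" by (subst (asm) sums_Suc_iff) simp
  moreover have "(\<lambda>n. VA n x * w ^ n) sums SA x w" by (intro sums_ser[where C = Cb] bds assms)
  ultimately show ?thesis using sums_unique2 by fastforce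
qed

text \<open>Cauchy products turn the convolutions into products of series. Together with the
  equations of \<open>AA\<close> and \<open>BB\<close>, these are the closed equations from which
  (S) is verified.\<close>

lemma serd_all:
  assumes x: "x \<in> D" and w: "norm w * \<rho> < 1"
  shows "serd VA (- SA x w + ka * (BB x * SF x w - SG x w * AA x) / x + x * (w * (SQ x w * SF x w - SG x w * SP x w))) x w"
    "serd (\<lambda>n. Y (Iph n)) (- ta * SG x w + 2 * x * (SA x w * (SG x w + SF x w))) x w"
    "serd VG (- x * SG x w + (th + ta) * SG x w + th * SF x w - 2 * x * (SA x w * (SG x w + SF x w))) x w"
    "serd VP (- x * SP x w - sg * SP x w + ta * SQ x w - 2 * x * (SA x w * (SP x w + SQ x w)) - 2 * ka * VW x / x * SA1 x w) x w"
    "serd (\<lambda>n. Y (Iq n)) (- th * SP x w + 2 * x * (SA x w * (SP x w + SQ x w)) + 2 * ka * VW x / x * SA1 x w) x w"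
proof -
  have a: "(\<lambda>n. VA n x * w ^ n) sums SA x w" "(\<lambda>n. VG n x * w ^ n) sums SG x w" "(\<lambda>n. VP n x * w ^ n) sums SP x w"
    by (intro sums_ser[where C = Cb] bds x w)+
  have b: "(\<lambda>n. Y (Iph n) x * w ^ n) sums SF x w" "(\<lambda>n. Y (Iq n) x * w ^ n) sums SQ x w"
    by (intro sums_ser[of "\<lambda>n. Y (Iph n)" x Cb] sums_ser[of "\<lambda>n. Y (Iq n)" x Cb] Ybd x w)+
  have c: "(\<lambda>n. VA (Suc n) x * w ^ n) sums SA1 x w"
    by (intro sums_ser[of "\<lambda>n. VA (Suc n)" x "Cb * \<rho>"] VA1_bd x w)
  show "serd VA (- SA x w + ka * (BB x * SF x w - SG x w * AA x) / x + x * (w * (SQ x w * SF x w - SG x w * SP x w))) x w"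
  proof (rule serdI[OF x w VA_deriv bds(1)])
    have "(\<lambda>n. - (VA n x * w ^ n) + ka * (BB x * (Y (Iph n) x * w ^ n) - VG n x * w ^ n * AA x) / x
        + x * ((if n = 0 then 0 else CQ (n - 1) x) * w ^ n)) sums
      (- SA x w + ka * (BB x * SF x w - SG x w * AA x) / x + x * (w * (SQ x w * SF x w - SG x w * SP x w)))"
      by (intro sums_add sums_minus sums_divide sums_mult sums_diff sums_mult2 a b CQ_sums x w)
    then show "(\<lambda>n. (- VA n x + ka * (inverse x * Y IB x * Y (Iph n) x - VG n x * Y IA x) / x
      + x * (if n = 0 then 0 else CQ (n - 1) x)) * w ^ n) sums
      (- SA x w + ka * (BB x * SF x w - SG x w * AA x) / x + x * (w * (SQ x w * SF x w - SG x w * SP x w)))"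
      by (rule sums_cong[THEN iffD1, rotated]) (simp add: algebra_simps add_divide_distrib diff_divide_distrib)
  qed
  show "serd (\<lambda>n. Y (Iph n)) (- ta * SG x w + 2 * x * (SA x w * (SG x w + SF x w))) x w"
  proof (rule serdI[OF x w VF_deriv Ybd(2)])
    have "(\<lambda>n. - ta * (VG n x * w ^ n) + 2 * x * (CG n x * w ^ n)) sums (- ta * SG x w + 2 * x * (SA x w * (SG x w + SF x w)))"
      by (intro sums_add sums_mult a CG_sums x w)
    then show "(\<lambda>n. (- ta * VG n x + 2 * x * CG n x) * w ^ n) sums (- ta * SG x w + 2 * x * (SA x w * (SG x w + SF x w)))"
      by (rule sums_cong[THEN iffD1, rotated]) (simp add: algebra_simps)
  qed
  show "serd VG (- x * SG x w + (th + ta) * SG x w + th * SF x w - 2 * x * (SA x w * (SG x w + SF x w))) x w"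
  proof (rule serdI[OF x w VG_deriv bds(2)])
    have "(\<lambda>n. - x * (VG n x * w ^ n) + (th + ta) * (VG n x * w ^ n) + th * (Y (Iph n) x * w ^ n) - 2 * x * (CG n x * w ^ n))
      sums (- x * SG x w + (th + ta) * SG x w + th * SF x w - 2 * x * (SA x w * (SG x w + SF x w)))"
      by (intro sums_add sums_diff sums_mult a b CG_sums x w)
    then show "(\<lambda>n. (- x * VG n x + (th + ta) * VG n x + th * Y (Iph n) x - 2 * x * CG n x) * w ^ n)
      sums (- x * SG x w + (th + ta) * SG x w + th * SF x w - 2 * x * (SA x w * (SG x w + SF x w)))"
      by (rule sums_cong[THEN iffD1, rotated]) (simp add: algebra_simps)
  qed
  show "serd VP (- x * SP x w - sg * SP x w + ta * SQ x w - 2 * x * (SA x w * (SP x w + SQ x w)) - 2 * ka * VW x / x * SA1 x w) x w"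
  proof (rule serdI[OF x w VP_deriv bds(3)])
    have "(\<lambda>n. - x * (VP n x * w ^ n) - sg * (VP n x * w ^ n) + ta * (Y (Iq n) x * w ^ n) - 2 * x * (CP n x * w ^ n)
        - 2 * ka * VW x / x * (VA (Suc n) x * w ^ n))
      sums (- x * SP x w - sg * SP x w + ta * SQ x w - 2 * x * (SA x w * (SP x w + SQ x w)) - 2 * ka * VW x / x * SA1 x w)"
      by (intro sums_add sums_diff sums_mult a b c CP_sums x w)
    then show "(\<lambda>n. (- x * VP n x - sg * VP n x + ta * Y (Iq n) x - 2 * x * CP n x - 2 * ka * VA (Suc n) x * VW x / x) * w ^ n)
      sums (- x * SP x w - sg * SP x w + ta * SQ x w - 2 * x * (SA x w * (SP x w + SQ x w)) - 2 * ka * VW x / x * SA1 x w)"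
      by (rule sums_cong[THEN iffD1, rotated]) (simp add: algebra_simps)
  qed
  show "serd (\<lambda>n. Y (Iq n)) (- th * SP x w + 2 * x * (SA x w * (SP x w + SQ x w)) + 2 * ka * VW x / x * SA1 x w) x w"
  proof (rule serdI[OF x w VQ_deriv Ybd(5)])
    have "(\<lambda>n. - th * (VP n x * w ^ n) + 2 * x * (CP n x * w ^ n) + 2 * ka * VW x / x * (VA (Suc n) x * w ^ n))
      sums (- th * SP x w + 2 * x * (SA x w * (SP x w + SQ x w)) + 2 * ka * VW x / x * SA1 x w)"
      by (intro sums_add sums_mult a b c CP_sums x w)
    then show "(\<lambda>n. (- th * VP n x + 2 * x * CP n x + 2 * ka * VA (Suc n) x * VW x / x) * w ^ n)
      sums (- th * SP x w + 2 * x * (SA x w * (SP x w + SQ x w)) + 2 * ka * VW x / x * SA1 x w)"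
      by (rule sums_cong[THEN iffD1, rotated]) (simp add: algebra_simps)
  qed
qed

lemma serd_curve:
  assumes h: "serd h T (exp z) (W z)" and W: "(W has_field_derivative (exp z + sg - 2) * W z) (at z)"
  shows "((\<lambda>z. ser h (exp z) (W z)) has_field_derivative T) (at z)"
proof -
  obtain p r where d: "((\<lambda>(x, w). ser h x w) has_derivative (\<lambda>(u, v). p * u + r * v)) (at (exp z, W z))"
    and T: "p * exp z + r * ((exp z + sg - 2) * W z) = T"
    using h unfolding serd_def by blast
  have "((\<lambda>z. (exp z, W z)) has_derivative (\<lambda>u. (exp z * u, (exp z + sg - 2) * W z * u))) (at z)"
    using W by (intro has_derivative_Pair) (auto simp: has_field_derivative_def[symmetric] intro!: derivative_eq_intros)
  from has_derivative_compose[OF this d]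
  have "((\<lambda>z. ser h (exp z) (W z)) has_derivative (\<lambda>u. p * (exp z * u) + r * ((exp z + sg - 2) * W z * u))) (at z)"
    by simp
  moreover have "(\<lambda>u. p * (exp z * u) + r * ((exp z + sg - 2) * W z * u)) = (\<lambda>u. T * u)"
    by (simp add: T[symmetric] algebra_simps)
  ultimately show ?thesis by (simp add: has_field_derivative_def)
qed

end

section \<open>Complex differentiability in two parameters and z\<close>

definition cdiff2 :: "((complex \<times> complex) \<times> complex \<Rightarrow> complex) \<Rightarrow> (complex \<times> complex) \<times> complex \<Rightarrow> bool" where
  "cdiff2 f P \<longleftrightarrow> (\<exists>p q r. (f has_derivative (\<lambda>((u, v), w). p * u + q * v + r * w)) (at P))"

lemma cdiff2_const: "cdiff2 (\<lambda>_. c) P"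
  unfolding cdiff2_def by (rule exI[of _ 0], rule exI[of _ 0], rule exI[of _ 0]) (simp add: case_prod_unfold)

lemma cdiff2_proj: "cdiff2 (\<lambda>y. fst (fst y)) P" "cdiff2 (\<lambda>y. snd (fst y)) P" "cdiff2 snd P"
proof -
  have "((\<lambda>y. fst (fst y)) has_derivative (\<lambda>((u, v), w). 1 * u + 0 * v + 0 * w)) (at P)"
    by (simp add: case_prod_unfold) (intro has_derivative_fst has_derivative_ident)
  then show "cdiff2 (\<lambda>y. fst (fst y)) P" unfolding cdiff2_def by blast
  have "((\<lambda>y. snd (fst y)) has_derivative (\<lambda>((u, v), w). 0 * u + 1 * v + 0 * w)) (at P)"
    by (simp add: case_prod_unfold) (intro has_derivative_fst has_derivative_snd has_derivative_ident)
  then show "cdiff2 (\<lambda>y. snd (fst y)) P" unfolding cdiff2_def by blast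
  have "(snd has_derivative (\<lambda>((u, v), w). 0 * u + 0 * v + 1 * w)) (at P)"
    using has_derivative_snd[OF has_derivative_ident, of "at P"] by (simp add: case_prod_unfold)
  then show "cdiff2 snd P" unfolding cdiff2_def by blast
qed

lemma cdiff2_joint:
  assumes H: "((\<lambda>(x, w). H x w) has_derivative (\<lambda>(u, v). a * u + b * v)) (at (f P, g P))" and f: "cdiff2 f P" and g: "cdiff2 g P"
  shows "cdiff2 (\<lambda>y. H (f y) (g y)) P"
proof -
  obtain p q r where f': "(f has_derivative (\<lambda>((u, v), w). p * u + q * v + r * w)) (at P)" using f cdiff2_def by blast
  obtain p' q' r' where g': "(g has_derivative (\<lambda>((u, v), w). p' * u + q' * v + r' * w)) (at P)" using g cdiff2_def by blast
  from has_derivative_compose[OF has_derivative_Pair[OF f' g'] H]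
  have "((\<lambda>y. H (f y) (g y)) has_derivative
      (\<lambda>((u, v), w). (a * p + b * p') * u + (a * q + b * q') * v + (a * r + b * r') * w)) (at P)"
    by (simp add: case_prod_unfold algebra_simps)
  then show ?thesis unfolding cdiff2_def by blast
qed

lemma cdiff2_add: "cdiff2 f P \<Longrightarrow> cdiff2 g P \<Longrightarrow> cdiff2 (\<lambda>y. f y + g y) P"
  by (rule cdiff2_joint[of "(+)" 1 1]) (auto simp: case_prod_unfold intro!: derivative_eq_intros)

lemma cdiff2_diff: "cdiff2 f P \<Longrightarrow> cdiff2 g P \<Longrightarrow> cdiff2 (\<lambda>y. f y - g y) P"
  by (rule cdiff2_joint[of "(-)" 1 "-1"]) (auto simp: case_prod_unfold intro!: derivative_eq_intros)

lemma cdiff2_mult: "cdiff2 f P \<Longrightarrow> cdiff2 g P \<Longrightarrow> cdiff2 (\<lambda>y. f y * g y) P"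
  by (rule cdiff2_joint[of "(*)" "g P" "f P"]) (auto simp: case_prod_unfold algebra_simps intro!: derivative_eq_intros)

lemma cdiff2_compose:
  assumes "(H has_field_derivative d) (at (f P))" "cdiff2 f P"
  shows "cdiff2 (\<lambda>y. H (f y)) P"
proof (rule cdiff2_joint[OF _ assms(2) cdiff2_const])
  have "((\<lambda>y. H (fst y)) has_derivative (\<lambda>y. d * fst y)) (at (f P, 0))"
    by (rule has_derivative_compose[of fst fst _ _ H]) (use assms(1) in \<open>auto simp: has_field_derivative_def intro!: derivative_eq_intros\<close>)
  then show "((\<lambda>(x, w). H x) has_derivative (\<lambda>(u, v). d * u + 0 * v)) (at (f P, 0))"
    by (simp add: case_prod_unfold)
qed

lemma holo2I:
  assumes "\<And>c0 cx z. (c0, cx) \<in> B \<Longrightarrow> z \<in> U \<Longrightarrow> cdiff2 (\<lambda>y. h (fst y) (snd y)) ((c0, cx), z)"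
  shows "holo2 B U h"
  using assms unfolding holo2_def cdiff2_def by (auto simp: case_prod_unfold)

text \<open>The one-parameter family is the slice cx = 0 of the two-parameter formulas: the chain
  rule is applied to the embedding of (c, z) as ((c, 0), z).\<close>

lemma holo1I:
  assumes "\<And>c z. c \<in> B \<Longrightarrow> z \<in> U \<Longrightarrow> cdiff2 (\<lambda>y. h (fst y) (snd y)) ((c, 0), z)"
  shows "holo1 B U (\<lambda>c. h (c, 0))"
  unfolding holo1_def
proof (intro ballI)
  fix c z assume "c \<in> B" "z \<in> U"
  then obtain p q r where d: "((\<lambda>y. h (fst y) (snd y)) has_derivative (\<lambda>((u, v), w). p * u + q * v + r * w)) (at ((c, 0), z))"
    using assms unfolding cdiff2_def by blast
  have lift: "((\<lambda>y. ((fst y, 0), snd y)) has_derivative (\<lambda>k. ((fst k, 0), snd k))) (at (c, z))"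
    by (intro has_derivative_Pair has_derivative_fst has_derivative_snd has_derivative_ident has_derivative_const)
  have "((\<lambda>y. h (fst y) (snd y)) has_derivative (\<lambda>((u, v), w). p * u + q * v + r * w)) (at ((fst (c, z), 0), snd (c, z)))"
    using d by simp
  from has_derivative_compose[OF lift this]
  have "((\<lambda>(c, z). h (c, 0) z) has_derivative (\<lambda>(u, w). p * u + r * w)) (at (c, z))"
    by (simp add: case_prod_unfold)
  then show "\<exists>p q. ((\<lambda>(c, z). h (c, 0) z) has_derivative (\<lambda>(u, w). p * u + q * w)) (at (c, z))" by blast
qed

section \<open>The system (S) in coordinates of trace-free matrices\<close>

lemma sl2_mat_nth:
  "sl2_mat a b c $ 1 $ 1 = a" "sl2_mat a b c $ 1 $ 2 = b" "sl2_mat a b c $ 2 $ 1 = c" "sl2_mat a b c $ 2 $ 2 = - a"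
  by (simp_all add: sl2_mat_def J_mat_def Delta_plus_def Delta_minus_def)

lemma mcomm_sl2_mat:
  "mcomm (sl2_mat a b c) (sl2_mat a' b' c') = sl2_mat (b * c' - c * b') (2 * (a * b' - b * a')) (2 * (c * a' - a * c'))"
  by (simp add: vec_eq_iff forall_2 mcomm_def matrix_matrix_mult_def sum_2 sl2_mat_nth algebra_simps)

lemma J_mat_eq: "J_mat = sl2_mat 1 0 0"
  by (simp add: vec_eq_iff forall_2 sl2_mat_nth) (simp add: J_mat_def)

lemma solves_S_sl2I:
  assumes "\<And>z. z \<in> U \<Longrightarrow> (f0 has_field_derivative gp z * fm z - gm z * fp z) (at z)"
    "\<And>z. z \<in> U \<Longrightarrow> (fp has_field_derivative 2 * (g0 z * fp z - gp z * f0 z)) (at z)"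
    "\<And>z. z \<in> U \<Longrightarrow> (fm has_field_derivative 2 * (gm z * f0 z - g0 z * fm z)) (at z)"
    "\<And>z. z \<in> U \<Longrightarrow> (g0 has_field_derivative fp z * gm z - fm z * gp z) (at z)"
    "\<And>z. z \<in> U \<Longrightarrow> (gp has_field_derivative 2 * (f0 z * gp z - fp z * g0 z) + exp z * gp z) (at z)"
    "\<And>z. z \<in> U \<Longrightarrow> (gm has_field_derivative 2 * (fm z * g0 z - f0 z * gm z) - exp z * gm z) (at z)"
  shows "solves_S (\<lambda>z. sl2_mat (f0 z) (fp z) (fm z)) (\<lambda>z. sl2_mat (g0 z) (gp z) (gm z)) U"
  unfolding solves_S_def J_mat_eq mcomm_sl2_mat forall_2 sl2_mat_nth
proof (intro ballI conjI)
  fix z assume z: "z \<in> U"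
  note d = assms[OF z]
  show "((\<lambda>w. - f0 w) has_field_derivative - (gp z * fm z - gm z * fp z)) (at z)"
    using d(1) by (rule DERIV_minus)
  show "((\<lambda>w. - g0 w) has_field_derivative - (fp z * gm z - fm z * gp z) + exp z / 2 * - (0 * gm z - 0 * gp z)) (at z)"
    using DERIV_minus[OF d(4)] by simp
qed (use assms in \<open>simp_all add: algebra_simps\<close>)

section \<open>The solution of the isomonodromy system\<close>

lemma has_field_derivative_xpow: "((\<lambda>z. xpow z a) has_field_derivative a * xpow z a) (at z)"
  unfolding xpow_def by (auto intro!: derivative_eq_intros)

lemma has_field_derivative_expx: "(expx has_field_derivative exp z * expx z) (at z)"
  unfolding expx_def by (auto intro!: derivative_eq_intros)

lemma xpow_add: "xpow z a * xpow z b = xpow z (a + b)"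
  by (simp add: xpow_def exp_add[symmetric] distrib_right)

lemma xpow_0 [simp]: "xpow z 0 = 1"
  by (simp add: xpow_def)

lemma xpow_minus_nat: "xpow z (- of_nat n) = inverse (exp z) ^ n"
  by (simp add: xpow_def exp_minus exp_of_nat_mult[symmetric] power_inverse)

lemma xpow_minus_nat_mult: "xpow z (- of_nat n) * exp z ^ n = 1"
  by (simp add: xpow_minus_nat power_inverse)

text \<open>The coefficient functions depend on X alone, so the coefficients of their expansions are
  constants in c. The conditions on \<open>Kf\<close> place these constants in both rings of
  functions of the parameters.\<close>

locale solution = system_series +
  fixes t0 tinf :: complex
  assumes ta: "ta = th + tinf" and sg: "sg = - 2 * th - tinf"
    and ka: "ka = (t0 - th - tinf) / 2 * ((t0 + th + tinf) / 2)"
    and Kf1: "\<And>k. k \<in> Kf \<Longrightarrow> (\<lambda>_. k) \<in> rat_ring {\<lambda>_. t0, \<lambda>_. th, \<lambda>_. tinf, \<lambda>c0. c0, \<lambda>c0. inverse c0}"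
    and Kf2: "\<And>k. k \<in> Kf \<Longrightarrow> (\<lambda>_. k) \<in> rat_ring {\<lambda>_. t0, \<lambda>_. th, \<lambda>_. tinf,
        \<lambda>(c0, cx). c0, \<lambda>(c0, cx). inverse c0, \<lambda>(c0, cx). cx}"
begin

definition gmi :: "complex \<times> complex \<Rightarrow> complex" where "gmi c = inverse (fst c) / 2 * (t0 + th + tinf)"
definition gpl :: "complex \<times> complex \<Rightarrow> complex" where "gpl c = fst c / 2 * (t0 - th - tinf)"
definition gxp :: "complex \<times> complex \<Rightarrow> complex" where "gxp c = snd c * th"
definition EE :: "complex \<Rightarrow> complex" where "EE z = expx z * xpow z (sg - 1)"
definition wv :: "complex \<times> complex \<Rightarrow> complex \<Rightarrow> complex" where "wv c z = gmi c * gxp c * EE z * inverse (exp z)"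

definition F0 where "F0 c z = - ta / 2 + exp z * SA (exp z) (wv c z)"
definition Fm where "Fm c z = xpow z (- th) * (gmi c * SF (exp z) (wv c z))"
definition Gm where "Gm c z = xpow z (- th) * (gmi c * SG (exp z) (wv c z))"
definition Fp where "Fp c z = xpow z th * (gpl c * AA (exp z) + gxp c * exp z * EE z * SP (exp z) (wv c z))"
definition Gp where "Gp c z = xpow z th * (gpl c * BB (exp z) + gxp c * exp z * EE z * SQ (exp z) (wv c z))"
definition G0 where "G0 c z = - tinf / 2 - F0 c z"

definition good :: "complex \<times> complex \<Rightarrow> complex \<Rightarrow> bool" where
  "good c z \<longleftrightarrow> fst c \<noteq> 0 \<and> exp z \<in> D \<and> norm (wv c z) * \<rho> < 1"

lemma EE_deriv: "(EE has_field_derivative (exp z + sg - 1) * EE z) (at z)"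
  unfolding EE_def
  by (rule derivative_eq_intros has_field_derivative_expx has_field_derivative_xpow refl)+ (simp add: algebra_simps)

lemma wv_deriv: "(wv c has_field_derivative (exp z + sg - 2) * wv c z) (at z)"
  unfolding wv_def
  by (rule derivative_eq_intros EE_deriv refl | simp)+ (simp add: field_simps power2_eq_square)

text \<open>After all derivatives are inserted, each equation is a polynomial identity modulo X w =
  m xx E, \<open>ka = pl * m\<close>, a = v0 + w a1 and X v = A + B. The equation of g+ is where the
  relation \<open>sg = - th - ta\<close> is used.\<close>

lemma solution_derivs:
  assumes g: "good c z"
  shows "(F0 c has_field_derivative Gp c z * Fm c z - Gm c z * Fp c z) (at z)"
    "(Fp c has_field_derivative 2 * (G0 c z * Fp c z - Gp c z * F0 c z)) (at z)"
    "(Fm c has_field_derivative 2 * (Gm c z * F0 c z - G0 c z * Fm c z)) (at z)"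
    "(G0 c has_field_derivative Fp c z * Gm c z - Fm c z * Gp c z) (at z)"
    "(Gp c has_field_derivative 2 * (F0 c z * Gp c z - Fp c z * G0 c z) + exp z * Gp c z) (at z)"
    "(Gm c has_field_derivative 2 * (Fm c z * G0 c z - F0 c z * Gm c z) - exp z * Gm c z) (at z)"
proof -
  define X where "X = exp z"
  define w where "w = wv c z"
  have XD: "X \<in> D" and wr: "norm w * \<rho> < 1" and c0: "fst c \<noteq> 0" using g by (auto simp: good_def X_def w_def)
  have X0: "X \<noteq> 0" by (simp add: X_def)
  note S = serd_all[OF XD wr]
  note cv = serd_curve[OF _ wv_deriv, of _ _ z c, folded X_def w_def]
  have dA: "((\<lambda>z. AA (exp z)) has_field_derivative ta * BB X - 2 * X * VA 0 X * VW X) (at z)"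
    using DERIV_chain2[OF A_deriv[OF XD, unfolded X_def] DERIV_exp, folded X_def] X0 by simp
  have dB: "((\<lambda>z. BB (exp z)) has_field_derivative X * BB X - (th + ta) * BB X - th * AA X + 2 * X * VA 0 X * VW X) (at z)"
    using DERIV_chain2[OF B_deriv[OF XD, unfolded X_def] DERIV_exp, folded X_def] X0 by simp
  define a f sgm p r a1 A B v0 E y ym m pl xx v where "a = SA X w" and "f = SF X w" and "sgm = SG X w" and "p = SP X w" and "r = SQ X w"
    and "a1 = SA1 X w" and "A = AA X" and "B = BB X" and "v0 = VA 0 X" and "E = EE z" and "y = xpow z th"
    and "ym = xpow z (- th)" and "m = gmi c" and "pl = gpl c" and "xx = gxp c" and "v = VW X / X"
  note defs = a_def f_def sgm_def p_def r_def a1_def A_def B_def v0_def E_def y_def ym_def m_def pl_def xx_def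
  have W: "VW X = A + B" by (simp add: vW_def A_def B_def)
  have vX: "X * v = A + B" using X0 by (simp add: v_def W)
  have yy: "y * ym = 1" by (simp add: y_def ym_def xpow_add)
  have Xw: "X * w = m * xx * E" using X0 by (simp add: w_def wv_def X_def defs)
  have kk: "ka = pl * m" using c0 by (simp add: ka pl_def m_def gpl_def gmi_def)
  have aa: "a = v0 + w * a1" unfolding defs by (rule SA_split[OF XD wr])
  have d0: "((\<lambda>z. SA (exp z) (wv c z)) has_field_derivative - a + ka * (B * f - sgm * A) / X + X * (w * (r * f - sgm * p))) (at z)"
    unfolding defs by (rule cv[OF S(1)])
  have df: "((\<lambda>z. SF (exp z) (wv c z)) has_field_derivative - ta * sgm + 2 * X * (a * (sgm + f))) (at z)"
    unfolding defs by (rule cv[OF S(2)])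
  have dg: "((\<lambda>z. SG (exp z) (wv c z)) has_field_derivative - X * sgm + (th + ta) * sgm + th * f - 2 * X * (a * (sgm + f))) (at z)"
    unfolding defs by (rule cv[OF S(3)])
  have dp: "((\<lambda>z. SP (exp z) (wv c z)) has_field_derivative - X * p - sg * p + ta * r - 2 * X * (a * (p + r)) - 2 * ka * v * a1) (at z)"
    using cv[OF S(4)] by (simp add: defs v_def)
  have dq: "((\<lambda>z. SQ (exp z) (wv c z)) has_field_derivative - th * p + 2 * X * (a * (p + r)) + 2 * ka * v * a1) (at z)"
    using cv[OF S(5)] by (simp add: defs v_def)
  have F0z: "F0 c z = - ta / 2 + X * a" and Fmz: "Fm c z = ym * (m * f)" and Gmz: "Gm c z = ym * (m * sgm)"
    and Fpz: "Fp c z = y * (pl * A + xx * X * E * p)" and Gpz: "Gp c z = y * (pl * B + xx * X * E * r)"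
    by (simp_all add: F0_def Fm_def Gm_def Fp_def Gp_def defs X_def w_def)
  have "G0 c z = - tinf / 2 - (- ta / 2 + X * a)" unfolding G0_def F0z ..
  also have "\<dots> = th / 2 - X * a" by (simp add: ta field_simps)
  finally have G0z: "G0 c z = th / 2 - X * a" .
  have sg': "sg = - th - ta" by (simp add: sg ta)
  show D0: "(F0 c has_field_derivative Gp c z * Fm c z - Gm c z * Fp c z) (at z)"
  proof -
    have "(F0 c has_field_derivative X * a + X * (- a + ka * (B * f - sgm * A) / X + X * (w * (r * f - sgm * p)))) (at z)"
      unfolding F0_def by (rule derivative_eq_intros d0 refl | simp)+ (simp add: X_def a_def w_def mult.commute)
    moreover have "X * a + X * (- a + ka * (B * f - sgm * A) / X + X * (w * (r * f - sgm * p)))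
        = ka * (B * f - sgm * A) + X * (X * w) * (r * f - sgm * p)"
      using X0 by (simp add: field_simps)
    moreover have "\<dots> = (y * ym) * (pl * m * (B * f - sgm * A) + X * (m * xx * E) * (r * f - sgm * p))"
      by (simp add: yy Xw kk)
    moreover have "\<dots> = Gp c z * Fm c z - Gm c z * Fp c z"
      by (simp add: Gpz Fmz Gmz Fpz algebra_simps)
    ultimately show ?thesis by simp
  qed
  show "(G0 c has_field_derivative Fp c z * Gm c z - Fm c z * Gp c z) (at z)"
    unfolding G0_def using D0 by (auto intro!: derivative_eq_intros)
  show "(Fm c has_field_derivative 2 * (Gm c z * F0 c z - G0 c z * Fm c z)) (at z)"
  proof -
    have "(Fm c has_field_derivative - th * ym * (m * f) + m * (- ta * sgm + 2 * X * (a * (sgm + f))) * ym) (at z)"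
      unfolding Fm_def by (rule derivative_eq_intros has_field_derivative_xpow df refl)+ (simp add: defs X_def w_def)
    moreover have "- th * ym * (m * f) + m * (- ta * sgm + 2 * X * (a * (sgm + f))) * ym = 2 * (Gm c z * F0 c z - G0 c z * Fm c z)"
      by (simp add: F0z Fmz Gmz G0z field_simps)
    ultimately show ?thesis by simp
  qed
  show "(Gm c has_field_derivative 2 * (Fm c z * G0 c z - F0 c z * Gm c z) - exp z * Gm c z) (at z)"
  proof -
    have "(Gm c has_field_derivative - th * ym * (m * sgm) + m * (- X * sgm + (th + ta) * sgm + th * f - 2 * X * (a * (sgm + f))) * ym) (at z)"
      unfolding Gm_def by (rule derivative_eq_intros has_field_derivative_xpow dg refl)+ (simp add: defs X_def w_def)
    moreover have "- th * ym * (m * sgm) + m * (- X * sgm + (th + ta) * sgm + th * f - 2 * X * (a * (sgm + f))) * ym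
        = 2 * (Fm c z * G0 c z - F0 c z * Gm c z) - X * Gm c z"
      by (simp add: F0z Fmz Gmz G0z field_simps)
    ultimately show ?thesis by (simp add: X_def)
  qed
  show "(Fp c has_field_derivative 2 * (G0 c z * Fp c z - Gp c z * F0 c z)) (at z)"
  proof -
    define T where "T = - X * p - sg * p + ta * r - 2 * X * (a * (p + r)) - 2 * ka * v * a1"
    define dAz where "dAz = ta * B - 2 * X * v0 * (A + B)"
    have dA': "((\<lambda>z. AA (exp z)) has_field_derivative dAz) (at z)" using dA by (simp add: dAz_def defs W[unfolded defs])
    have deriv: "(Fp c has_field_derivative th * y * (pl * A + xx * X * E * p)
        + (pl * dAz + (xx * X * E * (X + sg) * p + xx * X * E * T)) * y) (at z)"
      unfolding Fp_def T_def
      by (rule derivative_eq_intros has_field_derivative_xpow dA' EE_deriv dp refl)+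
        (simp add: defs X_def w_def algebra_simps)
    have inner: "th * (pl * A + xx * X * E * p) + (pl * dAz + (xx * X * E * (X + sg) * p + xx * X * E * T))
        = (th - 2 * X * a) * (pl * A + xx * X * E * p) + (ta - 2 * X * a) * (pl * B + xx * X * E * r)"
      unfolding T_def dAz_def using vX Xw kk aa by algebra
    have "th * y * (pl * A + xx * X * E * p) + (pl * dAz + (xx * X * E * (X + sg) * p + xx * X * E * T)) * y
        = y * (th * (pl * A + xx * X * E * p) + (pl * dAz + (xx * X * E * (X + sg) * p + xx * X * E * T)))"
      by (simp add: algebra_simps)
    also note inner
    also have "y * ((th - 2 * X * a) * (pl * A + xx * X * E * p) + (ta - 2 * X * a) * (pl * B + xx * X * E * r))
        = 2 * (G0 c z * Fp c z - Gp c z * F0 c z)"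
      by (simp add: F0z Fpz Gpz G0z field_simps)
    finally show ?thesis using deriv by (simp add: X_def)
  qed
  show "(Gp c has_field_derivative 2 * (F0 c z * Gp c z - Fp c z * G0 c z) + exp z * Gp c z) (at z)"
  proof -
    define T where "T = - th * p + 2 * X * (a * (p + r)) + 2 * ka * v * a1"
    define dBz where "dBz = X * B - (th + ta) * B - th * A + 2 * X * v0 * (A + B)"
    have dB': "((\<lambda>z. BB (exp z)) has_field_derivative dBz) (at z)" using dB by (simp add: dBz_def defs W[unfolded defs])
    have deriv: "(Gp c has_field_derivative th * y * (pl * B + xx * X * E * r)
        + (pl * dBz + (xx * X * E * (X + sg) * r + xx * X * E * T)) * y) (at z)"
      unfolding Gp_def T_def
      by (rule derivative_eq_intros has_field_derivative_xpow dB' EE_deriv dq refl)+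
        (simp add: defs X_def w_def algebra_simps)
    have inner: "th * (pl * B + xx * X * E * r) + (pl * dBz + (xx * X * E * (X + sg) * r + xx * X * E * T))
        = (2 * X * a - ta) * (pl * B + xx * X * E * r) - (th - 2 * X * a) * (pl * A + xx * X * E * p) + X * (pl * B + xx * X * E * r)"
      unfolding T_def dBz_def using vX Xw kk aa sg' by algebra
    have "th * y * (pl * B + xx * X * E * r) + (pl * dBz + (xx * X * E * (X + sg) * r + xx * X * E * T)) * y
        = y * (th * (pl * B + xx * X * E * r) + (pl * dBz + (xx * X * E * (X + sg) * r + xx * X * E * T)))"
      by (simp add: algebra_simps)
    also note inner
    also have "y * ((2 * X * a - ta) * (pl * B + xx * X * E * r) - (th - 2 * X * a) * (pl * A + xx * X * E * p) + X * (pl * B + xx * X * E * r))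
        = 2 * (F0 c z * Gp c z - Fp c z * G0 c z) + X * Gp c z"
      by (simp add: F0z Fpz Gpz G0z field_simps)
    finally show ?thesis using deriv by (simp add: X_def)
  qed
qed

lemma solution_solves:
  assumes "\<And>z. z \<in> U \<Longrightarrow> good c z"
  shows "solves_S (\<lambda>z. sl2_mat (F0 c z) (Fp c z) (Fm c z)) (\<lambda>z. sl2_mat (G0 c z) (Gp c z) (Gm c z)) U"
  using solution_derivs[OF assms] by (intro solves_S_sl2I)

end

section \<open>Joint holomorphy of the entries\<close>

context solution
begin

lemma cdiff2_gmi: "fst (fst P) \<noteq> 0 \<Longrightarrow> cdiff2 (\<lambda>y. gmi (fst y)) P"
  unfolding gmi_def divide_inverse
  by (intro cdiff2_mult cdiff2_const cdiff2_compose[of inverse] cdiff2_proj) (rule DERIV_inverse, simp)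

lemma cdiff2_gpl: "cdiff2 (\<lambda>y. gpl (fst y)) P"
  unfolding gpl_def divide_inverse by (intro cdiff2_mult cdiff2_const cdiff2_proj)

lemma cdiff2_gxp: "cdiff2 (\<lambda>y. gxp (fst y)) P"
  unfolding gxp_def by (intro cdiff2_mult cdiff2_const cdiff2_proj)

lemma cdiff2_exp: "cdiff2 (\<lambda>y. exp (snd y)) P"
  by (rule cdiff2_compose[OF DERIV_exp cdiff2_proj(3)])

lemma cdiff2_xpow: "cdiff2 (\<lambda>y. xpow (snd y) a) P"
  by (rule cdiff2_compose[OF has_field_derivative_xpow cdiff2_proj(3)])

lemma cdiff2_EE: "cdiff2 (\<lambda>y. EE (snd y)) P"
  by (rule cdiff2_compose[OF EE_deriv cdiff2_proj(3)])

lemma cdiff2_exp_comp: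
  assumes "h holomorphic_on D" "exp (snd P) \<in> D"
  shows "cdiff2 (\<lambda>y. h (exp (snd y))) P"
  by (rule cdiff2_compose[OF _ cdiff2_exp]) (rule holomorphic_derivI[OF assms(1) open_D assms(2)])

lemma cdiff2_wv:
  assumes "fst (fst P) \<noteq> 0"
  shows "cdiff2 (\<lambda>y. wv (fst y) (snd y)) P"
  unfolding wv_def
  by (intro cdiff2_mult cdiff2_gmi cdiff2_gxp cdiff2_EE cdiff2_compose[of inverse] cdiff2_exp assms) (rule DERIV_inverse, simp)

lemma cdiff2_ser:
  assumes "serd h T (exp (snd P)) (wv (fst P) (snd P))" "fst (fst P) \<noteq> 0"
  shows "cdiff2 (\<lambda>y. ser h (exp (snd y)) (wv (fst y) (snd y))) P"
proof -
  obtain p r where "((\<lambda>(x, w). ser h x w) has_derivative (\<lambda>(u, v). p * u + r * v)) (at (exp (snd P), wv (fst P) (snd P)))"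
    using assms(1) unfolding serd_def by blast
  from cdiff2_joint[OF this cdiff2_exp cdiff2_wv[OF assms(2)]] show ?thesis .
qed

lemma Y_holomorphic: "Y i holomorphic_on D"
  using Y_deriv holomorphic_on_open[OF open_D] by blast

lemma solution_cdiff2:
  assumes "good c z"
  shows "cdiff2 (\<lambda>y. F0 (fst y) (snd y)) (c, z)" "cdiff2 (\<lambda>y. Fp (fst y) (snd y)) (c, z)"
    "cdiff2 (\<lambda>y. Fm (fst y) (snd y)) (c, z)" "cdiff2 (\<lambda>y. G0 (fst y) (snd y)) (c, z)"
    "cdiff2 (\<lambda>y. Gp (fst y) (snd y)) (c, z)" "cdiff2 (\<lambda>y. Gm (fst y) (snd y)) (c, z)"
proof -
  have g: "fst (fst (c, z)) \<noteq> 0" "exp (snd (c, z)) \<in> D" "norm (wv (fst (c, z)) (snd (c, z))) * \<rho> < 1"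
    using assms by (auto simp: good_def)
  note S = cdiff2_ser[OF serd_all(1)[OF g(2,3)] g(1)] cdiff2_ser[OF serd_all(2)[OF g(2,3)] g(1)]
    cdiff2_ser[OF serd_all(3)[OF g(2,3)] g(1)] cdiff2_ser[OF serd_all(4)[OF g(2,3)] g(1)]
    cdiff2_ser[OF serd_all(5)[OF g(2,3)] g(1)]
  have A: "cdiff2 (\<lambda>y. AA (exp (snd y))) (c, z)" by (rule cdiff2_exp_comp[OF Y_holomorphic g(2)])
  have "BB holomorphic_on D" using D_nonzero by (intro holomorphic_intros Y_holomorphic) auto
  then have B: "cdiff2 (\<lambda>y. BB (exp (snd y))) (c, z)" using g(2) by (rule cdiff2_exp_comp)
  show F: "cdiff2 (\<lambda>y. F0 (fst y) (snd y)) (c, z)"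
    unfolding F0_def by (intro cdiff2_add cdiff2_mult cdiff2_const cdiff2_exp S)
  show "cdiff2 (\<lambda>y. G0 (fst y) (snd y)) (c, z)"
    unfolding G0_def by (intro cdiff2_diff cdiff2_const F)
  show "cdiff2 (\<lambda>y. Fp (fst y) (snd y)) (c, z)"
    unfolding Fp_def by (intro cdiff2_add cdiff2_mult cdiff2_xpow cdiff2_gpl cdiff2_gxp cdiff2_EE cdiff2_exp S A)
  show "cdiff2 (\<lambda>y. Gp (fst y) (snd y)) (c, z)"
    unfolding Gp_def by (intro cdiff2_add cdiff2_mult cdiff2_xpow cdiff2_gpl cdiff2_gxp cdiff2_EE cdiff2_exp S B)
  show "cdiff2 (\<lambda>y. Fm (fst y) (snd y)) (c, z)"
    unfolding Fm_def by (intro cdiff2_mult cdiff2_xpow cdiff2_gmi S) (use g in simp)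
  show "cdiff2 (\<lambda>y. Gm (fst y) (snd y)) (c, z)"
    unfolding Gm_def by (intro cdiff2_mult cdiff2_xpow cdiff2_gmi S) (use g in simp)
qed

lemma solution_holo2:
  assumes "\<And>c z. c \<in> B \<Longrightarrow> z \<in> U \<Longrightarrow> good c z"
  shows "\<forall>h\<in>{F0, Fp, Fm, G0, Gp, Gm}. holo2 B U h"
  using solution_cdiff2[OF assms] by (auto intro!: holo2I)

lemma solution_holo1:
  assumes "\<And>c z. c \<in> B \<Longrightarrow> z \<in> U \<Longrightarrow> good (c, 0) z"
  shows "\<forall>h\<in>{F0, Fp, Fm, G0, Gp, Gm}. holo1 B U (\<lambda>c. h (c, 0))"
  using solution_cdiff2[OF assms] by (auto intro!: holo1I)

section \<open>Coefficient functions as bracketed powers of x\<close>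

definition asyhol :: "(complex \<Rightarrow> complex) \<Rightarrow> bool" where
  "asyhol h \<longleftrightarrow> h holomorphic_on D \<and> (\<forall>N. asy N h)"

lemma asyhol_Y: "asyhol (Y i)"
  by (simp add: asyhol_def Y_holomorphic Y_asy_all)

lemma asyhol_const: "c \<in> Kf \<Longrightarrow> asyhol (\<lambda>_. c)"
  by (simp add: asyhol_def asy_const)

lemma asyhol_mult: "asyhol h \<Longrightarrow> asyhol g \<Longrightarrow> asyhol (\<lambda>x. h x * g x)"
  by (auto simp: asyhol_def intro!: asy_mult holomorphic_intros)

lemma asyhol_shift: "asyhol h \<Longrightarrow> lead h v \<Longrightarrow> v \<in> Kf \<Longrightarrow> asyhol (\<lambda>x. x * (h x - v))"
  by (auto simp: asyhol_def intro!: asy_shift holomorphic_intros)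

lemma norm_xpow_minus_nat: "norm (xpow z (- of_nat n)) = 1 / norm (exp z) ^ n"
  by (simp only: xpow_minus_nat norm_power norm_inverse) (simp add: power_inverse divide_inverse)

text \<open>Uniformity in c is immediate, as neither h nor its coefficients depend on c; the
  estimate holds on all of D, beyond any threshold for |x|.\<close>

lemma asyhol_unif_asymp:
  assumes h: "asyhol h" and U: "exp ` U \<subseteq> D" and K: "\<And>k. k \<in> Kf \<Longrightarrow> (\<lambda>_. k) \<in> Rg"
  shows "unif_asymp Rg B U k (\<lambda>c z. xpow z (- of_nat k) * h (exp z))"
proof -
  obtain f where f: "\<And>j. f j \<in> Kf"
    "\<And>N. \<exists>C. \<forall>x\<in>D. norm (h x - (\<Sum>j<N. f j * inverse x ^ j)) \<le> C / norm x ^ N"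
    using asy_all_orders[of h] h unfolding asyhol_def by blast
  have "\<exists>C r. \<forall>c\<in>B. \<forall>z\<in>U. norm (exp z) > r \<longrightarrow>
      norm (xpow z (- of_nat k) * h (exp z) - xpow z (- of_nat k) * (\<Sum>j<N. f j * xpow z (- of_nat j))) \<le> C / norm (exp z) ^ (k + N)" for N
  proof -
    obtain C where C: "\<And>x. x \<in> D \<Longrightarrow> norm (h x - (\<Sum>j<N. f j * inverse x ^ j)) \<le> C / norm x ^ N"
      using f(2)[of N] by blast
    have "norm (xpow z (- of_nat k) * h (exp z) - xpow z (- of_nat k) * (\<Sum>j<N. f j * xpow z (- of_nat j))) \<le> C / norm (exp z) ^ (k + N)"
      if "z \<in> U" for z
    proof -
      have zD: "exp z \<in> D" using that U by blast
      have "norm (xpow z (- of_nat k) * (h (exp z) - (\<Sum>j<N. f j * xpow z (- of_nat j)))) \<le> (1 / norm (exp z) ^ k) * (C / norm (exp z) ^ N)"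
        unfolding norm_mult norm_xpow_minus_nat unfolding xpow_minus_nat by (intro mult_left_mono C zD) simp
      then show ?thesis by (simp add: right_diff_distrib power_add)
    qed
    then show ?thesis by blast
  qed
  then show ?thesis unfolding unif_asymp_def using f(1) K by (intro exI[of _ "\<lambda>j _. f j"]) blast
qed

lemma asyhol_cdiff2:
  assumes "asyhol h" "exp z \<in> D"
  shows "cdiff2 (\<lambda>y. xpow (snd y) a * h (exp (snd y))) (c, z)"
  using assms unfolding asyhol_def by (intro cdiff2_mult cdiff2_xpow cdiff2_exp_comp) auto

lemma asyhol_bracket2:
  assumes h: "asyhol h" and U: "exp ` U \<subseteq> D"
  shows "bracket2 t0 th tinf B U k (\<lambda>c z. xpow z (- of_nat k) * h (exp z))"
  unfolding bracket2_def using U by (auto intro!: holo2I asyhol_cdiff2[OF h] asyhol_unif_asymp[OF h U Kf2])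

lemma asyhol_bracket1:
  assumes h: "asyhol h" and U: "exp ` U \<subseteq> D"
  shows "bracket1 t0 th tinf B U k (\<lambda>c z. xpow z (- of_nat k) * h (exp z))"
proof -
  have "holo1 B U (\<lambda>c. (\<lambda>_ z. xpow z (- of_nat k) * h (exp z)) (c, 0))"
    by (rule holo1I) (use U in \<open>auto intro!: asyhol_cdiff2[OF h]\<close>)
  then show ?thesis unfolding bracket1_def using asyhol_unif_asymp[OF h U Kf1] by blast
qed

lemma Kf_params: "th \<in> Kf" "ta \<in> Kf" "ka \<in> Kf" "th * ka \<in> Kf"
  using coeffs by (auto intro: Kf_mult)

text \<open>In h = v + [x^(-1)] the bracket is x^(-1) times this function.\<close>

definition rem :: "(complex \<Rightarrow> complex) \<Rightarrow> complex \<Rightarrow> complex \<Rightarrow> complex" where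
  "rem h v x = x * (h x - v)"

lemma asyhol_rem: "asyhol h \<Longrightarrow> lead h v \<Longrightarrow> v \<in> Kf \<Longrightarrow> asyhol (rem h v)"
  unfolding rem_def[abs_def] by (rule asyhol_shift)

lemma rem_eq: "v + xpow z (- of_nat 1) * rem h v (exp z) = h (exp z)"
  by (simp add: rem_def xpow_def exp_minus flip: mult.assoc)

lemma asyhol_cmult: "c \<in> Kf \<Longrightarrow> asyhol h \<Longrightarrow> asyhol (\<lambda>x. c * h x)"
  by (intro asyhol_mult asyhol_const)

text \<open>Two constants are peeled off \<open>Y (Ia 0)\<close>: its value 0 at infinity and the
  limit \<open>th * ka\<close> of x times it. What remains is the bracket [x^(-3)] of f0.\<close>

lemma asyhol_alpha: "asyhol (rem (rem (Y (Ia 0)) 0) (th * ka))"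
  using asyhol_rem[OF asyhol_rem[OF asyhol_Y lead_a0 Kf_consts(1)], of "th * ka"] lead_a0_scaled Kf_params
  by (simp add: rem_def[abs_def])

lemma VA_0_eq: "exp z * VA 0 (exp z) = th * ka * xpow z (-2) + xpow z (- of_nat 3) * rem (rem (Y (Ia 0)) 0) (th * ka) (exp z)"
proof -
  have "xpow z (-2) = inverse (exp z) ^ 2" using xpow_minus_nat[of z 2] by simp
  then show ?thesis
    unfolding xpow_minus_nat by (simp add: va_def rem_def field_simps power2_eq_square power3_eq_cube)
qed

lemma sums_tail:
  fixes a :: "nat \<Rightarrow> complex"
  assumes "a sums S"
  shows "(\<lambda>n. a (n + 2)) sums (S - a 0 - a 1)"
  using sums_split_initial_segment[OF assms, of 2] by (simp add: numeral_2_eq_2 algebra_simps)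

lemma wv_power: "exp z ^ n * wv c z ^ n = (gmi c * gxp c) ^ n * EE z ^ n"
proof -
  have "exp z * wv c z = gmi c * gxp c * EE z" by (simp add: wv_def)
  then show ?thesis by (simp only: power_mult_distrib[symmetric])
qed

text \<open>A factor X in front of a power of w cancels one inverse power of X. This is the origin
  of the exponents - n + 1 for f0 and - n + 2 for f+ and g-.\<close>

lemma wv_Suc_power:
  "exp z * wv c z ^ Suc m = xpow z (- of_nat m) * ((gmi c * gxp c) ^ Suc m * EE z ^ Suc m)"
proof -
  have "xpow z (- of_nat m) * ((gmi c * gxp c) ^ Suc m * EE z ^ Suc m)
      = (xpow z (- of_nat m) * exp z ^ m) * (exp z * wv c z ^ Suc m)"
    unfolding wv_power[symmetric] by simp
  then show ?thesis by (simp add: xpow_minus_nat_mult)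
qed

lemma wv_power': "wv c z ^ n = xpow z (- of_nat n) * ((gmi c * gxp c) ^ n * EE z ^ n)"
proof -
  have "xpow z (- of_nat n) * ((gmi c * gxp c) ^ n * EE z ^ n) = (xpow z (- of_nat n) * exp z ^ n) * wv c z ^ n"
    unfolding wv_power[symmetric] by simp
  then show ?thesis by (simp add: xpow_minus_nat_mult)
qed

lemma expx_xpow_eq: "expx z * xpow z (sg - 2) = EE z * inverse (exp z)"
proof -
  have "xpow z (sg - 2) = xpow z (sg - 1) * xpow z (- of_nat 1)" by (simp add: xpow_add)
  then show ?thesis unfolding xpow_minus_nat by (simp add: EE_def)
qed

section \<open>The series representations of the two-parameter family\<close>

context
  fixes B :: "(complex \<times> complex) set" and U S :: "complex set"
  assumes good: "\<And>c z. c \<in> B \<Longrightarrow> z \<in> U \<Longrightarrow> good c z" and S: "exp ` S \<subseteq> D"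
begin

abbreviation "br \<equiv> bracket2 t0 th tinf B S"

lemma good_D: "c \<in> B \<Longrightarrow> z \<in> U \<Longrightarrow> exp z \<in> D" "c \<in> B \<Longrightarrow> z \<in> U \<Longrightarrow> norm (wv c z) * \<rho> < 1"
   "c \<in> B \<Longrightarrow> z \<in> U \<Longrightarrow> fst c \<noteq> 0"
  using good by (auto simp: good_def)

text \<open>Mode 0 of the series gives the terms free of exponentials through
  \<open>VA_0_eq\<close>, mode 1 the term linear in E, and the tail starts at mode 2.\<close>

lemma repr_F0:
  "\<exists>a b h. br 3 a \<and> br 1 b \<and> (\<forall>n\<ge>2. br (n - 1) (h n)) \<and>
     (\<forall>c\<in>B. \<forall>z\<in>U. let T = (\<lambda>n. (gmi c * gxp c) ^ n * h n c z * EE z ^ n) in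
        summable (\<lambda>n. T (n + 2)) \<and>
        F0 c z = - (th + tinf) / 2 + th * gpl c * gmi c * xpow z (-2) + a c z
          + gmi c * gxp c * (1 + b c z) * EE z + (\<Sum>n. T (n + 2)))"
proof (intro exI conjI allI impI ballI)
  show "br 3 (\<lambda>c z. xpow z (- of_nat 3) * rem (rem (Y (Ia 0)) 0) (th * ka) (exp z))"
    by (rule asyhol_bracket2[OF asyhol_alpha S])
  show "br 1 (\<lambda>c z. xpow z (- of_nat 1) * rem (Y (Ia 1)) 1 (exp z))"
    using lead_a1 by (intro asyhol_bracket2 asyhol_rem asyhol_Y S Kf_consts) simp
  show "br (n - 1) (\<lambda>c z. xpow z (- of_nat (n - 1)) * Y (Ia n) (exp z))" for n
    by (rule asyhol_bracket2[OF asyhol_Y S])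
  fix c z assume c: "c \<in> B" "z \<in> U"
  note g = good_D[OF c]
  define T where "T = (\<lambda>n. (gmi c * gxp c) ^ n * (xpow z (- of_nat (n - 1)) * Y (Ia n) (exp z)) * EE z ^ n)"
  have "(\<lambda>n. VA n (exp z) * wv c z ^ n) sums SA (exp z) (wv c z)"
    by (intro sums_ser[where C = Cb] bds g)
  from sums_mult[OF sums_tail[OF this], of "exp z"]
  have "(\<lambda>n. exp z * (VA (n + 2) (exp z) * wv c z ^ (n + 2))) sums
      (exp z * (SA (exp z) (wv c z) - VA 0 (exp z) * wv c z ^ 0 - VA 1 (exp z) * wv c z ^ 1))" .
  moreover have "exp z * (VA (n + 2) (exp z) * wv c z ^ (n + 2)) = T (n + 2)" for n
    using wv_Suc_power[of z c "Suc n"] by (simp add: T_def va_def mult_ac)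
  ultimately have T: "(\<lambda>n. T (n + 2)) sums
      (exp z * SA (exp z) (wv c z) - exp z * VA 0 (exp z) - VA 1 (exp z) * (exp z * wv c z))"
    by (simp add: algebra_simps)
  have w: "exp z * wv c z = gmi c * gxp c * EE z" using wv_power[of z 1 c] by simp
  have k: "th * ka = th * gpl c * gmi c" using g(3) by (simp add: ka gpl_def gmi_def)
  have "F0 c z = - (th + tinf) / 2 + th * gpl c * gmi c * xpow z (-2)
      + xpow z (- of_nat 3) * rem (rem (Y (Ia 0)) 0) (th * ka) (exp z)
      + gmi c * gxp c * (1 + xpow z (- of_nat 1) * rem (Y (Ia 1)) 1 (exp z)) * EE z + (\<Sum>n. T (n + 2))"
    unfolding rem_eq sums_unique[OF T, symmetric] k[symmetric] VA_0_eq w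
    by (simp add: F0_def ta[symmetric] va_def)
  then show "let T = (\<lambda>n. (gmi c * gxp c) ^ n * (xpow z (- of_nat (n - 1)) * Y (Ia n) (exp z)) * EE z ^ n) in
      summable (\<lambda>n. T (n + 2)) \<and>
      F0 c z = - (th + tinf) / 2 + th * gpl c * gmi c * xpow z (-2)
        + xpow z (- of_nat 3) * rem (rem (Y (Ia 0)) 0) (th * ka) (exp z)
        + gmi c * gxp c * (1 + xpow z (- of_nat 1) * rem (Y (Ia 1)) 1 (exp z)) * EE z + (\<Sum>n. T (n + 2))"
    unfolding Let_def T_def[symmetric] using sums_summable[OF T] by (simp add: T_def)
qed

text \<open>The series in f+ has the prefactor E, so the summand with index n is mode n - 1. The
  coefficient of mode 1 tends to - 1; the displayed minus sign is therefore taken out and -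
  \<open>Ip 1\<close> is expanded.\<close>

lemma repr_Fp:
  "\<exists>a b d h. br 1 a \<and> br 1 b \<and> br 1 d \<and> (\<forall>n\<ge>3. br (n - 2) (h n)) \<and>
     (\<forall>c\<in>B. \<forall>z\<in>U. let T = (\<lambda>n. gxp c * (gmi c * gxp c) ^ (n - 1) * h n c z * EE z ^ n) in
        summable (\<lambda>n. T (n + 3)) \<and>
        xpow z (- th) * Fp c z = gpl c * (1 + a c z)
          + gxp c * (th + tinf + b c z) * EE z
          - gmi c * (gxp c)\<^sup>2 * (1 + d c z) * (EE z)\<^sup>2 + (\<Sum>n. T (n + 3)))"
proof (intro exI conjI allI impI ballI)
  show "br 1 (\<lambda>c z. xpow z (- of_nat 1) * rem AA 1 (exp z))"
    by (intro asyhol_bracket2 asyhol_rem asyhol_Y S Kf_consts lead_IA)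
  show "br 1 (\<lambda>c z. xpow z (- of_nat 1) * rem (Y (Ip 0)) ta (exp z))"
    by (intro asyhol_bracket2 asyhol_rem asyhol_Y S Kf_params lead_P0)
  have "lead (\<lambda>x. - 1 * Y (Ip 1) x) 1" using lead_mult[OF lead_const[of "-1"] lead_P1] by simp
  then show "br 1 (\<lambda>c z. xpow z (- of_nat 1) * rem (\<lambda>x. - 1 * Y (Ip 1) x) 1 (exp z))"
    by (intro asyhol_bracket2 asyhol_rem asyhol_cmult asyhol_Y S Kf_consts Kf_uminus)
  show "br (n - 2) (\<lambda>c z. xpow z (- of_nat (n - 2)) * Y (Ip (n - 1)) (exp z))" for n
    by (rule asyhol_bracket2[OF asyhol_Y S])
  fix c z assume c: "c \<in> B" "z \<in> U"
  note g = good_D[OF c]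
  define T where "T = (\<lambda>n. gxp c * (gmi c * gxp c) ^ (n - 1) * (xpow z (- of_nat (n - 2)) * Y (Ip (n - 1)) (exp z)) * EE z ^ n)"
  have "(\<lambda>n. VP n (exp z) * wv c z ^ n) sums SP (exp z) (wv c z)"
    by (intro sums_ser[where C = Cb] bds g)
  from sums_mult[OF sums_tail[OF this], of "gxp c * exp z * EE z"]
  have "(\<lambda>n. gxp c * exp z * EE z * (VP (n + 2) (exp z) * wv c z ^ (n + 2))) sums
      (gxp c * exp z * EE z * (SP (exp z) (wv c z) - VP 0 (exp z) * wv c z ^ 0 - VP 1 (exp z) * wv c z ^ 1))" .
  moreover have "gxp c * exp z * EE z * (VP (n + 2) (exp z) * wv c z ^ (n + 2)) = T (n + 3)" for n
  proof -
    have "gxp c * exp z * EE z * (VP (n + 2) (exp z) * wv c z ^ (n + 2))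
        = gxp c * EE z * Y (Ip (n + 2)) (exp z) * (exp z * wv c z ^ Suc (Suc n))"
      by (simp add: vp_def)
    also have "\<dots> = T (n + 3)" unfolding wv_Suc_power by (simp add: T_def numeral_3_eq_3 mult_ac)
    finally show ?thesis .
  qed
  ultimately have "(\<lambda>n. T (n + 3)) sums (gxp c * exp z * EE z * (SP (exp z) (wv c z) - VP 0 (exp z) * wv c z ^ 0 - VP 1 (exp z) * wv c z ^ 1))"
    by simp
  moreover have "gxp c * exp z * EE z * (SP (exp z) (wv c z) - VP 0 (exp z) * wv c z ^ 0 - VP 1 (exp z) * wv c z ^ 1)
      = gxp c * exp z * EE z * SP (exp z) (wv c z) - gxp c * EE z * (exp z * VP 0 (exp z)) - gxp c * EE z * VP 1 (exp z) * (exp z * wv c z)"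
    by (simp add: algebra_simps)
  ultimately have T: "(\<lambda>n. T (n + 3)) sums (gxp c * exp z * EE z * SP (exp z) (wv c z)
      - gxp c * EE z * (exp z * VP 0 (exp z)) - gxp c * EE z * VP 1 (exp z) * (exp z * wv c z))" by simp
  have w: "exp z * wv c z = gmi c * gxp c * EE z" using wv_power[of z 1 c] by simp
  have x: "xpow z (- th) * Fp c z = gpl c * AA (exp z) + gxp c * exp z * EE z * SP (exp z) (wv c z)"
    unfolding Fp_def mult.assoc[symmetric] xpow_add by simp
  have "xpow z (- th) * Fp c z = gpl c * (1 + xpow z (- of_nat 1) * rem AA 1 (exp z))
      + gxp c * (th + tinf + xpow z (- of_nat 1) * rem (Y (Ip 0)) ta (exp z)) * EE z
      - gmi c * (gxp c)\<^sup>2 * (1 + xpow z (- of_nat 1) * rem (\<lambda>x. - 1 * Y (Ip 1) x) 1 (exp z)) * (EE z)\<^sup>2 + (\<Sum>n. T (n + 3))"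
    unfolding x ta[symmetric] rem_eq sums_unique[OF T, symmetric] w
    by (simp add: vp_def power2_eq_square)
  then show "let T = (\<lambda>n. gxp c * (gmi c * gxp c) ^ (n - 1) * (xpow z (- of_nat (n - 2)) * Y (Ip (n - 1)) (exp z)) * EE z ^ n) in
      summable (\<lambda>n. T (n + 3)) \<and>
      xpow z (- th) * Fp c z = gpl c * (1 + xpow z (- of_nat 1) * rem AA 1 (exp z))
      + gxp c * (th + tinf + xpow z (- of_nat 1) * rem (Y (Ip 0)) ta (exp z)) * EE z
      - gmi c * (gxp c)\<^sup>2 * (1 + xpow z (- of_nat 1) * rem (\<lambda>x. - 1 * Y (Ip 1) x) 1 (exp z)) * (EE z)\<^sup>2 + (\<Sum>n. T (n + 3))"
    unfolding Let_def T_def[symmetric] using sums_summable[OF T] by (simp add: T_def)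
qed

text \<open>\<open>Iq 1\<close> tends to 2, so the displayed factor 2 is taken out and half of it is
  expanded. The last summand stems from the part \<open>BB\<close> free of exponentials, which the
  normalising factor on the left turns into a term with exp (- x).\<close>

lemma repr_Gp:
  "\<exists>a b d h. br 1 a \<and> br 1 b \<and> br 1 d \<and> (\<forall>n\<ge>2. br n (h n)) \<and>
     (\<forall>c\<in>B. \<forall>z\<in>U. let T = (\<lambda>n. gxp c * (gmi c * gxp c) ^ n * h n c z * EE z ^ n) in
        summable (\<lambda>n. T (n + 2)) \<and>
        inverse (expx z) * xpow z (th + tinf) * Gp c z = gxp c * (1 + a c z)
          + 2 * gmi c * (gxp c)\<^sup>2 * (1 + b c z) * (expx z * xpow z (sg - 2))
          + (\<Sum>n. T (n + 2))
          + gpl c * (th + d c z) * (inverse (expx z) * xpow z (- sg - 1)))"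
proof (intro exI conjI allI impI ballI)
  show "br 1 (\<lambda>c z. xpow z (- of_nat 1) * rem (Y (Iq 0)) 1 (exp z))"
    by (intro asyhol_bracket2 asyhol_rem asyhol_Y S Kf_consts lead_Q0)
  have "lead (\<lambda>x. 1 / of_nat 2 * Y (Iq 1) x) 1" using lead_mult[OF lead_const[of "1/2"] lead_Q1] by simp
  then show "br 1 (\<lambda>c z. xpow z (- of_nat 1) * rem (\<lambda>x. 1 / of_nat 2 * Y (Iq 1) x) 1 (exp z))"
    by (intro asyhol_bracket2 asyhol_rem asyhol_cmult asyhol_Y S Kf_consts Kf_divide_nat)
  show "br 1 (\<lambda>c z. xpow z (- of_nat 1) * rem (Y IB) th (exp z))"
    by (intro asyhol_bracket2 asyhol_rem asyhol_Y S Kf_params lead_IB)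
  show "br n (\<lambda>c z. xpow z (- of_nat n) * Y (Iq n) (exp z))" for n
    by (rule asyhol_bracket2[OF asyhol_Y S])
  fix c z assume c: "c \<in> B" "z \<in> U"
  note g = good_D[OF c]
  define T where "T = (\<lambda>n. gxp c * (gmi c * gxp c) ^ n * (xpow z (- of_nat n) * Y (Iq n) (exp z)) * EE z ^ n)"
  have "(\<lambda>n. Y (Iq n) (exp z) * wv c z ^ n) sums SQ (exp z) (wv c z)"
    by (intro sums_ser[of "\<lambda>n. Y (Iq n)" _ Cb] Ybd g)
  from sums_mult[OF sums_tail[OF this], of "gxp c"]
  have "(\<lambda>n. gxp c * (Y (Iq (n + 2)) (exp z) * wv c z ^ (n + 2))) sums
      (gxp c * (SQ (exp z) (wv c z) - Y (Iq 0) (exp z) * wv c z ^ 0 - Y (Iq 1) (exp z) * wv c z ^ 1))" .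
  moreover have "gxp c * (Y (Iq n) (exp z) * wv c z ^ n) = T n" for n
    unfolding wv_power' T_def by (simp add: mult_ac)
  ultimately have "(\<lambda>n. T (n + 2)) sums
      (gxp c * (SQ (exp z) (wv c z) - Y (Iq 0) (exp z) * wv c z ^ 0 - Y (Iq 1) (exp z) * wv c z ^ 1))"
    by (simp only:)
  then have T: "(\<lambda>n. T (n + 2)) sums (gxp c * SQ (exp z) (wv c z) - gxp c * Y (Iq 0) (exp z) - gxp c * Y (Iq 1) (exp z) * wv c z)"
    by (simp add: right_diff_distrib mult.assoc)
  \<comment> \<open>The exponents of x add up to 2 th + tinf + sg, which is 0 by the choice of
    \<sigma>0.\<close>
  have e1: "inverse (expx z) * xpow z (th + tinf) * xpow z th * (exp z * EE z) = 1"
  proof -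
    have "th + tinf + th + (1 + (sg - 1)) = 0" by (simp add: sg)
    then have 1: "xpow z (th + tinf) * xpow z th * (xpow z 1 * xpow z (sg - 1)) = 1"
      unfolding xpow_add by simp
    have 2: "inverse (expx z) * expx z = 1" by (simp add: expx_def)
    have "xpow z 1 = exp z" by (simp add: xpow_def)
    then have "inverse (expx z) * xpow z (th + tinf) * xpow z th * (exp z * EE z)
        = (inverse (expx z) * expx z) * (xpow z (th + tinf) * xpow z th * (xpow z 1 * xpow z (sg - 1)))"
      by (simp only: EE_def mult_ac)
    then show ?thesis unfolding 1 2 by simp
  qed
  have e2: "inverse (expx z) * xpow z (th + tinf) * xpow z th * inverse (exp z) = inverse (expx z) * xpow z (- sg - 1)"
  proof -
    have "- sg - 1 = th + tinf + th + - of_nat 1" by (simp add: sg)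
    then have "xpow z (- sg - 1) = xpow z (th + tinf) * xpow z th * xpow z (- of_nat 1)"
      unfolding xpow_add by (rule arg_cong)
    then show ?thesis unfolding xpow_minus_nat by simp
  qed
  have x: "inverse (expx z) * xpow z (th + tinf) * Gp c z = gpl c * Y IB (exp z) * (inverse (expx z) * xpow z (- sg - 1))
      + gxp c * SQ (exp z) (wv c z)"
  proof -
    have "inverse (expx z) * xpow z (th + tinf) * Gp c z =
        gpl c * Y IB (exp z) * (inverse (expx z) * xpow z (th + tinf) * xpow z th * inverse (exp z))
        + gxp c * SQ (exp z) (wv c z) * (inverse (expx z) * xpow z (th + tinf) * xpow z th * (exp z * EE z))"
      unfolding Gp_def by (simp add: algebra_simps)
    then show ?thesis unfolding e1 e2 by simp
  qed
  have "inverse (expx z) * xpow z (th + tinf) * Gp c z = gxp c * (1 + xpow z (- of_nat 1) * rem (Y (Iq 0)) 1 (exp z))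
          + 2 * gmi c * (gxp c)\<^sup>2 * (1 + xpow z (- of_nat 1) * rem (\<lambda>x. 1 / of_nat 2 * Y (Iq 1) x) 1 (exp z)) * (expx z * xpow z (sg - 2))
          + (\<Sum>n. T (n + 2))
          + gpl c * (th + xpow z (- of_nat 1) * rem (Y IB) th (exp z)) * (inverse (expx z) * xpow z (- sg - 1))"
    unfolding x rem_eq sums_unique[OF T, symmetric] expx_xpow_eq
    by (simp add: wv_def power2_eq_square)
  then show "let T = (\<lambda>n. gxp c * (gmi c * gxp c) ^ n * (xpow z (- of_nat n) * Y (Iq n) (exp z)) * EE z ^ n) in
      summable (\<lambda>n. T (n + 2)) \<and>
      inverse (expx z) * xpow z (th + tinf) * Gp c z = gxp c * (1 + xpow z (- of_nat 1) * rem (Y (Iq 0)) 1 (exp z))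
          + 2 * gmi c * (gxp c)\<^sup>2 * (1 + xpow z (- of_nat 1) * rem (\<lambda>x. 1 / of_nat 2 * Y (Iq 1) x) 1 (exp z)) * (expx z * xpow z (sg - 2))
          + (\<Sum>n. T (n + 2))
          + gpl c * (th + xpow z (- of_nat 1) * rem (Y IB) th (exp z)) * (inverse (expx z) * xpow z (- sg - 1))"
    unfolding Let_def T_def[symmetric] using sums_summable[OF T] by (simp add: T_def)
qed

lemma repr_Fm:
  "\<exists>a b h. br 1 a \<and> br 1 b \<and> (\<forall>n\<ge>2. br n (h n)) \<and>
     (\<forall>c\<in>B. \<forall>z\<in>U. let T = (\<lambda>n. gmi c * (gmi c * gxp c) ^ n * h n c z * EE z ^ n) in
        summable (\<lambda>n. T (n + 2)) \<and>
        xpow z th * Fm c z = gmi c * (1 + a c z)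
          + 2 * (gmi c)\<^sup>2 * gxp c * (1 + b c z) * (expx z * xpow z (sg - 2))
          + (\<Sum>n. T (n + 2)))"
proof (intro exI conjI allI impI ballI)
  show "br 1 (\<lambda>c z. xpow z (- of_nat 1) * rem (Y (Iph 0)) 1 (exp z))"
    by (intro asyhol_bracket2 asyhol_rem asyhol_Y S Kf_consts lead_F0)
  have "lead (\<lambda>x. 1 / of_nat 2 * Y (Iph 1) x) 1" using lead_mult[OF lead_const[of "1/2"] lead_F1] by simp
  then show "br 1 (\<lambda>c z. xpow z (- of_nat 1) * rem (\<lambda>x. 1 / of_nat 2 * Y (Iph 1) x) 1 (exp z))"
    by (intro asyhol_bracket2 asyhol_rem asyhol_cmult asyhol_Y S Kf_consts Kf_divide_nat)
  show "br n (\<lambda>c z. xpow z (- of_nat n) * Y (Iph n) (exp z))" for n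
    by (rule asyhol_bracket2[OF asyhol_Y S])
  fix c z assume c: "c \<in> B" "z \<in> U"
  note g = good_D[OF c]
  define T where "T = (\<lambda>n. gmi c * (gmi c * gxp c) ^ n * (xpow z (- of_nat n) * Y (Iph n) (exp z)) * EE z ^ n)"
  have "(\<lambda>n. Y (Iph n) (exp z) * wv c z ^ n) sums SF (exp z) (wv c z)"
    by (intro sums_ser[of "\<lambda>n. Y (Iph n)" _ Cb] Ybd g)
  from sums_mult[OF sums_tail[OF this], of "gmi c"]
  have "(\<lambda>n. gmi c * (Y (Iph (n + 2)) (exp z) * wv c z ^ (n + 2))) sums
      (gmi c * (SF (exp z) (wv c z) - Y (Iph 0) (exp z) * wv c z ^ 0 - Y (Iph 1) (exp z) * wv c z ^ 1))" .
  moreover have "gmi c * (Y (Iph n) (exp z) * wv c z ^ n) = T n" for n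
    unfolding wv_power' T_def by (simp add: mult_ac)
  ultimately have "(\<lambda>n. T (n + 2)) sums
      (gmi c * (SF (exp z) (wv c z) - Y (Iph 0) (exp z) * wv c z ^ 0 - Y (Iph 1) (exp z) * wv c z ^ 1))"
    by (simp only:)
  then have T: "(\<lambda>n. T (n + 2)) sums (gmi c * SF (exp z) (wv c z) - gmi c * Y (Iph 0) (exp z) - gmi c * Y (Iph 1) (exp z) * wv c z)"
    by (simp add: right_diff_distrib mult.assoc)
  have x: "xpow z th * Fm c z = gmi c * SF (exp z) (wv c z)"
    unfolding Fm_def mult.assoc[symmetric] xpow_add by simp
  have "xpow z th * Fm c z = gmi c * (1 + xpow z (- of_nat 1) * rem (Y (Iph 0)) 1 (exp z))
          + 2 * (gmi c)\<^sup>2 * gxp c * (1 + xpow z (- of_nat 1) * rem (\<lambda>x. 1 / of_nat 2 * Y (Iph 1) x) 1 (exp z)) * (expx z * xpow z (sg - 2))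
          + (\<Sum>n. T (n + 2))"
    unfolding x rem_eq sums_unique[OF T, symmetric] expx_xpow_eq
    by (simp add: wv_def power2_eq_square)
  then show "let T = (\<lambda>n. gmi c * (gmi c * gxp c) ^ n * (xpow z (- of_nat n) * Y (Iph n) (exp z)) * EE z ^ n) in
      summable (\<lambda>n. T (n + 2)) \<and>
      xpow z th * Fm c z = gmi c * (1 + xpow z (- of_nat 1) * rem (Y (Iph 0)) 1 (exp z))
          + 2 * (gmi c)\<^sup>2 * gxp c * (1 + xpow z (- of_nat 1) * rem (\<lambda>x. 1 / of_nat 2 * Y (Iph 1) x) 1 (exp z)) * (expx z * xpow z (sg - 2))
          + (\<Sum>n. T (n + 2))"
    unfolding Let_def T_def[symmetric] using sums_summable[OF T] by (simp add: T_def)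
qed

text \<open>The normalising factor on the left contributes \<open>exp z * EE z\<close>, so the
  powers of E are shifted by one against the modes, as for f+; mode 1 again has limit - 1.\<close>

lemma repr_Gm:
  "\<exists>a b h. br 1 a \<and> br 1 b \<and> (\<forall>n\<ge>3. br (n - 2) (h n)) \<and>
     (\<forall>c\<in>B. \<forall>z\<in>U. let T = (\<lambda>n. gmi c * (gmi c * gxp c) ^ (n - 1) * h n c z * EE z ^ n) in
        summable (\<lambda>n. T (n + 3)) \<and>
        expx z * xpow z (- th - tinf) * Gm c z = gmi c * (th + a c z) * EE z
          - (gmi c)\<^sup>2 * gxp c * (1 + b c z) * (EE z)\<^sup>2 + (\<Sum>n. T (n + 3)))"
proof (intro exI conjI allI impI ballI)
  show "br 1 (\<lambda>c z. xpow z (- of_nat 1) * rem (Y (Iga 0)) th (exp z))"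
    by (intro asyhol_bracket2 asyhol_rem asyhol_Y S Kf_params lead_G0)
  have "lead (\<lambda>x. - 1 * Y (Iga 1) x) 1" using lead_mult[OF lead_const[of "-1"] lead_G1] by simp
  then show "br 1 (\<lambda>c z. xpow z (- of_nat 1) * rem (\<lambda>x. - 1 * Y (Iga 1) x) 1 (exp z))"
    by (intro asyhol_bracket2 asyhol_rem asyhol_cmult asyhol_Y S Kf_consts Kf_uminus)
  show "br (n - 2) (\<lambda>c z. xpow z (- of_nat (n - 2)) * Y (Iga (n - 1)) (exp z))" for n
    by (rule asyhol_bracket2[OF asyhol_Y S])
  fix c z assume c: "c \<in> B" "z \<in> U"
  note g = good_D[OF c]
  define T where "T = (\<lambda>n. gmi c * (gmi c * gxp c) ^ (n - 1) * (xpow z (- of_nat (n - 2)) * Y (Iga (n - 1)) (exp z)) * EE z ^ n)"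
  have "(\<lambda>n. VG n (exp z) * wv c z ^ n) sums SG (exp z) (wv c z)"
    by (intro sums_ser[where C = Cb] bds g)
  from sums_mult[OF sums_tail[OF this], of "gmi c * exp z * EE z"]
  have "(\<lambda>n. gmi c * exp z * EE z * (VG (n + 2) (exp z) * wv c z ^ (n + 2))) sums
      (gmi c * exp z * EE z * (SG (exp z) (wv c z) - VG 0 (exp z) * wv c z ^ 0 - VG 1 (exp z) * wv c z ^ 1))" .
  moreover have "gmi c * exp z * EE z * (VG (n + 2) (exp z) * wv c z ^ (n + 2)) = T (n + 3)" for n
  proof -
    have "gmi c * exp z * EE z * (VG (n + 2) (exp z) * wv c z ^ (n + 2))
        = gmi c * EE z * Y (Iga (n + 2)) (exp z) * (exp z * wv c z ^ Suc (Suc n))"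
      by (simp add: vg_def)
    also have "\<dots> = T (n + 3)" unfolding wv_Suc_power by (simp add: T_def numeral_3_eq_3 mult_ac)
    finally show ?thesis .
  qed
  ultimately have "(\<lambda>n. T (n + 3)) sums (gmi c * exp z * EE z * (SG (exp z) (wv c z) - VG 0 (exp z) * wv c z ^ 0 - VG 1 (exp z) * wv c z ^ 1))"
    by simp
  moreover have "gmi c * exp z * EE z * (SG (exp z) (wv c z) - VG 0 (exp z) * wv c z ^ 0 - VG 1 (exp z) * wv c z ^ 1)
      = gmi c * exp z * EE z * SG (exp z) (wv c z) - gmi c * EE z * (exp z * VG 0 (exp z)) - gmi c * EE z * VG 1 (exp z) * (exp z * wv c z)"
    by (simp add: algebra_simps)
  ultimately have T: "(\<lambda>n. T (n + 3)) sums (gmi c * exp z * EE z * SG (exp z) (wv c z)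
      - gmi c * EE z * (exp z * VG 0 (exp z)) - gmi c * EE z * VG 1 (exp z) * (exp z * wv c z))" by simp
  have w: "exp z * wv c z = gmi c * gxp c * EE z" using wv_power[of z 1 c] by simp
  have x: "expx z * xpow z (- th - tinf) * Gm c z = gmi c * exp z * EE z * SG (exp z) (wv c z)"
  proof -
    have "- th - tinf + - th = 1 + (sg - 1)" by (simp add: sg)
    then have "xpow z (- th - tinf) * xpow z (- th) = xpow z 1 * xpow z (sg - 1)"
      unfolding xpow_add by (rule arg_cong)
    moreover have "xpow z 1 = exp z" by (simp add: xpow_def)
    ultimately have e: "expx z * (xpow z (- th - tinf) * xpow z (- th)) = exp z * EE z"
      by (simp add: EE_def)
    have "expx z * xpow z (- th - tinf) * Gm c z = (expx z * (xpow z (- th - tinf) * xpow z (- th))) * (gmi c * SG (exp z) (wv c z))"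
      by (simp add: Gm_def)
    then show ?thesis unfolding e by simp
  qed
  have "expx z * xpow z (- th - tinf) * Gm c z = gmi c * (th + xpow z (- of_nat 1) * rem (Y (Iga 0)) th (exp z)) * EE z
      - (gmi c)\<^sup>2 * gxp c * (1 + xpow z (- of_nat 1) * rem (\<lambda>x. - 1 * Y (Iga 1) x) 1 (exp z)) * (EE z)\<^sup>2 + (\<Sum>n. T (n + 3))"
    unfolding x rem_eq sums_unique[OF T, symmetric] w
    by (simp add: vg_def power2_eq_square)
  then show "let T = (\<lambda>n. gmi c * (gmi c * gxp c) ^ (n - 1) * (xpow z (- of_nat (n - 2)) * Y (Iga (n - 1)) (exp z)) * EE z ^ n) in
      summable (\<lambda>n. T (n + 3)) \<and>
      expx z * xpow z (- th - tinf) * Gm c z = gmi c * (th + xpow z (- of_nat 1) * rem (Y (Iga 0)) th (exp z)) * EE z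
      - (gmi c)\<^sup>2 * gxp c * (1 + xpow z (- of_nat 1) * rem (\<lambda>x. - 1 * Y (Iga 1) x) 1 (exp z)) * (EE z)\<^sup>2 + (\<Sum>n. T (n + 3))"
    unfolding Let_def T_def[symmetric] using sums_summable[OF T] by (simp add: T_def)
qed

end

end

section \<open>The one-parameter family at cx = 0\<close>

context solution
begin

lemma ser_0: "ser h x 0 = h 0 x"
  unfolding ser_def by (rule powser_zero)

lemma wv_0: "wv (c, 0) z = 0"
  by (simp add: wv_def gxp_def)

text \<open>At cx = 0 both \<open>gxp\<close> and w vanish, so the series reduce to mode 0 and f+
  and g+ to their parts free of exponentials. The factor 1/2 in \<open>gpl\<close> and
  \<open>gmi\<close> is moved into the expanded functions to match the stated normalisation.\<close>

lemma repr_one_parameter: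
  assumes B: "\<And>c. c \<in> B \<Longrightarrow> c \<noteq> 0" and U: "exp ` U \<subseteq> D"
  shows "\<exists>a b d p q. let br = bracket1 t0 th tinf B U in
     br 3 a \<and> br 1 b \<and> br 1 d \<and> br 1 p \<and> br 1 q \<and>
     (\<forall>c\<in>B. \<forall>z\<in>U.
       F0 (c, 0) z = - (th + tinf) / 2 + th / 4 * (t0\<^sup>2 - (th + tinf)\<^sup>2) * xpow z (-2) + a c z \<and>
       G0 (c, 0) z = - tinf / 2 - F0 (c, 0) z \<and>
       xpow z (- th) * Fp (c, 0) z = c * (t0 - th - tinf) * (1/2 + b c z) \<and>
       xpow z (- th + 1) * Gp (c, 0) z = c * (t0 - th - tinf) * (th/2 + d c z) \<and>
       xpow z th * Fm (c, 0) z = inverse c * (t0 + th + tinf) * (1/2 + p c z) \<and>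
       xpow z (th + 1) * Gm (c, 0) z = inverse c * (t0 + th + tinf) * (th/2 + q c z))"
proof -
  have half: "1 / 2 \<in> Kf" "th / 2 \<in> Kf"
    using Kf_divide_nat[of _ 2] Kf_consts Kf_params by fastforce+
  have scaled: "asyhol (rem (\<lambda>x. 1 / 2 * Y i x) (1 / 2 * v))" if "lead (Y i) v" "1 / 2 * v \<in> Kf" for i v
    using that half by (intro asyhol_rem asyhol_cmult asyhol_Y lead_mult lead_const)
  have br: "bracket1 t0 th tinf B U 3 (\<lambda>c z. xpow z (- of_nat 3) * rem (rem (Y (Ia 0)) 0) (th * ka) (exp z))"
    "bracket1 t0 th tinf B U 1 (\<lambda>c z. xpow z (- of_nat 1) * rem (\<lambda>x. 1 / 2 * Y IA x) (1 / 2 * 1) (exp z))"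
    "bracket1 t0 th tinf B U 1 (\<lambda>c z. xpow z (- of_nat 1) * rem (\<lambda>x. 1 / 2 * Y IB x) (1 / 2 * th) (exp z))"
    "bracket1 t0 th tinf B U 1 (\<lambda>c z. xpow z (- of_nat 1) * rem (\<lambda>x. 1 / 2 * Y (Iph 0) x) (1 / 2 * 1) (exp z))"
    "bracket1 t0 th tinf B U 1 (\<lambda>c z. xpow z (- of_nat 1) * rem (\<lambda>x. 1 / 2 * Y (Iga 0) x) (1 / 2 * th) (exp z))"
    using half by (intro asyhol_bracket1 asyhol_alpha scaled U lead_IA lead_IB lead_F0 lead_G0; simp)+
  have eqs: "F0 (c, 0) z = - (th + tinf) / 2 + th / 4 * (t0\<^sup>2 - (th + tinf)\<^sup>2) * xpow z (-2)
        + xpow z (- of_nat 3) * rem (rem (Y (Ia 0)) 0) (th * ka) (exp z)"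
      "G0 (c, 0) z = - tinf / 2 - F0 (c, 0) z"
      "xpow z (- th) * Fp (c, 0) z = c * (t0 - th - tinf) * (1/2 + xpow z (- of_nat 1) * rem (\<lambda>x. 1 / 2 * Y IA x) (1 / 2 * 1) (exp z))"
      "xpow z (- th + 1) * Gp (c, 0) z = c * (t0 - th - tinf) * (th/2 + xpow z (- of_nat 1) * rem (\<lambda>x. 1 / 2 * Y IB x) (1 / 2 * th) (exp z))"
      "xpow z th * Fm (c, 0) z = inverse c * (t0 + th + tinf) * (1/2 + xpow z (- of_nat 1) * rem (\<lambda>x. 1 / 2 * Y (Iph 0) x) (1 / 2 * 1) (exp z))"
      "xpow z (th + 1) * Gm (c, 0) z = inverse c * (t0 + th + tinf) * (th/2 + xpow z (- of_nat 1) * rem (\<lambda>x. 1 / 2 * Y (Iga 0) x) (1 / 2 * th) (exp z))"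
    if "c \<in> B" "z \<in> U" for c z
  proof -
    have k: "th / 4 * (t0\<^sup>2 - (th + tinf)\<^sup>2) = th * ka"
      by (simp add: ka field_simps power2_eq_square)
    show "F0 (c, 0) z = - (th + tinf) / 2 + th / 4 * (t0\<^sup>2 - (th + tinf)\<^sup>2) * xpow z (-2)
        + xpow z (- of_nat 3) * rem (rem (Y (Ia 0)) 0) (th * ka) (exp z)"
      using VA_0_eq[of z] unfolding k by (simp add: F0_def wv_0 ser_0 ta[symmetric] va_def)
    show "G0 (c, 0) z = - tinf / 2 - F0 (c, 0) z" by (rule G0_def)
    have one: "xpow z 1 = exp z" by (simp add: xpow_def)
    have r: "1/2 + xpow z (- of_nat 1) * rem (\<lambda>x. 1 / 2 * Y i x) (1 / 2 * 1) (exp z) = 1 / 2 * Y i (exp z)"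
      "th/2 + xpow z (- of_nat 1) * rem (\<lambda>x. 1 / 2 * Y i x) (1 / 2 * th) (exp z) = 1 / 2 * Y i (exp z)" for i
      using rem_eq[of "1 / 2 * 1" z "\<lambda>x. 1 / 2 * Y i x"] rem_eq[of "1 / 2 * th" z "\<lambda>x. 1 / 2 * Y i x"] by simp_all
    have x1: "xpow z (- th) * xpow z th = 1" "xpow z th * xpow z (- th) = 1"
      by (simp_all add: xpow_add)
    have x2: "xpow z (- th + 1) * xpow z th = exp z" "xpow z (th + 1) * xpow z (- th) = exp z"
      unfolding one[symmetric] xpow_add by simp_all
    have "xpow z (- th) * Fp (c, 0) z = (xpow z (- th) * xpow z th) * (gpl (c, 0) * AA (exp z))"
      by (simp add: Fp_def gxp_def)
    then show "xpow z (- th) * Fp (c, 0) z = c * (t0 - th - tinf) * (1/2 + xpow z (- of_nat 1) * rem (\<lambda>x. 1 / 2 * Y IA x) (1 / 2 * 1) (exp z))"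
      unfolding r x1 by (simp add: gpl_def)
    have "xpow z th * Fm (c, 0) z = (xpow z th * xpow z (- th)) * (gmi (c, 0) * Y (Iph 0) (exp z))"
      by (simp add: Fm_def wv_0 ser_0)
    then show "xpow z th * Fm (c, 0) z = inverse c * (t0 + th + tinf) * (1/2 + xpow z (- of_nat 1) * rem (\<lambda>x. 1 / 2 * Y (Iph 0) x) (1 / 2 * 1) (exp z))"
      unfolding r x1 by (simp add: gmi_def)
    have "xpow z (- th + 1) * Gp (c, 0) z = (xpow z (- th + 1) * xpow z th) * (gpl (c, 0) * BB (exp z))"
      by (simp add: Gp_def gxp_def)
    then show "xpow z (- th + 1) * Gp (c, 0) z = c * (t0 - th - tinf) * (th/2 + xpow z (- of_nat 1) * rem (\<lambda>x. 1 / 2 * Y IB x) (1 / 2 * th) (exp z))"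
      unfolding r x2 by (simp add: gpl_def)
    have "xpow z (th + 1) * Gm (c, 0) z = (xpow z (th + 1) * xpow z (- th)) * (gmi (c, 0) * VG 0 (exp z))"
      by (simp add: Gm_def wv_0 ser_0)
    then show "xpow z (th + 1) * Gm (c, 0) z = inverse c * (t0 + th + tinf) * (th/2 + xpow z (- of_nat 1) * rem (\<lambda>x. 1 / 2 * Y (Iga 0) x) (1 / 2 * th) (exp z))"
      unfolding r x2 by (simp add: gmi_def vg_def)
  qed
  show ?thesis unfolding Let_def
    by (intro exI conjI ballI, rule br(1), rule br(2), rule br(3), rule br(4), rule br(5), (erule (1) eqs)+)
qed

end

text \<open>Let \<psi> be the angle to the positive imaginary axis. Up to a right angle sin \<psi> +
  cos \<psi> \<ge> 1 suffices; beyond it sin \<psi> \<ge> sin \<delta>, so the second term is at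
  least 2, which outweighs cos \<psi> \<ge> - 1.\<close>

lemma sector_level:
  assumes d: "0 < \<delta>" "\<delta> < pi / 2" and y: "\<bar>y - pi / 2\<bar> < pi - \<delta>"
  shows "1 \<le> sin y + 2 / sin \<delta> * \<bar>cos y\<bar>"
proof -
  define \<psi> where "\<psi> = \<bar>y - pi / 2\<bar>"
  have \<psi>: "0 \<le> \<psi>" "\<psi> < pi - \<delta>" using y by (auto simp: \<psi>_def)
  have "cos \<psi> = sin y" by (simp add: \<psi>_def abs_if cos_diff)
  moreover have "\<bar>sin \<psi>\<bar> = \<bar>cos y\<bar>" by (simp add: \<psi>_def abs_if sin_diff)
  moreover have "0 \<le> sin \<psi>" using \<psi> d by (intro sin_ge_zero) auto
  ultimately have e: "sin y = cos \<psi>" "\<bar>cos y\<bar> = sin \<psi>" by auto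
  have sd: "0 < sin \<delta>" "sin \<delta> \<le> 1" using d by (auto intro!: sin_gt_zero)
  then have s2: "2 \<le> 2 / sin \<delta>" by (simp add: le_divide_eq)
  have "1 \<le> cos \<psi> + 2 / sin \<delta> * sin \<psi>"
  proof (cases "\<psi> \<le> pi / 2")
    case True
    then have c: "0 \<le> cos \<psi>" using \<psi> by (intro cos_ge_zero) auto
    have "1 = (sin \<psi>)\<^sup>2 + (cos \<psi>)\<^sup>2" by simp
    also have "\<dots> \<le> sin \<psi> + cos \<psi>"
      using c \<open>0 \<le> sin \<psi>\<close> by (intro add_mono) (auto simp: power2_eq_square mult_left_le)
    also have "\<dots> \<le> cos \<psi> + 2 / sin \<delta> * sin \<psi>"
      using mult_right_mono[of 1 "2 / sin \<delta>" "sin \<psi>"] s2 \<open>0 \<le> sin \<psi>\<close> by simp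
    finally show ?thesis .
  next
    case False
    have "sin \<delta> \<le> sin (pi - \<psi>)" using \<psi> d False by (intro sin_monotone_2pi_le) auto
    then have "2 \<le> 2 / sin \<delta> * sin \<psi>" using sd by (simp add: field_simps)
    then show ?thesis using cos_ge_minus_one[of \<psi>] by linarith
  qed
  then show ?thesis by (simp add: e)
qed

text \<open>Intersecting the constants of two rings lets one construction of the coefficients serve
  both families of solutions.\<close>

lemma coeff_field_constants:
  "coeff_field {k. (\<lambda>_. k) \<in> rat_ring G \<and> (\<lambda>_. k) \<in> rat_ring H}"
  by unfold_locales (auto intro: rat_ring.intros)

theorem theorem2p8:
  fixes \<theta>0 \<theta>x \<theta>inf \<sigma>0 :: complex and \<delta> :: real and B0 Bt :: "complex set"
    and \<gamma>0p \<gamma>0m \<gamma>xp :: "complex \<times> complex \<Rightarrow> complex"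
    and E :: "complex \<Rightarrow> complex"
  assumes "\<theta>x \<noteq> 0"
    and "\<sigma>0 = - 2 * \<theta>x - \<theta>inf"
    and "0 < \<delta>" and "\<delta> < pi / 2"
    and "open Bt" and "connected Bt" and "Bt \<noteq> {}" and "bounded Bt"
    and "open B0" and "connected B0" and "B0 \<noteq> {}" and "bounded B0" and "0 \<notin> B0"
    and "\<gamma>0p = (\<lambda>(c0, cx). c0 / 2 * (\<theta>0 - \<theta>x - \<theta>inf))"
    and "\<gamma>0m = (\<lambda>(c0, cx). inverse c0 / 2 * (\<theta>0 + \<theta>x + \<theta>inf))"
    and "\<gamma>xp = (\<lambda>(c0, cx). cx * \<theta>x)"
    and "E = (\<lambda>z. expx z * xpow z (\<sigma>0 - 1))"
  shows
    "(0 \<notin> closure B0 \<longrightarrow>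
      (\<exists>\<epsilon>>0. \<exists>xinf>0.
       \<exists>f0 fp fm g0 gp gm :: complex \<times> complex \<Rightarrow> complex \<Rightarrow> complex.
         (\<forall>h\<in>{f0, fp, fm, g0, gp, gm}. holo2 (B0 \<times> Bt) (Sigma_star \<sigma>0 \<epsilon> xinf \<delta>) h) \<and>
         (\<forall>c\<in>B0 \<times> Bt.
            solves_S (\<lambda>z. sl2_mat (f0 c z) (fp c z) (fm c z))
                     (\<lambda>z. sl2_mat (g0 c z) (gp c z) (gm c z)) (Sigma_star \<sigma>0 \<epsilon> xinf \<delta>)) \<and>
         (let br = bracket2 \<theta>0 \<theta>x \<theta>inf (B0 \<times> Bt) (sector_star xinf \<delta>) in
          (\<exists>a b h. br 3 a \<and> br 1 b \<and> (\<forall>n\<ge>2. br (n - 1) (h n)) \<and>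
             (\<forall>c\<in>B0 \<times> Bt. \<forall>z\<in>Sigma_star \<sigma>0 \<epsilon> xinf \<delta>.
                let T = (\<lambda>n. (\<gamma>0m c * \<gamma>xp c) ^ n * h n c z * E z ^ n) in
                summable (\<lambda>n. T (n + 2)) \<and>
                f0 c z = - (\<theta>x + \<theta>inf) / 2 + \<theta>x * \<gamma>0p c * \<gamma>0m c * xpow z (-2) + a c z
                  + \<gamma>0m c * \<gamma>xp c * (1 + b c z) * E z + (\<Sum>n. T (n + 2)))) \<and>
          (\<forall>c\<in>B0 \<times> Bt. \<forall>z\<in>Sigma_star \<sigma>0 \<epsilon> xinf \<delta>. g0 c z = - \<theta>inf / 2 - f0 c z) \<and>
          (\<exists>a b d h. br 1 a \<and> br 1 b \<and> br 1 d \<and> (\<forall>n\<ge>3. br (n - 2) (h n)) \<and>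
             (\<forall>c\<in>B0 \<times> Bt. \<forall>z\<in>Sigma_star \<sigma>0 \<epsilon> xinf \<delta>.
                let T = (\<lambda>n. \<gamma>xp c * (\<gamma>0m c * \<gamma>xp c) ^ (n - 1) * h n c z * E z ^ n) in
                summable (\<lambda>n. T (n + 3)) \<and>
                xpow z (- \<theta>x) * fp c z = \<gamma>0p c * (1 + a c z)
                  + \<gamma>xp c * (\<theta>x + \<theta>inf + b c z) * E z
                  - \<gamma>0m c * (\<gamma>xp c)\<^sup>2 * (1 + d c z) * (E z)\<^sup>2 + (\<Sum>n. T (n + 3)))) \<and>
          (\<exists>a b d h. br 1 a \<and> br 1 b \<and> br 1 d \<and> (\<forall>n\<ge>2. br n (h n)) \<and>
             (\<forall>c\<in>B0 \<times> Bt. \<forall>z\<in>Sigma_star \<sigma>0 \<epsilon> xinf \<delta>.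
                let T = (\<lambda>n. \<gamma>xp c * (\<gamma>0m c * \<gamma>xp c) ^ n * h n c z * E z ^ n) in
                summable (\<lambda>n. T (n + 2)) \<and>
                inverse (expx z) * xpow z (\<theta>x + \<theta>inf) * gp c z = \<gamma>xp c * (1 + a c z)
                  + 2 * \<gamma>0m c * (\<gamma>xp c)\<^sup>2 * (1 + b c z) * (expx z * xpow z (\<sigma>0 - 2))
                  + (\<Sum>n. T (n + 2))
                  + \<gamma>0p c * (\<theta>x + d c z) * (inverse (expx z) * xpow z (- \<sigma>0 - 1)))) \<and>
          (\<exists>a b h. br 1 a \<and> br 1 b \<and> (\<forall>n\<ge>2. br n (h n)) \<and>
             (\<forall>c\<in>B0 \<times> Bt. \<forall>z\<in>Sigma_star \<sigma>0 \<epsilon> xinf \<delta>.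
                let T = (\<lambda>n. \<gamma>0m c * (\<gamma>0m c * \<gamma>xp c) ^ n * h n c z * E z ^ n) in
                summable (\<lambda>n. T (n + 2)) \<and>
                xpow z \<theta>x * fm c z = \<gamma>0m c * (1 + a c z)
                  + 2 * (\<gamma>0m c)\<^sup>2 * \<gamma>xp c * (1 + b c z) * (expx z * xpow z (\<sigma>0 - 2))
                  + (\<Sum>n. T (n + 2)))) \<and>
          (\<exists>a b h. br 1 a \<and> br 1 b \<and> (\<forall>n\<ge>3. br (n - 2) (h n)) \<and>
             (\<forall>c\<in>B0 \<times> Bt. \<forall>z\<in>Sigma_star \<sigma>0 \<epsilon> xinf \<delta>.
                let T = (\<lambda>n. \<gamma>0m c * (\<gamma>0m c * \<gamma>xp c) ^ (n - 1) * h n c z * E z ^ n) in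
                summable (\<lambda>n. T (n + 3)) \<and>
                expx z * xpow z (- \<theta>x - \<theta>inf) * gm c z = \<gamma>0m c * (\<theta>x + a c z) * E z
                  - (\<gamma>0m c)\<^sup>2 * \<gamma>xp c * (1 + b c z) * (E z)\<^sup>2 + (\<Sum>n. T (n + 3)))))))
     \<and>
     (\<exists>xinf>0.
       \<exists>f0 fp fm g0 gp gm :: complex \<Rightarrow> complex \<Rightarrow> complex.
         (\<forall>h\<in>{f0, fp, fm, g0, gp, gm}. holo1 B0 (Sigma_dstar xinf \<delta>) h) \<and>
         (\<forall>c0\<in>B0.
            solves_S (\<lambda>z. sl2_mat (f0 c0 z) (fp c0 z) (fm c0 z))
                     (\<lambda>z. sl2_mat (g0 c0 z) (gp c0 z) (gm c0 z)) (Sigma_dstar xinf \<delta>)) \<and>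
         (\<exists>a b d p q. let br = bracket1 \<theta>0 \<theta>x \<theta>inf B0 (Sigma_dstar xinf \<delta>) in
            br 3 a \<and> br 1 b \<and> br 1 d \<and> br 1 p \<and> br 1 q \<and>
            (\<forall>c0\<in>B0. \<forall>z\<in>Sigma_dstar xinf \<delta>.
               f0 c0 z = - (\<theta>x + \<theta>inf) / 2 + \<theta>x / 4 * (\<theta>0\<^sup>2 - (\<theta>x + \<theta>inf)\<^sup>2) * xpow z (-2) + a c0 z \<and>
               g0 c0 z = - \<theta>inf / 2 - f0 c0 z \<and>
               xpow z (- \<theta>x) * fp c0 z = c0 * (\<theta>0 - \<theta>x - \<theta>inf) * (1/2 + b c0 z) \<and>
               xpow z (- \<theta>x + 1) * gp c0 z = c0 * (\<theta>0 - \<theta>x - \<theta>inf) * (\<theta>x/2 + d c0 z) \<and>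
               xpow z \<theta>x * fm c0 z = inverse c0 * (\<theta>0 + \<theta>x + \<theta>inf) * (1/2 + p c0 z) \<and>
               xpow z (\<theta>x + 1) * gm c0 z = inverse c0 * (\<theta>0 + \<theta>x + \<theta>inf) * (\<theta>x/2 + q c0 z))))"
proof -
  define ta where "ta = \<theta>x + \<theta>inf"
  define ka where "ka = (\<theta>0 - \<theta>x - \<theta>inf) / 2 * ((\<theta>0 + \<theta>x + \<theta>inf) / 2)"
  \<comment> \<open>By \<open>sector_level\<close> this slope puts both sectors beyond |x| = R
    inside D.\<close>
  define s where "s = 2 / sin \<delta>"
  have "0 < sin \<delta>" "sin \<delta> \<le> 1" using assms(3,4) by (auto intro!: sin_gt_zero)
  then have "0 < sin \<delta>" "sin \<delta> \<le> 2" by linarith+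
  then have s: "1 \<le> s" by (simp add: s_def)
  let ?G1 = "{\<lambda>_. \<theta>0, \<lambda>_. \<theta>x, \<lambda>_. \<theta>inf, \<lambda>c0. c0, \<lambda>c0. inverse c0} :: (complex \<Rightarrow> complex) set"
  let ?G2 = "{\<lambda>_. \<theta>0, \<lambda>_. \<theta>x, \<lambda>_. \<theta>inf, \<lambda>(c0, cx). c0, \<lambda>(c0, cx). inverse c0, \<lambda>(c0, cx). cx} :: (complex \<times> complex \<Rightarrow> complex) set"
  define Kf where "Kf = {k. (\<lambda>_. k) \<in> rat_ring ?G1 \<and> (\<lambda>_. k) \<in> rat_ring ?G2}"
  interpret coeff_field Kf unfolding Kf_def by (rule coeff_field_constants)
  have Kp: "\<theta>0 \<in> Kf" "\<theta>x \<in> Kf" "\<theta>inf \<in> Kf" by (auto simp: Kf_def intro: rat_ring.gen)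
  obtain R M \<xi> \<rho> Y where RR: "sector_dom s R" "(1 + s) / R \<le> 1" and pos: "0 < \<rho>" "0 < M" "0 < \<xi>" "M \<le> R / (1 + s)"
    and Yhol: "\<And>i. Y i holomorphic_on sector_dom.D s R"
    and Ybnd: "\<And>i x. x \<in> sector_dom.D s R \<Longrightarrow> norm (Y i x) \<le> bnd M \<xi> \<rho> i"
    and Ysol: "\<And>i. \<exists>h. sector_dom.Sol s R i (\<lambda>x. rhs \<theta>x ta ka \<sigma>0 i (\<lambda>j. Y j x) (inverse x)) h \<and>
       (\<forall>x\<in>sector_dom.D s R. Y i x = of_real (init i) + h x)"
    by (rule system_solution[OF s, of \<theta>x ta ka \<sigma>0]) (rule that)
  interpret sector_dom s R by (rule RR)
  \<comment> \<open>A common upper bound for the constants of all cases of \<open>bnd\<close>; the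
    inverse squares in the weights are dropped from here on.\<close>
  define Cb where "Cb = 2 + M + M\<^sup>2 + \<xi>"
  have wt_le: "wt \<rho> n \<le> \<rho> ^ n" for n
    using pos by (simp add: wt_def divide_le_eq one_le_power mult_left_le)
  have bnd_le: "norm (Y i x) \<le> Cb * \<rho> ^ n" if "x \<in> D" "i \<in> {Ia n, Iph n, Iga n, Ip n, Iq n}" for i n x
  proof -
    have "bnd M \<xi> \<rho> i \<le> Cb * \<rho> ^ n"
    proof (cases "n = 0")
      case True then show ?thesis using that(2) pos by (auto simp: Cb_def)
    next
      case False
      have "2 * wt \<rho> n \<le> Cb * \<rho> ^ n" "\<xi> * wt \<rho> n \<le> Cb * \<rho> ^ n"
        using wt_le[of n] wt_pos[OF pos(1), of n] pos by (auto simp: Cb_def intro!: mult_mono)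
      then show ?thesis using that(2) False by auto
    qed
    then show ?thesis using Ybnd[OF that(1), of i] by simp
  qed
  interpret solution s R Kf \<theta>x ta ka \<sigma>0 Y Cb \<rho> \<theta>0 \<theta>inf
  proof unfold_locales
    show "(1 + s) / R \<le> 1" by (rule RR)
    have half: "a / 2 \<in> Kf" if "a \<in> Kf" for a using Kf_divide_nat[OF that, of 2] by simp
    show "\<theta>x \<in> Kf" by (rule Kp)
    show "ta \<in> Kf" unfolding ta_def by (intro Kf_add Kp)
    show "ka \<in> Kf" unfolding ka_def by (intro Kf_mult half Kf_diff Kf_add Kp)
    show "\<sigma>0 \<in> Kf" unfolding assms(2) by (intro Kf_diff Kf_mult Kf_uminus Kf_consts Kp)
    show "\<exists>C. \<forall>x\<in>D. norm (Y i x) \<le> C" for i using Ybnd by blast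
    show "\<exists>h. Sol i (\<lambda>x. rhs \<theta>x ta ka \<sigma>0 i (\<lambda>j. Y j x) (inverse x)) h \<and>
       (\<forall>x\<in>D. Y i x = of_real (init i) + h x)" for i by (rule Ysol)
    show "0 < \<rho>" by (rule pos)
  qed (use bnd_le in \<open>auto simp: ta_def ka_def assms(2) Kf_def\<close>)
  have R0: "0 < R" "1 \<le> R" using RR(2) s R by (auto simp: divide_le_eq)
  have inD: "exp z \<in> D" if "\<bar>Im z - pi / 2\<bar> < pi - \<delta>" "R < norm (exp z)" for z
  proof -
    have "norm (exp z) * 1 \<le> norm (exp z) * (sin (Im z) + s * \<bar>cos (Im z)\<bar>)"
      unfolding s_def by (intro mult_left_mono sector_level assms(3,4) that(1)) simp
    also have "\<dots> = Im (exp z) + s * \<bar>Re (exp z)\<bar>"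
      by (simp add: Im_exp Re_exp abs_mult algebra_simps)
    finally show ?thesis using that(2) by (simp add: D_def)
  qed
  have S1: "exp ` sector_star R \<delta> \<subseteq> D"
    using assms(3,4) by (auto simp: sector_star_def abs_less_iff intro!: inD)
  have S2: "exp ` Sigma_dstar R \<delta> \<subseteq> D"
    by (auto simp: Sigma_dstar_def intro!: inD)
  have good2: "good (c, 0) z" if "c \<in> B0" "z \<in> Sigma_dstar R \<delta>" for c z
    using that assms(13) S2 by (auto simp: good_def wv_0)
  have \<gamma>: "\<gamma>0p = gpl" "\<gamma>0m = gmi" "\<gamma>xp = gxp" "E = EE"
    using assms(14-17) by (auto simp: fun_eq_iff gpl_def gmi_def gxp_def EE_def)
  show ?thesis
  proof (intro conjI impI, goal_cases)
    case 1
    \<comment> \<open>As 0 is outside the closure of \<open>B0\<close>, |c0| is bounded below; this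
      bounds \<open>gmi\<close>, hence w, uniformly in c.\<close>
    obtain d where d: "0 < d" "\<And>c. c \<in> B0 \<Longrightarrow> d \<le> norm c"
      using 1 unfolding closure_approachable by (auto simp: not_less)
    obtain b where b: "\<And>c. c \<in> Bt \<Longrightarrow> norm c \<le> b"
      using assms(8) by (auto simp: bounded_iff)
    define L where "L = (1 / d) / 2 * norm (\<theta>0 + \<theta>x + \<theta>inf) * (\<bar>b\<bar> * norm \<theta>x)"
    have L0: "0 \<le> L" using d by (simp add: L_def)
    have L: "norm (gmi c * gxp c) \<le> L" if c: "c \<in> B0 \<times> Bt" for c
    proof -
      have "d \<le> norm (fst c)" using d(2)[of "fst c"] c by auto
      then have "norm (inverse (fst c)) \<le> 1 / d"
        using d(1) le_imp_inverse_le[of d "norm (fst c)"] by (simp only: norm_inverse divide_inverse mult_1)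
      moreover have "norm (snd c) \<le> \<bar>b\<bar>" using b[of "snd c"] c by fastforce
      ultimately show ?thesis unfolding L_def gmi_def gxp_def norm_mult norm_divide using d(1)
        by (intro mult_mono divide_right_mono) (auto intro!: mult_nonneg_nonneg)
    qed
    \<comment> \<open>As |1/x| \<le> 1 on D, this gives |w| \<rho> \<le> L \<epsilon> \<rho> = L /
      (2 (L + 1)) < 1; the summand 1 covers L = 0.\<close>
    define \<epsilon> where "\<epsilon> = 1 / (2 * \<rho> * (L + 1))"
    have \<epsilon>: "0 < \<epsilon>" using pos L0 by (simp add: \<epsilon>_def)
    have good1: "good c z" if c: "c \<in> B0 \<times> Bt" and z: "z \<in> Sigma_star \<sigma>0 \<epsilon> R \<delta>" for c z
      unfolding good_def
    proof (intro conjI)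
      show "fst c \<noteq> 0" using c assms(13) by auto
      have "z \<in> sector_star R \<delta>" using z by (auto simp: Sigma_star_def sector_star_def)
      then show zD: "exp z \<in> D" using S1 by blast
      have "norm (wv c z) \<le> L * \<epsilon> * 1"
        unfolding wv_def norm_mult[of _ "inverse (exp z)"] norm_mult[of "gmi c * gxp c"]
        using L[OF c] z L0 \<epsilon> D_inverse_le1[OF zD]
        by (intro mult_mono) (auto simp: Sigma_star_def EE_def)
      then have "norm (wv c z) * \<rho> \<le> L * \<epsilon> * 1 * \<rho>" using pos by (intro mult_right_mono) auto
      also have "\<dots> = L / (2 * (L + 1))" using pos L0 by (simp add: \<epsilon>_def)
      also have "\<dots> < 1" using L0 by (simp add: divide_less_eq)
      finally show "norm (wv c z) * \<rho> < 1" .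
    qed
    have holo: "\<forall>h\<in>{F0, Fp, Fm, G0, Gp, Gm}. holo2 (B0 \<times> Bt) (Sigma_star \<sigma>0 \<epsilon> R \<delta>) h"
      by (rule solution_holo2) (rule good1)
    have solves: "\<forall>c\<in>B0 \<times> Bt. solves_S (\<lambda>z. sl2_mat (F0 c z) (Fp c z) (Fm c z))
        (\<lambda>z. sl2_mat (G0 c z) (Gp c z) (Gm c z)) (Sigma_star \<sigma>0 \<epsilon> R \<delta>)"
      by (intro ballI solution_solves good1)
    have g0: "\<forall>c\<in>B0 \<times> Bt. \<forall>z\<in>Sigma_star \<sigma>0 \<epsilon> R \<delta>. G0 c z = - \<theta>inf / 2 - F0 c z"
      by (simp add: G0_def)
    show ?case
      unfolding \<gamma> Let_def
      by (rule exI[of _ \<epsilon>], rule conjI, rule \<epsilon>, rule exI[of _ R], rule conjI, rule R0(1),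
        rule exI[of _ F0], rule exI[of _ Fp], rule exI[of _ Fm], rule exI[of _ G0], rule exI[of _ Gp], rule exI[of _ Gm],
        intro conjI, rule holo, rule solves, rule repr_F0[unfolded Let_def], erule (1) good1, rule S1, rule g0, rule repr_Fp[unfolded Let_def], erule (1) good1, rule S1, rule repr_Gp[unfolded Let_def], erule (1) good1, rule S1, rule repr_Fm[unfolded Let_def], erule (1) good1, rule S1, rule repr_Gm[unfolded Let_def], erule (1) good1, rule S1)
  next
    case 2
    show ?case
    proof (rule exI[of _ R], rule conjI, rule R0(1), rule exI[of _ "\<lambda>c. F0 (c, 0)"], rule exI[of _ "\<lambda>c. Fp (c, 0)"],
        rule exI[of _ "\<lambda>c. Fm (c, 0)"], rule exI[of _ "\<lambda>c. G0 (c, 0)"], rule exI[of _ "\<lambda>c. Gp (c, 0)"],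
        rule exI[of _ "\<lambda>c. Gm (c, 0)"], intro conjI)
      show "\<forall>h\<in>{\<lambda>c. F0 (c, 0), \<lambda>c. Fp (c, 0), \<lambda>c. Fm (c, 0), \<lambda>c. G0 (c, 0), \<lambda>c. Gp (c, 0), \<lambda>c. Gm (c, 0)}.
          holo1 B0 (Sigma_dstar R \<delta>) h"
        using solution_holo1[OF good2] by simp
      show "\<forall>c0\<in>B0. solves_S (\<lambda>z. sl2_mat (F0 (c0, 0) z) (Fp (c0, 0) z) (Fm (c0, 0) z))
          (\<lambda>z. sl2_mat (G0 (c0, 0) z) (Gp (c0, 0) z) (Gm (c0, 0) z)) (Sigma_dstar R \<delta>)"
        by (intro ballI solution_solves good2)
    qed (rule repr_one_parameter[OF _ S2], use assms(13) in blast)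
  qed
qed

end
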